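(* The coefficients of the series $$\mathbb{T}(z)=\mathrm{tr}_{1,\ldots,N}\,A^h_{(N)}\,\mathcal{T}_1(z)\,\mathcal{T}_2(ze^{-h})\cdots\mathcal{T}_N(ze^{-(N-1)h})\in\widetilde{\mathrm{Y}}(\widehat{\mathcal{R}})[[z^{\pm1}]]$$ belong to the center of $\widetilde{\mathrm{Y}}(\widehat{\mathcal{R}})$.
   Context: Fix an integer $N\geq2$ and a formal parameter $h$; $e_{ij}$ are the matrix units of $\mathrm{End}\,\mathbb{C}^N$. The trigonometric $R$-matrix of type $A$ is $$\mathcal{R}(x,y)=(xe^{-h/2}-ye^{h/2})\sum_{i}e_{ii}\otimes e_{ii}+(x-y)\sum_{i\neq j}e_{ii}\otimes e_{jj}+(e^{-h/2}-e^{h/2})x\sum_{i>j}e_{ij}\otimes e_{ji}+(e^{-h/2}-e^{h/2})y\sum_{i<j}e_{ij}\otimes e_{ji},$$ sums over $i,j=1,\ldots,N$, and $\widehat{\mathcal{R}}(x)=e^{-h/2}\mathcal{R}(x,1)$. $\mathrm{Y}(\widehat{\mathcal{R}})$ is the associative algebra over $\mathbb{C}[[h]]$ generated by $\tau_{ij}^{(r)}$, $r\in\mathbb{Z}$, $i,j=1,\ldots,N$, subject to $$\widehat{\mathcal{R}}(x/y)\mathcal{T}_1(x)\mathcal{T}_2(y)=\mathcal{T}_2(y)\mathcal{T}_1(x)\widehat{\mathcal{R}}(x/y),$$ where $\mathcal{T}(x)=\sum_{i,j}e_{ij}\otimes\tau_{ij}(x)$, $\tau_{ij}(x)=\sum_{r\in\mathbb{Z}}\tau_{ij}^{(-r)}x^r$,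 and $\mathcal{T}_k(x)$ is the copy whose matrix part acts on the $k$-th tensor factor. For $p\ge0$ let $I_p$ be the two-sided ideal generated by $h^{p+1}$ and all $\tau_{ij}^{(-r)}$ with $r>p$; the completed algebra is $\widetilde{\mathrm{Y}}(\widehat{\mathcal{R}})=\varprojlim\mathrm{Y}(\widehat{\mathcal{R}})/I_p$. Let $P^h=\sum_ie_{ii}\otimes e_{ii}+e^{h/2}\sum_{i>j}e_{ij}\otimes e_{ji}+e^{-h/2}\sum_{i<j}e_{ij}\otimes e_{ji}$. The symmetric group $\mathfrak{S}_N$ acts on $(\mathbb{C}^N)^{\otimes N}$ (with coefficients extended to $\mathbb{C}[[h]]$) so that the transposition $(i,i+1)$ acts as $P^h$ on the tensor factors $i,i+1$; $A^h_{(N)}$ is the image of $\frac{1}{N!}\sum_{p\in\mathfrak{S}_N}\mathrm{sgn}(p)\,p$ under this action. $\mathrm{tr}_{1,\ldots,N}$ is the trace over the $N$ tensor factors $\mathrm{End}\,\mathbb{C}^N$. *)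

theory Defs
  imports
    "HOL-Algebra.QuotRing"
    "HOL-Library.Poly_Mapping"
    "HOL-Library.FuncSet"
    "HOL-Combinatorics.Permutations"
    "HOL-Computational_Algebra.Polynomial"
    "HOL-Computational_Algebra.Formal_Power_Series"
begin

text \<open>The coefficient ring is \<^typ>\<open>complex fps\<close>, with h = \<^term>\<open>fps_X\<close> and
  exp(ch) = \<^term>\<open>fps_exp c\<close>.\<close>

section \<open>Tensor powers of the matrix algebra\<close>

text \<open>The standard basis of the m-th tensor power of the N-dimensional space is indexed by
  functions from \<open>{1..m}\<close> to \<open>{1..N}\<close>. An element of
  (End C^N)^{(x)m} (x) S is given by its matrix entries in S: the coefficient of
  e_{i_1 j_1} (x) ... (x) e_{i_m j_m} is the entry at row i and column j.\<close>

type_synonym 'a tmat = "(nat \<Rightarrow> nat) \<Rightarrow> (nat \<Rightarrow> nat) \<Rightarrow> 'a"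

definition multi :: "nat \<Rightarrow> nat \<Rightarrow> (nat \<Rightarrow> nat) set" where
  "multi N m = {1..m} \<rightarrow>\<^sub>E {1..N}"

definition tone :: "('a, 'b) ring_scheme \<Rightarrow> 'a tmat" where
  "tone S I J = (if I = J then \<one>\<^bsub>S\<^esub> else \<zero>\<^bsub>S\<^esub>)"

definition tmul :: "('a, 'b) ring_scheme \<Rightarrow> nat \<Rightarrow> nat \<Rightarrow> 'a tmat \<Rightarrow> 'a tmat \<Rightarrow> 'a tmat" where
  "tmul S N m A B I J = (\<Oplus>\<^bsub>S\<^esub>K\<in>multi N m. A I K \<otimes>\<^bsub>S\<^esub> B K J)"

definition ttrace :: "('a, 'b) ring_scheme \<Rightarrow> nat \<Rightarrow> nat \<Rightarrow> 'a tmat \<Rightarrow> 'a" where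
  "ttrace S N m A = (\<Oplus>\<^bsub>S\<^esub>I\<in>multi N m. A I I)"

text \<open>\<open>X i j\<close> is the coefficient of e_{ij}; the matrix acts on the k-th of m factors.\<close>

definition at_factor ::
    "('a, 'b) ring_scheme \<Rightarrow> nat \<Rightarrow> nat \<Rightarrow> (nat \<Rightarrow> nat \<Rightarrow> 'a) \<Rightarrow> 'a tmat" where
  "at_factor S m k X I J =
     (if \<forall>a\<in>{1..m} - {k}. I a = J a then X (I k) (J k) else \<zero>\<^bsub>S\<^esub>)"

text \<open>\<open>X i j k l\<close> is the coefficient of e_{ij} (x) e_{kl}; the operator acts on the
  factors k and k+1 of m.\<close>

definition at_pair ::
    "('a, 'b) ring_scheme \<Rightarrow> nat \<Rightarrow> nat \<Rightarrow> (nat \<Rightarrow> nat \<Rightarrow> nat \<Rightarrow> nat \<Rightarrow> 'a) \<Rightarrow> 'a tmat" where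
  "at_pair S m k X I J =
     (if \<forall>a\<in>{1..m} - {k, k + 1}. I a = J a
      then X (I k) (J k) (I (k + 1)) (J (k + 1)) else \<zero>\<^bsub>S\<^esub>)"

definition unit2 ::
    "nat \<Rightarrow> nat \<Rightarrow> nat \<Rightarrow> nat \<Rightarrow> nat \<Rightarrow> nat \<Rightarrow> nat \<Rightarrow> nat \<Rightarrow> 'a::zero_neq_one" where
  "unit2 i j k l a b c d = of_bool (a = i \<and> b = j \<and> c = k \<and> d = l)"

section \<open>The R-matrix\<close>

definition Rmat :: "nat \<Rightarrow> complex fps poly \<Rightarrow> complex fps poly
    \<Rightarrow> nat \<Rightarrow> nat \<Rightarrow> nat \<Rightarrow> nat \<Rightarrow> complex fps poly" where
  "Rmat N x y a b c d =
     (x * [:fps_exp (-1/2):] - y * [:fps_exp (1/2):]) * (\<Sum>i\<in>{1..N}. unit2 i i i i a b c d)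
   + (x - y) * (\<Sum>i\<in>{1..N}. \<Sum>j\<in>{1..N} - {i}. unit2 i i j j a b c d)
   + [:fps_exp (-1/2) - fps_exp (1/2):] * x * (\<Sum>i\<in>{1..N}. \<Sum>j\<in>{1..<i}. unit2 i j j i a b c d)
   + [:fps_exp (-1/2) - fps_exp (1/2):] * y * (\<Sum>i\<in>{1..N}. \<Sum>j\<in>{i<..N}. unit2 i j j i a b c d)"

text \<open>The normalized R-matrix in one variable u, the indeterminate \<open>[:0, 1:]\<close>.\<close>

definition Rhat :: "nat \<Rightarrow> nat \<Rightarrow> nat \<Rightarrow> nat \<Rightarrow> nat \<Rightarrow> complex fps poly" where
  "Rhat N a b c d = [:fps_exp (-1/2):] * Rmat N [:0, 1:] 1 a b c d"

section \<open>The antisymmetrizer\<close>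

definition fps_ring :: "complex fps ring" where
  "fps_ring = \<lparr>carrier = UNIV, monoid.mult = (*), one = 1, zero = 0, add = (+)\<rparr>"

definition Ph :: "nat \<Rightarrow> nat \<Rightarrow> nat \<Rightarrow> nat \<Rightarrow> nat \<Rightarrow> complex fps" where
  "Ph N a b c d =
     (\<Sum>i\<in>{1..N}. unit2 i i i i a b c d)
   + fps_exp (1/2) * (\<Sum>i\<in>{1..N}. \<Sum>j\<in>{1..<i}. unit2 i j j i a b c d)
   + fps_exp (-1/2) * (\<Sum>i\<in>{1..N}. \<Sum>j\<in>{i<..N}. unit2 i j j i a b c d)"

text \<open>An action of the symmetric group on \<open>{1..N}\<close> in which the adjacent transpositions act
  through \<^const>\<open>Ph\<close>. Matrices are only compared at basis indices.\<close>

definition is_Ph_action :: "nat \<Rightarrow> ((nat \<Rightarrow> nat) \<Rightarrow> complex fps tmat) \<Rightarrow> bool" where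
  "is_Ph_action N \<rho> \<longleftrightarrow>
     (\<forall>I\<in>multi N N. \<forall>J\<in>multi N N.
        \<rho> id I J = tone fps_ring I J \<and>
        (\<forall>p q. p permutes {1..N} \<longrightarrow> q permutes {1..N} \<longrightarrow>
            \<rho> (p \<circ> q) I J = tmul fps_ring N N (\<rho> p) (\<rho> q) I J) \<and>
        (\<forall>k\<in>{1..<N}. \<rho> (transpose k (k + 1)) I J = at_pair fps_ring N k (Ph N) I J))"

definition Ph_action :: "nat \<Rightarrow> (nat \<Rightarrow> nat) \<Rightarrow> complex fps tmat" where
  "Ph_action N = (SOME \<rho>. is_Ph_action N \<rho>)"

text \<open>The choice above is harmless. The values at basis indices are determined, since the
  adjacent transpositions generate the symmetric group. An action exists: conjugate the
  permutation of the tensor factors by exp(h/2) to the power of the number of inversions.\<close>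

definition Ph_inversions :: "nat \<Rightarrow> (nat \<Rightarrow> nat) \<Rightarrow> nat" where
  "Ph_inversions N I =
     (\<Sum>(a, b)\<in>{(a, b). a \<in> {1..N} \<and> b \<in> {1..N} \<and> a < b}. of_bool (I b < I a))"

definition Ph_model :: "nat \<Rightarrow> (nat \<Rightarrow> nat) \<Rightarrow> complex fps tmat" where
  "Ph_model N p I J =
     (if I = J \<circ> inv_into UNIV p
      then fps_exp ((of_nat (Ph_inversions N I) - of_nat (Ph_inversions N J)) / 2) else 0)"

lemma fps_ring_simps [simp]:
  "carrier fps_ring = UNIV" "x \<otimes>\<^bsub>fps_ring\<^esub> y = x * y" "x \<oplus>\<^bsub>fps_ring\<^esub> y = x + y"
  "\<one>\<^bsub>fps_ring\<^esub> = 1" "\<zero>\<^bsub>fps_ring\<^esub> = 0"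
  by (simp_all add: fps_ring_def)

lemma fps_ring_cring: "cring fps_ring"
proof (rule cringI)
  show "abelian_group fps_ring"
  proof (rule abelian_groupI)
    fix x :: "complex fps"
    show "\<exists>y\<in>carrier fps_ring. y \<oplus>\<^bsub>fps_ring\<^esub> x = \<zero>\<^bsub>fps_ring\<^esub>"
      by (rule bexI[of _ "- x"]) simp_all
  qed (simp_all add: algebra_simps)
  show "comm_monoid fps_ring"
    by (rule comm_monoidI) (simp_all add: algebra_simps)
qed (simp add: algebra_simps)

lemma finsum_fps_ring [simp]: "finsum fps_ring f A = sum f A"
proof -
  interpret cring fps_ring by (rule fps_ring_cring)
  show ?thesis
    by (induction A rule: infinite_finite_induct) (simp_all add: finsum_infinite)
qed

lemma finite_multi [simp]: "finite (multi N m)"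
  by (simp add: multi_def finite_PiE)

lemma multi_comp_permutes:
  assumes "I \<in> multi N m" "p permutes {1..m}"
  shows "I \<circ> p \<in> multi N m"
  using assms permutes_in_image[OF assms(2)] permutes_not_in[OF assms(2)]
  by (auto simp: multi_def PiE_iff extensional_def)

lemma Ph_inversions_swap:
  assumes k: "k \<in> {1..<N}" and less: "I (k + 1) < I k"
  shows "Ph_inversions N I = Suc (Ph_inversions N (I \<circ> transpose k (k + 1)))"
proof -
  let ?t = "transpose k (k + 1)"
  let ?P = "{(a, b). a \<in> {1..N} \<and> b \<in> {1..N} \<and> a < b}"
  let ?Q = "?P - {(k, k + 1)}"
  have "finite ?P"
    by (rule finite_subset[of _ "{1..N} \<times> {1..N}"]) auto
  moreover have "(k, k + 1) \<in> ?P"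
    using k by auto
  ultimately have split: "Ph_inversions N J =
      of_bool (J (k + 1) < J k) + (\<Sum>(a, b)\<in>?Q. of_bool (J b < J a))" for J
    unfolding Ph_inversions_def by (subst sum.remove[where x = "(k, k + 1)"]) auto
  have t_in: "(?t a, ?t b) \<in> ?Q" if "(a, b) \<in> ?Q" for a b
    using that k by (auto simp: transpose_def split: if_splits)
  have "(\<Sum>(a, b)\<in>?Q. of_bool (I b < I a) :: nat)
      = (\<Sum>(a, b)\<in>?Q. of_bool ((I \<circ> ?t) b < (I \<circ> ?t) a))"
    by (rule sum.reindex_bij_witness[of _ "\<lambda>(a, b). (?t a, ?t b)" "\<lambda>(a, b). (?t a, ?t b)"])
      (use t_in in \<open>auto simp del: transpose_eq_iff\<close>)
  then show ?thesis
    using less by (simp add: split)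
qed

lemma Ph_entry:
  assumes "a \<in> {1..N}" "b \<in> {1..N}" "c \<in> {1..N}" "d \<in> {1..N}"
  shows "Ph N a b c d = (if a = d \<and> b = c
    then (if a = b then 1 else if b < a then fps_exp (1/2) else fps_exp (-1/2)) else 0)"
proof -
  have 1: "(\<Sum>i\<in>{1..N}. unit2 i i i i a b c d :: complex fps) = of_bool (a = b \<and> b = c \<and> c = d)"
  proof -
    have "(\<Sum>i\<in>{1..N}. unit2 i i i i a b c d :: complex fps)
        = (\<Sum>i\<in>{1..N}. if i = a then of_bool (a = b \<and> b = c \<and> c = d) else 0)"
      by (rule sum.cong) (auto simp: unit2_def)
    then show ?thesis using assms by simp
  qed
  have 2: "(\<Sum>i\<in>{1..N}. \<Sum>j\<in>S i. unit2 i j j i a b c d :: complex fps)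
      = of_bool (a = d \<and> b = c \<and> b \<in> S a)" if "\<And>i. finite (S i)" for S :: "nat \<Rightarrow> nat set"
  proof -
    have "(\<Sum>i\<in>{1..N}. \<Sum>j\<in>S i. unit2 i j j i a b c d :: complex fps)
        = (\<Sum>i\<in>{1..N}. if i = a then (\<Sum>j\<in>S i. if j = b then of_bool (a = d \<and> b = c) else 0) else 0)"
      by (intro sum.cong) (auto simp: unit2_def intro!: sum.neutral sum.cong)
    then show ?thesis using assms that by simp
  qed
  have 3: "(\<Sum>i\<in>{1..N}. \<Sum>j\<in>{1..<i}. unit2 i j j i a b c d :: complex fps)
      = of_bool (a = d \<and> b = c \<and> b \<in> {1..<a})"
    by (rule 2) simp
  have 4: "(\<Sum>i\<in>{1..N}. \<Sum>j\<in>{i<..N}. unit2 i j j i a b c d :: complex fps)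
      = of_bool (a = d \<and> b = c \<and> b \<in> {a<..N})"
    by (rule 2) simp
  show ?thesis
    unfolding Ph_def 1 3 4 using assms by auto
qed

lemma Ph_model_action: "is_Ph_action N (Ph_model N)"
  unfolding is_Ph_action_def
proof (intro ballI conjI allI impI)
  fix I J assume I: "I \<in> multi N N" and J: "J \<in> multi N N"
  show "Ph_model N id I J = tone fps_ring I J"
    by (simp add: Ph_model_def tone_def)
  show "Ph_model N (p \<circ> q) I J = tmul fps_ring N N (Ph_model N p) (Ph_model N q) I J"
    if p: "p permutes {1..N}" and q: "q permutes {1..N}" for p q
  proof -
    let ?K = "J \<circ> inv_into UNIV q"
    have K: "?K \<in> multi N N"
      using J q by (intro multi_comp_permutes permutes_inv)
    have inv_comp: "inv_into UNIV (p \<circ> q) = inv_into UNIV q \<circ> inv_into UNIV p"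
      using p q by (intro o_inv_distrib) (auto simp: permutes_bij)
    have "tmul fps_ring N N (Ph_model N p) (Ph_model N q) I J
        = (\<Sum>K\<in>multi N N. if K = ?K then Ph_model N p I K * Ph_model N q K J else 0)"
      unfolding tmul_def finsum_fps_ring fps_ring_simps
      by (rule sum.cong) (auto simp: Ph_model_def)
    also have "\<dots> = Ph_model N p I ?K * Ph_model N q ?K J"
      using K by simp
    also have "\<dots> = Ph_model N (p \<circ> q) I J"
      by (auto simp: Ph_model_def inv_comp comp_assoc diff_divide_distrib
          simp flip: fps_exp_add_mult)
    finally show ?thesis ..
  qed
  show "Ph_model N (transpose k (k + 1)) I J = at_pair fps_ring N k (Ph N) I J"
    if k: "k \<in> {1..<N}" for k
  proof -
    let ?t = "transpose k (k + 1)"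
    have range: "I k \<in> {1..N}" "J k \<in> {1..N}" "I (k + 1) \<in> {1..N}" "J (k + 1) \<in> {1..N}"
      using I J k by (auto simp: multi_def PiE_iff)
    have eq: "I = J \<circ> ?t \<longleftrightarrow> (\<forall>a\<in>{1..N} - {k, k + 1}. I a = J a) \<and>
        I k = J (k + 1) \<and> I (k + 1) = J k" (is "_ \<longleftrightarrow> ?R")
    proof
      assume ?R
      show "I = J \<circ> ?t"
      proof
        fix a
        consider "a = k" | "a = k + 1" | "a \<in> {1..N} - {k, k + 1}" | "a \<notin> {1..N}" "a \<noteq> k" "a \<noteq> k + 1"
          using k by auto
        then show "I a = (J \<circ> ?t) a"
          using \<open>?R\<close> I J by cases (auto simp: multi_def PiE_iff extensional_def transpose_def)
      qed
    qed (auto simp: transpose_def)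
    show ?thesis
    proof (cases "I = J \<circ> ?t")
      case True
      then have R: "?R" and J': "J = I \<circ> ?t"
        using eq by (auto simp: comp_assoc)
      have at: "at_pair fps_ring N k (Ph N) I J =
          (if I k = J k then 1 else if J k < I k then fps_exp (1/2) else fps_exp (-1/2))"
        unfolding at_pair_def Ph_entry[OF range] using R by simp
      have model: "Ph_model N ?t I J =
          fps_exp ((of_nat (Ph_inversions N I) - of_nat (Ph_inversions N J)) / 2)"
        unfolding Ph_model_def inv_transpose_eq using True by (rule if_P)
      consider "I k = J k" | "J k < I k" | "I k < J k" by linarith
      then show ?thesis
      proof cases
        case 1
        then have "I = J"
          using True R by (metis comp_apply ext transpose_def)
        then show ?thesis
          unfolding at model using 1 by simp
      next
        case 2
        then have "I (k + 1) < I k"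
          using R by simp
        from Ph_inversions_swap[OF k this] have "Ph_inversions N I = Suc (Ph_inversions N J)"
          unfolding J'[symmetric] .
        then show ?thesis
          unfolding at model using 2 by (simp add: add_divide_distrib diff_divide_distrib)
      next
        case 3
        then have "J (k + 1) < J k"
          using R by simp
        from Ph_inversions_swap[OF k this] have "Ph_inversions N J = Suc (Ph_inversions N I)"
          unfolding True[symmetric] .
        then show ?thesis
          unfolding at model using 3 by (simp add: add_divide_distrib diff_divide_distrib)
      qed
    next
      case False
      then have "Ph_model N ?t I J = 0"
        unfolding Ph_model_def inv_transpose_eq by (rule if_not_P)
      moreover have "at_pair fps_ring N k (Ph N) I J = 0"
      proof -
        have "\<not> ?R"
          using False eq by blast
        then show ?thesis
          unfolding at_pair_def Ph_entry[OF range] by (auto simp del: One_nat_def)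
      qed
      ultimately show ?thesis by simp
    qed
  qed
qed

lemma Ph_action_exists: "is_Ph_action N (Ph_action N)"
  unfolding Ph_action_def by (rule someI[of "is_Ph_action N"]) (rule Ph_model_action)

definition antisymmetrizer :: "nat \<Rightarrow> complex fps tmat" where
  "antisymmetrizer N I J =
     fps_const (1 / fact N) * (\<Sum>p | p permutes {1..N}. of_int (sign p) * Ph_action N p I J)"

section \<open>The free algebra\<close>

text \<open>\<open>(i, j, r)\<close> stands for the generator tau_{ij}^{(r)}. The free algebra is the monoid
  algebra of the free monoid; \<^typ>\<open>_ \<Rightarrow>\<^sub>0 _\<close> requires the latter in additive notation.\<close>

type_synonym gen = "nat \<times> nat \<times> int"

datatype 'a fmonoid = Word (letters: "'a list")

instantiation fmonoid :: (type) monoid_add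
begin

definition zero_fmonoid :: "'a fmonoid" where
  "zero_fmonoid = Word []"

definition plus_fmonoid :: "'a fmonoid \<Rightarrow> 'a fmonoid \<Rightarrow> 'a fmonoid" where
  "plus_fmonoid u v = Word (letters u @ letters v)"

instance
  by standard (auto simp: zero_fmonoid_def plus_fmonoid_def)

end

type_synonym free = "gen fmonoid \<Rightarrow>\<^sub>0 complex fps"

definition free_alg :: "nat \<Rightarrow> free ring" where
  "free_alg N =
     \<lparr>carrier = {f. \<forall>w\<in>Poly_Mapping.keys f. set (letters w) \<subseteq> {1..N} \<times> {1..N} \<times> UNIV},
      monoid.mult = (*), one = 1, zero = 0, add = (+)\<rparr>"

lemma free_alg_simps [simp]:
  "f \<otimes>\<^bsub>free_alg N\<^esub> g = f * g" "f \<oplus>\<^bsub>free_alg N\<^esub> g = f + g"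
  "\<one>\<^bsub>free_alg N\<^esub> = 1" "\<zero>\<^bsub>free_alg N\<^esub> = 0"
  by (simp_all add: free_alg_def)

lemma free_alg_carrier_iff:
  "f \<in> carrier (free_alg N) \<longleftrightarrow>
     (\<forall>w\<in>Poly_Mapping.keys f. set (letters w) \<subseteq> {1..N} \<times> {1..N} \<times> UNIV)"
  by (simp add: free_alg_def)

lemma free_alg_ring: "ring (free_alg N)"
proof (rule ringI)
  have add: "f + g \<in> carrier (free_alg N)"
    if "f \<in> carrier (free_alg N)" "g \<in> carrier (free_alg N)" for f g
    using that Poly_Mapping.keys_add[of f g] unfolding free_alg_carrier_iff by blast
  have minus: "- f \<in> carrier (free_alg N)" if "f \<in> carrier (free_alg N)" for f
    using that unfolding free_alg_carrier_iff keys_minus .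
  have mult: "f * g \<in> carrier (free_alg N)"
    if f: "f \<in> carrier (free_alg N)" and g: "g \<in> carrier (free_alg N)" for f g
    unfolding free_alg_carrier_iff
  proof
    fix w assume "w \<in> Poly_Mapping.keys (f * g)"
    then obtain u v where uv: "w = u + v" "u \<in> Poly_Mapping.keys f" "v \<in> Poly_Mapping.keys g"
      using keys_mult[of f g] by blast
    have "set (letters w) = set (letters u) \<union> set (letters v)"
      by (simp add: uv(1) plus_fmonoid_def)
    then show "set (letters w) \<subseteq> {1..N} \<times> {1..N} \<times> UNIV"
      using uv f g unfolding free_alg_carrier_iff by blast
  qed
  have zero: "0 \<in> carrier (free_alg N)"
    unfolding free_alg_carrier_iff by simp
  have one: "1 \<in> carrier (free_alg N)"
    unfolding free_alg_carrier_iff by (simp add: zero_fmonoid_def flip: single_one)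
  show "abelian_group (free_alg N)"
  proof (rule abelian_groupI)
    fix f assume "f \<in> carrier (free_alg N)"
    then show "\<exists>g\<in>carrier (free_alg N). g \<oplus>\<^bsub>free_alg N\<^esub> f = \<zero>\<^bsub>free_alg N\<^esub>"
      by (intro bexI[of _ "- f"] minus) simp
  qed (simp_all add: add zero algebra_simps)
  show "monoid (free_alg N)"
    by (rule monoidI) (simp_all add: mult one algebra_simps)
qed (simp_all add: algebra_simps)

definition fscal :: "complex fps \<Rightarrow> free" where
  "fscal c = Poly_Mapping.single 0 c"

definition ftau :: "nat \<Rightarrow> nat \<Rightarrow> int \<Rightarrow> free" where
  "ftau i j r = Poly_Mapping.single (Word [(i, j, r)]) 1"

section \<open>The algebra of the RTT relation\<close>

text \<open>With R_s the coefficient of u^s in the normalized R-matrix (s = 0, 1) and T[r] the coefficient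
  of x^r in T(x), the coefficients of x^a y^b on the two sides of
  R(x/y) T_1(x) T_2(y) = T_2(y) T_1(x) R(x/y).\<close>

definition Rhat_coeff :: "nat \<Rightarrow> nat \<Rightarrow> free tmat" where
  "Rhat_coeff N s =
     at_pair (free_alg N) 2 1 (\<lambda>i j k l. fscal (coeff (Rhat N i j k l) s))"

definition ftau_at :: "nat \<Rightarrow> nat \<Rightarrow> int \<Rightarrow> free tmat" where
  "ftau_at N k r = at_factor (free_alg N) 2 k (\<lambda>i j. ftau i j (- r))"

definition rtt_lhs :: "nat \<Rightarrow> int \<Rightarrow> int \<Rightarrow> free tmat" where
  "rtt_lhs N a b I J =
     (\<Oplus>\<^bsub>free_alg N\<^esub>s\<in>{0, 1::nat}.
        tmul (free_alg N) N 2 (Rhat_coeff N s)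
          (tmul (free_alg N) N 2 (ftau_at N 1 (a - int s)) (ftau_at N 2 (b + int s))) I J)"

definition rtt_rhs :: "nat \<Rightarrow> int \<Rightarrow> int \<Rightarrow> free tmat" where
  "rtt_rhs N a b I J =
     (\<Oplus>\<^bsub>free_alg N\<^esub>s\<in>{0, 1::nat}.
        tmul (free_alg N) N 2
          (tmul (free_alg N) N 2 (ftau_at N 2 (b + int s)) (ftau_at N 1 (a - int s)))
          (Rhat_coeff N s) I J)"

definition rtt_ideal :: "nat \<Rightarrow> free set" where
  "rtt_ideal N = Idl\<^bsub>free_alg N\<^esub>
     {rtt_lhs N a b I J \<ominus>\<^bsub>free_alg N\<^esub> rtt_rhs N a b I J | a b I J.
        I \<in> multi N 2 \<and> J \<in> multi N 2}"

definition Y :: "nat \<Rightarrow> free set ring" where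
  "Y N = free_alg N Quot rtt_ideal N"

definition yscal :: "nat \<Rightarrow> complex fps \<Rightarrow> free set" where
  "yscal N c = rtt_ideal N +>\<^bsub>free_alg N\<^esub> fscal c"

definition tau :: "nat \<Rightarrow> nat \<Rightarrow> nat \<Rightarrow> int \<Rightarrow> free set" where
  "tau N i j r = rtt_ideal N +>\<^bsub>free_alg N\<^esub> ftau i j r"

section \<open>The completion\<close>

definition inverse_limit :: "(nat \<Rightarrow> 'a ring) \<Rightarrow> (nat \<Rightarrow> 'a \<Rightarrow> 'a) \<Rightarrow> (nat \<Rightarrow> 'a) ring" where
  "inverse_limit R \<phi> =
     \<lparr>carrier = {f. (\<forall>p. f p \<in> carrier (R p)) \<and> (\<forall>p. \<phi> p (f (Suc p)) = f p)},
      monoid.mult = (\<lambda>f g p. f p \<otimes>\<^bsub>R p\<^esub> g p),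
      one = (\<lambda>p. \<one>\<^bsub>R p\<^esub>),
      zero = (\<lambda>p. \<zero>\<^bsub>R p\<^esub>),
      add = (\<lambda>f g p. f p \<oplus>\<^bsub>R p\<^esub> g p)\<rparr>"

definition ring_center :: "('a, 'b) ring_scheme \<Rightarrow> 'a set" where
  "ring_center R = {z \<in> carrier R. \<forall>x\<in>carrier R. z \<otimes>\<^bsub>R\<^esub> x = x \<otimes>\<^bsub>R\<^esub> z}"

definition I_ideal :: "nat \<Rightarrow> nat \<Rightarrow> free set set" where
  "I_ideal N p = Idl\<^bsub>Y N\<^esub>
     ({yscal N (fps_X ^ (p + 1))} \<union>
      {tau N i j (- r) | i j r. i \<in> {1..N} \<and> j \<in> {1..N} \<and> r > int p})"

text \<open>The transition map sends a coset x + I_{p+1} to the coset x + I_p = I_p + (x + I_{p+1}).\<close>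

definition Ycompl :: "nat \<Rightarrow> (nat \<Rightarrow> free set set) ring" where
  "Ycompl N = inverse_limit (\<lambda>p. Y N Quot I_ideal N p) (\<lambda>p X. I_ideal N p <+>\<^bsub>Y N\<^esub> X)"

definition to_compl :: "nat \<Rightarrow> free set \<Rightarrow> nat \<Rightarrow> free set set" where
  "to_compl N y = (\<lambda>p. I_ideal N p +>\<^bsub>Y N\<^esub> y)"

text \<open>The sum in the completion of a family in \<open>Y N\<close> of which, for every p, only finitely many
  members are nonzero modulo I_p.\<close>

definition compl_sum :: "nat \<Rightarrow> ('i \<Rightarrow> free set) \<Rightarrow> 'i set \<Rightarrow> nat \<Rightarrow> free set set" where
  "compl_sum N f A = (\<lambda>p.
     \<Oplus>\<^bsub>Y N Quot I_ideal N p\<^esub>a\<in>{a \<in> A. to_compl N (f a) p \<noteq> \<zero>\<^bsub>Y N Quot I_ideal N p\<^esub>}.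
       to_compl N (f a) p)"

section \<open>The series\<close>

text \<open>The coefficient of z^r in T_k(z exp(-(k-1)h)).\<close>

definition T_coeff :: "nat \<Rightarrow> nat \<Rightarrow> int \<Rightarrow> free set tmat" where
  "T_coeff N k r I J =
     yscal N (fps_exp (- of_int ((int k - 1) * r)))
       \<otimes>\<^bsub>Y N\<^esub> at_factor (Y N) N k (\<lambda>i j. tau N i j (- r)) I J"

definition T_word :: "nat \<Rightarrow> (nat \<Rightarrow> int) \<Rightarrow> free set tmat" where
  "T_word N r = foldr (\<lambda>k M. tmul (Y N) N N (T_coeff N k (r k)) M) [1..<N + 1] (tone (Y N))"

text \<open>The coefficient of z^n in T_1(z) T_2(z exp(-h)) ... T_N(z exp(-(N-1)h)). Modulo I_p only
  the exponents with all \<open>r k \<le> p\<close> contribute.\<close>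

definition T_prod :: "nat \<Rightarrow> int \<Rightarrow> (nat \<Rightarrow> free set set) tmat" where
  "T_prod N n I J =
     compl_sum N (\<lambda>r. T_word N r I J) {r \<in> {1..N} \<rightarrow>\<^sub>E UNIV. (\<Sum>k\<in>{1..N}. r k) = n}"

definition TT :: "nat \<Rightarrow> int \<Rightarrow> nat \<Rightarrow> free set set" where
  "TT N n = ttrace (Ycompl N) N N
     (tmul (Ycompl N) N N (\<lambda>I J. to_compl N (yscal N (antisymmetrizer N I J))) (T_prod N n))"

end

theory Submission
  imports Defs "HOL-Computational_Algebra.Formal_Laurent_Series"
begin

text \<open>Write \<open>q = exp(h/2)\<close>, let \<open>P\<^sub>k\<close> be the involution \<open>P\<^sup>h\<close> on the tensor factors \<open>k, k+1\<close>, and let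
\<open>T\<^sub>k\<close> stand for \<open>T\<^sub>k(z exp(-(k-1)h))\<close>. The series is a scalar multiple of a quantum determinant, and the
quantum determinant is central by the usual fusion argument.

Fusion. Since \<open>R(x, x exp(-h)) = x (1 - exp(-h)) (1 - P\<^sup>h)\<close>, the RTT relation at \<open>y = x exp(-h)\<close> should say
\<open>(1 - P\<^sub>k) T\<^sub>k T\<^sub>k\<^sub>+\<^sub>1 = T\<^sub>k\<^sub>+\<^sub>1 T\<^sub>k (1 - P\<^sub>k)\<close> and hence, as \<open>P\<^sub>k\<close> is an involution,
\<open>(1 - P\<^sub>k) T\<^sub>k T\<^sub>k\<^sub>+\<^sub>1 (1 + P\<^sub>k) = 0\<close>. The substitution only gives this multiplied by \<open>1 - exp(-h)\<close>, and
\<open>h\<close> is nilpotent in the quotients by \<open>I\<^sub>p\<close>. The lemma \<open>conv_exchange\<close> avoids the division: \<open>R(x, y)\<close> is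
\<open>x - y\<close> times a constant matrix plus \<open>(1/q - q) x\<close> times the flip, so the RTT relation expresses differences of certain
coefficients as multiples of \<open>1/q - q\<close>, and a summation by parts (\<open>abel_summation\<close>) produces exactly the factor
\<open>1 - exp(-h)\<close> that has to be cancelled.

Skew-symmetric words. Let \<open>\<epsilon>\<close> be the row vector with the entries \<open>q_sign N J\<close>, that is, \<open>(-1/q)\<close> to the number of
inversions of \<open>J\<close>, and 0 if \<open>J\<close> repeats a letter; then \<open>\<epsilon> P\<^sub>k = - \<epsilon>\<close>. If \<open>(1 - P\<^sub>k) F (1 + P\<^sub>k) = 0\<close> for all \<open>k\<close>, then
\<open>\<epsilon> F (1 + P\<^sub>k) = \<epsilon> P\<^sub>k F (1 + P\<^sub>k) = - \<epsilon> F (1 + P\<^sub>k)\<close>, so \<open>\<epsilon> F (1 + P\<^sub>k) = 0\<close>, and sorting words shows that such a row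
vector is a multiple of \<open>\<epsilon>\<close> (\<open>skew_of_fusion\<close>, \<open>skew_determined\<close>). In particular \<open>\<epsilon> T\<^sub>1 \<dots> T\<^sub>N = D \<epsilon>\<close>, which defines the
quantum determinant \<open>D\<close>. The rows of the antisymmetrizer \<open>A\<close> are multiples of \<open>\<epsilon>\<close> as well, whence
\<open>A T\<^sub>1 \<dots> T\<^sub>N = D A\<close>, and the trace is \<open>tr(A) D\<close> (\<open>TT_image\<close>).

Centrality of \<open>D\<close>. Let \<open>T\<^sub>0(x)\<close> act on a further tensor factor. The RTT relation gives
\<open>R\<^sub>0\<^sub>N \<dots> R\<^sub>0\<^sub>1 T\<^sub>0 T\<^sub>1 \<dots> T\<^sub>N = T\<^sub>1 \<dots> T\<^sub>N T\<^sub>0 R\<^sub>0\<^sub>N \<dots> R\<^sub>0\<^sub>1\<close>. The product of the R-matrices satisfies the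
fusion identity, too, and so \<open>\<epsilon> R\<^sub>0\<^sub>N \<dots> R\<^sub>0\<^sub>1\<close> is \<open>\<epsilon>\<close> times a matrix on the factor 0; that matrix turns out to be a scalar
\<open>f\<close>, a product of \<open>N\<close> linear factors in \<open>x\<close> and \<open>z\<close>. Applying \<open>\<epsilon>\<close> to both sides yields \<open>f (T\<^sub>0 D - D T\<^sub>0) = 0\<close>
(\<open>qdet_commutes\<close>), and \<open>f\<close> is not a zero divisor (\<open>eigenvalue_regular\<close>).

Where this takes place. In the quotient by \<open>I\<^sub>p\<close> the series \<open>T(x)\<close> contains no power of \<open>x\<close> above \<open>p\<close>, so it is
a Laurent series in \<open>1/x\<close>, and all products above make sense as Laurent series in \<open>1/x\<close> over Laurent series in \<open>1/z\<close>.
These series have coefficients in a type of class \<^class>\<open>ring_1\<close>, whereas the quotients are ring records; every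
\<open>\<complex>[[h]]\<close>-algebra with elements of type \<open>'a\<close> embeds into the product of all such algebras, which is a type
(\<open>'a algebra_product\<close>). Thus the coefficients of the series commute with the generators in every
quotient by \<open>I\<^sub>p\<close>, and therefore with every element of the inverse limit.\<close>

section \<open>Signs and weights of words\<close>

lemma fps_exp_mult_collect:
  "fps_exp a * fps_exp b = fps_exp (a + b :: complex)"
  "fps_exp a * (fps_exp b * x) = fps_exp (a + b) * x"
  by (simp_all add: fps_exp_add_mult mult.assoc)

text \<open>The operator \<open>P\<^sup>h\<close> on the factors \<open>k, k+1\<close> sends the basis vector of the word \<open>J\<close> to
\<open>swap_weight (J (Suc k)) (J k)\<close> times that of the word with the letters \<open>k, k+1\<close> exchanged.\<close>

definition swap_weight :: "nat \<Rightarrow> nat \<Rightarrow> complex fps" where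
  "swap_weight a b = (if a = b then 1 else if b < a then fps_exp (1/2) else fps_exp (-1/2))"

text \<open>The row vector \<open>\<epsilon>\<close> on which every \<open>P\<^sub>k\<close> acts by \<open>-1\<close> from the right (\<open>q_sign_swap\<close>).\<close>

definition q_sign :: "nat \<Rightarrow> (nat \<Rightarrow> nat) \<Rightarrow> complex fps" where
  "q_sign N K = (if inj_on K {1..N} then (- fps_exp (-1/2)) ^ Ph_inversions N K else 0)"

abbreviation swap_at :: "nat \<Rightarrow> (nat \<Rightarrow> nat) \<Rightarrow> nat \<Rightarrow> nat" where
  "swap_at k K \<equiv> K \<circ> transpose k (Suc k)"

definition id_word :: "nat \<Rightarrow> nat \<Rightarrow> nat" where
  "id_word N = restrict id {1..N}"

lemma swap_at_values [simp]:
  "swap_at k K k = K (Suc k)" "swap_at k K (Suc k) = K k"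
  "i \<noteq> k \<Longrightarrow> i \<noteq> Suc k \<Longrightarrow> swap_at k K i = K i"
  by (simp_all add: transpose_def)

lemma swap_at_swap_at [simp]: "swap_at k (swap_at k K) = K"
  by (simp add: comp_assoc)

lemma transpose_permutes:
  "k \<in> {1..<N} \<Longrightarrow> transpose k (Suc k) permutes {1..N::nat}"
  by (rule permutes_swap_id) auto

lemma swap_at_multi: "K \<in> multi N N \<Longrightarrow> k \<in> {1..<N} \<Longrightarrow> swap_at k K \<in> multi N N"
  by (rule multi_comp_permutes[OF _ transpose_permutes])

lemma multi_range: "K \<in> multi N m \<Longrightarrow> i \<in> {1..m} \<Longrightarrow> K i \<in> {1..N}"
  by (auto simp: multi_def PiE_iff)

lemma id_word_multi: "id_word N \<in> multi N N"
  by (auto simp: id_word_def multi_def)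

lemma q_sign_id: "q_sign N (id_word N) = 1"
proof -
  have "Ph_inversions N (id_word N) = 0"
    by (auto simp: Ph_inversions_def id_word_def intro!: sum.neutral)
  then show ?thesis
    by (simp add: q_sign_def id_word_def inj_on_def)
qed

lemma swap_weight_inverse: "swap_weight a b * swap_weight b a = 1"
  by (auto simp: swap_weight_def fps_exp_mult_collect)

lemma inversions_swap:
  assumes "k \<in> {1..<N}" "I (Suc k) < I k"
  shows "Ph_inversions N I = Suc (Ph_inversions N (swap_at k I))"
  using Ph_inversions_swap[of k N I] assms by simp

lemma q_sign_swap:
  assumes k: "k \<in> {1..<N}"
  shows "q_sign N (swap_at k K) = - swap_weight (K k) (K (Suc k)) * q_sign N K"
proof (cases "inj_on K {1..N}")
  case False
  then have "\<not> inj_on (swap_at k K) {1..N}"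
    using transpose_permutes[OF k]
    by (metis comp_inj_on_iff permutes_inj_on permutes_image)
  then show ?thesis using False by (simp add: q_sign_def)
next
  case True
  then have inj: "inj_on (swap_at k K) {1..N}"
    using transpose_permutes[OF k]
    by (metis comp_inj_on_iff permutes_inj_on permutes_image)
  have "K k \<noteq> K (Suc k)"
    using inj_onD[OF True, of k "Suc k"] k by auto
  then consider "K (Suc k) < K k" | "K k < K (Suc k)"
    by linarith
  then show ?thesis
  proof cases
    case 1
    from inversions_swap[OF k, of K, OF 1] show ?thesis
      using inj True 1 by (simp add: q_sign_def swap_weight_def fps_exp_mult_collect)
  next
    case 2
    then have "swap_at k K (Suc k) < swap_at k K k" by simp
    from inversions_swap[OF k, of "swap_at k K", OF this] show ?thesis
      unfolding swap_at_swap_at using inj True 2 by (simp add: q_sign_def swap_weight_def)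
  qed
qed

text \<open>A strictly increasing word satisfies \<open>i \<le> J i\<close>, by counting from the left end, and \<open>J i \<le> i\<close>, by counting
from the right end.\<close>

lemma increasing_word_id:
  assumes J: "J \<in> multi N N" and less: "\<And>k. k \<in> {1..<N} \<Longrightarrow> J k < J (Suc k)"
  shows "J = id_word N"
proof -
  have lower: "i \<in> {1..N} \<Longrightarrow> i \<le> J i" for i
  proof (induction i)
    case (Suc i)
    show ?case
    proof (cases "i = 0")
      case True
      then show ?thesis using multi_range[OF J Suc.prems] by simp
    next
      case False
      then have "i \<le> J i" "J i < J (i + 1)"
        using Suc less[of i] by simp_all
      then show ?thesis by simp
    qed
  qed simp
  have upper: "i < N \<Longrightarrow> J (N - i) \<le> N - i" for i
  proof (induction i)
    case 0
    then show ?case using multi_range[OF J, of N] by simp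
  next
    case (Suc i)
    then have "J (N - Suc i) < J (N - i)"
      using less[of "N - Suc i"] by (simp add: Suc_diff_Suc)
    with Suc show ?case by simp
  qed
  show ?thesis
  proof
    fix i
    show "J i = id_word N i"
    proof (cases "i \<in> {1..N}")
      case True
      then show ?thesis using lower[OF True] upper[of "N - i"] by (simp add: id_word_def)
    next
      case False
      then show ?thesis using J by (auto simp: id_word_def multi_def PiE_iff extensional_def)
    qed
  qed
qed

section \<open>Skew-symmetric functions of words\<close>

text \<open>A unital algebra over \<open>\<complex>[[h]]\<close>, given by its structure map; multiplication by a scalar need not be injective.\<close>

locale central_scalars =
  fixes s :: "complex fps \<Rightarrow> 'a::ring_1"
  assumes s_one [simp]: "s 1 = 1"
    and s_add: "s (c + d) = s c + s d"
    and s_mult: "s (c * d) = s c * s d"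
    and s_central: "s c * x = x * s c"
begin

lemma s_zero [simp]: "s 0 = 0"
  using s_add[of 0 0] by simp

lemma s_minus: "s (- c) = - s c"
  using s_add[of c "- c"] by (simp add: eq_neg_iff_add_eq_0 add.commute)

lemma s_diff: "s (c - d) = s c - s d"
  using s_add[of c "- d"] by (simp add: s_minus)

lemma s_sum: "s (sum f A) = (\<Sum>i\<in>A. s (f i))"
  by (induction A rule: infinite_finite_induct) (simp_all add: s_add)

lemma s_left_commute: "x * (s c * y) = s c * (x * y)"
  by (metis s_central mult.assoc)

lemma s_commute: "s c * (s d * x) = s d * (s c * x)"
  by (rule s_left_commute)

text \<open>The scalars contain \<open>1/2\<close>, so there is no 2-torsion.\<close>

lemma eq_zero_of_eq_minus:
  assumes "x = (- x :: 'a)"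
  shows "x = 0"
proof -
  have "s (fps_const (1/2)) * (x + x) = s (fps_const (1/2) + fps_const (1/2)) * x"
    by (simp only: s_add distrib_left distrib_right)
  moreover have "x + x = 0"
    using assms by (simp only: eq_neg_iff_add_eq_0)
  moreover have "fps_const (1/2) + fps_const (1/2) = (1 :: complex fps)"
    by simp
  ultimately show ?thesis by (simp only: mult_zero_right s_one mult_1_left)
qed

text \<open>The row vector \<open>u\<close> satisfies \<open>u (1 + P\<^sub>k) = 0\<close> for all \<open>k\<close>.\<close>

definition skew :: "nat \<Rightarrow> ((nat \<Rightarrow> nat) \<Rightarrow> 'a) \<Rightarrow> bool" where
  "skew N u \<longleftrightarrow> (\<forall>J\<in>multi N N. \<forall>k\<in>{1..<N}.
     u J + s (swap_weight (J (Suc k)) (J k)) * u (swap_at k J) = 0)"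

text \<open>Exchanging two neighbouring letters that are out of order reduces the number of inversions and multiplies both sides by
the same factor. A word without such letters either has two equal neighbours, where both sides vanish, or is the word
\<open>1 2 \<dots> N\<close>.\<close>

lemma skew_determined:
  assumes "skew N u" "J \<in> multi N N"
  shows "u J = s (q_sign N J) * u (id_word N)"
  using assms(2)
proof (induction "Ph_inversions N J" arbitrary: J rule: less_induct)
  case less
  have skew: "u J = - s (swap_weight (J (Suc k)) (J k)) * u (swap_at k J)"
    if "k \<in> {1..<N}" for k
    using assms(1) less.prems that by (simp add: skew_def eq_neg_iff_add_eq_0)
  consider "\<exists>k\<in>{1..<N}. J (Suc k) < J k" | "\<exists>k\<in>{1..<N}. J k = J (Suc k)"
    | "\<forall>k\<in>{1..<N}. J k < J (Suc k)"
    by (meson linorder_neqE_nat)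
  then show ?case
  proof cases
    case 1
    then obtain k where k: "k \<in> {1..<N}" "J (Suc k) < J k" by blast
    have IH: "u (swap_at k J) = s (q_sign N (swap_at k J)) * u (id_word N)"
      using inversions_swap[where I = J, OF k] swap_at_multi[OF less.prems k(1)]
      by (intro less.hyps) simp_all
    have "q_sign N J = - swap_weight (J (Suc k)) (J k) * q_sign N (swap_at k J)"
      using q_sign_swap[OF k(1), of "swap_at k J"] unfolding swap_at_swap_at by simp
    then show ?thesis
      unfolding skew[OF k(1)] IH by (simp add: s_mult s_minus mult.assoc)
  next
    case 2
    \<comment> \<open>Exchanging equal letters has weight 1, so \<open>u J\<close> equals its own negative.\<close>
    then obtain k where k: "k \<in> {1..<N}" "J k = J (Suc k)" by blast
    have fixed: "swap_at k J = J"
    proof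
      show "swap_at k J i = J i" for i
        using k(2) by (cases "i = k"; cases "i = Suc k") (simp_all add: transpose_def)
    qed
    have eq: "u J = - s (swap_weight (J (Suc k)) (J k)) * u J"
      by (rule skew[OF k(1), unfolded fixed])
    have "swap_weight (J (Suc k)) (J k) = 1"
      unfolding swap_weight_def by (rule if_P) (rule k(2)[symmetric])
    then have w: "s (swap_weight (J (Suc k)) (J k)) = 1"
      by (simp only: s_one)
    have "u J = - u J"
      by (rule trans[OF eq]) (simp only: w mult_minus1)
    then have "u J = 0"
      by (rule eq_zero_of_eq_minus)
    moreover have "\<not> inj_on J {1..N}"
      using inj_onD[of J "{1..N}" k "Suc k"] k by auto
    then have "q_sign N J = 0"
      by (simp add: q_sign_def)
    ultimately show ?thesis by simp
  next
    case 3
    then show ?thesis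
      using increasing_word_id[OF less.prems] by (simp add: q_sign_id)
  qed
qed

text \<open>The entry at row \<open>K\<close> and column \<open>L\<close> of \<open>(1 - P\<^sub>k) F (1 + P\<^sub>k)\<close>.\<close>

definition fusion_defect where
  "fusion_defect k F K L =
     F K L - s (swap_weight (K k) (K (Suc k))) * F (swap_at k K) L
     + s (swap_weight (L (Suc k)) (L k))
       * (F K (swap_at k L) - s (swap_weight (K k) (K (Suc k))) * F (swap_at k K) (swap_at k L))"

text \<open>From \<open>F (1 + P\<^sub>k) = P\<^sub>k F (1 + P\<^sub>k)\<close> and \<open>\<epsilon> P\<^sub>k = - \<epsilon>\<close> one gets \<open>\<epsilon> F (1 + P\<^sub>k) = - \<epsilon> F (1 + P\<^sub>k)\<close>, so this row vector
vanishes. In the proof, \<open>G\<close> is \<open>F (1 + P\<^sub>k)\<close> at the column \<open>L\<close>, and the multiplication by \<open>P\<^sub>k\<close> is a reindexing of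
the sum over rows.\<close>

lemma skew_of_fusion:
  assumes "\<And>k K L. k \<in> {1..<N} \<Longrightarrow> K \<in> multi N N \<Longrightarrow> L \<in> multi N N \<Longrightarrow> fusion_defect k F K L = 0"
  shows "skew N (\<lambda>L. \<Sum>K\<in>multi N N. s (q_sign N K) * F K L)"
  unfolding skew_def
proof (intro ballI)
  fix L k assume L: "L \<in> multi N N" and k: "k \<in> {1..<N}"
  let ?w = "s (swap_weight (L (Suc k)) (L k))"
  define G where "G K = F K L + ?w * F K (swap_at k L)" for K
  have G: "G K = s (swap_weight (K k) (K (Suc k))) * G (swap_at k K)" if "K \<in> multi N N" for K
    using assms[OF k that L] unfolding fusion_defect_def G_def
    by (simp add: algebra_simps s_commute)
  let ?X = "\<Sum>K\<in>multi N N. s (q_sign N K) * G K"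
  have "?X = (\<Sum>K\<in>multi N N. - (s (q_sign N (swap_at k K)) * G (swap_at k K)))"
  proof (rule sum.cong[OF refl])
    fix K assume K: "K \<in> multi N N"
    show "s (q_sign N K) * G K = - (s (q_sign N (swap_at k K)) * G (swap_at k K))"
      unfolding q_sign_swap[OF k] by (subst G[OF K]) (simp add: s_mult s_minus mult.assoc s_commute)
  qed
  also have "\<dots> = - (\<Sum>K\<in>multi N N. s (q_sign N (swap_at k K)) * G (swap_at k K))"
    by (rule sum_negf)
  also have "(\<Sum>K\<in>multi N N. s (q_sign N (swap_at k K)) * G (swap_at k K)) = ?X"
    by (rule sum.reindex_bij_witness[of _ "swap_at k" "swap_at k"])
      (use swap_at_multi[OF _ k] in simp_all)
  finally have "?X = 0"
    by (rule eq_zero_of_eq_minus)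
  then show "(\<Sum>K\<in>multi N N. s (q_sign N K) * F K L)
      + ?w * (\<Sum>K\<in>multi N N. s (q_sign N K) * F K (swap_at k L)) = 0"
    by (simp add: G_def algebra_simps sum.distrib sum_distrib_left s_commute)
qed

lemma q_minor_expansion:
  assumes "\<And>k K L. k \<in> {1..<N} \<Longrightarrow> K \<in> multi N N \<Longrightarrow> L \<in> multi N N \<Longrightarrow> fusion_defect k F K L = 0"
    and "L \<in> multi N N"
  shows "(\<Sum>K\<in>multi N N. s (q_sign N K) * F K L)
    = s (q_sign N L) * (\<Sum>K\<in>multi N N. s (q_sign N K) * F K (id_word N))"
  using skew_determined[OF skew_of_fusion[OF assms(1)] assms(2)] by blast

end

section \<open>The fusion identity for the R-matrix\<close>

text \<open>The coefficients of \<open>x\<close> and, below, of \<open>y\<close> in the entry \<open>e\<^sub>a\<^sub>c \<otimes> e\<^sub>b\<^sub>d\<close> of \<open>R(x, y)\<close>. Rows come first: the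
arguments are the row word \<open>a b\<close> followed by the column word \<open>c d\<close>.\<close>

definition r_hi :: "nat \<Rightarrow> nat \<Rightarrow> nat \<Rightarrow> nat \<Rightarrow> complex fps" where
  "r_hi a b c d =
    (if a = c \<and> b = d then (if a = b then fps_exp (-1/2) else 1)
     else if a = d \<and> b = c \<and> b < a then fps_exp (-1/2) - fps_exp (1/2) else 0)"

definition r_lo :: "nat \<Rightarrow> nat \<Rightarrow> nat \<Rightarrow> nat \<Rightarrow> complex fps" where
  "r_lo a b c d =
    (if a = c \<and> b = d then (if a = b then - fps_exp (1/2) else - 1)
     else if a = d \<and> b = c \<and> a < b then fps_exp (-1/2) - fps_exp (1/2) else 0)"

lemma r_hi_sum:
  assumes "a \<in> {1..N}" "b \<in> {1..N}"
  shows "(\<Sum>e\<in>{1..N}. r_hi a b e d * g e) =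
    (if b = d then r_hi a b a b * g a else if a = d then r_hi a b b a * g b else 0)"
proof -
  have "(\<Sum>e\<in>{1..N}. r_hi a b e d * g e) = (\<Sum>e\<in>{if b = d then a else b}. r_hi a b e d * g e)"
    using assms by (intro sum.mono_neutral_right) (auto simp: r_hi_def)
  then show ?thesis by (auto simp: r_hi_def)
qed

lemma r_lo_sum:
  assumes "a \<in> {1..N}" "b \<in> {1..N}"
  shows "(\<Sum>e\<in>{1..N}. r_lo a b e d * g e) =
    (if b = d then r_lo a b a b * g a else if a = d then r_lo a b b a * g b else 0)"
proof -
  have "(\<Sum>e\<in>{1..N}. r_lo a b e d * g e) = (\<Sum>e\<in>{if b = d then a else b}. r_lo a b e d * g e)"
    using assms by (intro sum.mono_neutral_right) (auto simp: r_lo_def)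
  then show ?thesis by (auto simp: r_lo_def)
qed

text \<open>The entry of \<open>(1 - P) f (1 + P)\<close> on two factors, at row word \<open>i j\<close> and column word \<open>k l\<close>.\<close>

definition pair_defect ::
    "(nat \<Rightarrow> nat \<Rightarrow> nat \<Rightarrow> nat \<Rightarrow> complex fps) \<Rightarrow> nat \<Rightarrow> nat \<Rightarrow> nat \<Rightarrow> nat \<Rightarrow> complex fps" where
  "pair_defect f i j k l = f i j k l - swap_weight i j * f j i k l
     + swap_weight l k * (f i j l k - swap_weight i j * f j i l k)"

lemma swap_weight_cancel: "swap_weight a b * (swap_weight b a * x) = x"
  by (simp add: swap_weight_inverse flip: mult.assoc)

lemma pair_defect_swap_left:
  "pair_defect f j i k l = - swap_weight j i * pair_defect f i j k l"
  by (simp add: pair_defect_def algebra_simps swap_weight_cancel)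

text \<open>Both words are words on the factors \<open>0, 1, 2\<close>. The product of R-matrices \<open>R\<^sub>0\<^sub>2 R\<^sub>0\<^sub>1\<close> only relates words
with the same letters.\<close>

definition is_rearrangement :: "nat \<Rightarrow> nat \<Rightarrow> nat \<Rightarrow> nat \<Rightarrow> nat \<Rightarrow> nat \<Rightarrow> bool" where
  "is_rearrangement a i j c k l \<longleftrightarrow>
     c = a \<and> (k = i \<and> l = j \<or> k = j \<and> l = i) \<or> c = i \<and> (k = a \<and> l = j \<or> k = j \<and> l = a)
     \<or> c = j \<and> (k = a \<and> l = i \<or> k = i \<and> l = a)"

definition weight_preserving :: "(nat \<Rightarrow> nat \<Rightarrow> nat \<Rightarrow> nat \<Rightarrow> complex fps) \<Rightarrow> bool" where
  "weight_preserving F \<longleftrightarrow> (\<forall>a b c d. F a b c d \<noteq> 0 \<longrightarrow> a = c \<and> b = d \<or> a = d \<and> b = c)"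

lemma weight_preserving_r: "weight_preserving r_hi" "weight_preserving r_lo"
  by (simp_all add: weight_preserving_def r_hi_def r_lo_def)

lemma entry_product_eq_0:
  assumes F: "weight_preserving F" and G: "weight_preserving G"
    and "\<not> is_rearrangement a i j c k l"
  shows "(\<Sum>e\<in>{1..N}. F a j e l * G e i c k) = 0"
proof (rule sum.neutral, rule ballI, rule ccontr)
  fix e assume "F a j e l * G e i c k \<noteq> 0"
  then have "a = e \<and> j = l \<or> a = l \<and> j = e" "e = c \<and> i = k \<or> e = k \<and> i = c"
    using F G unfolding weight_preserving_def by (metis mult_zero_left, metis mult_zero_right)
  then show False
    using assms(3) unfolding is_rearrangement_def by metis
qed

text \<open>Because \<open>P (1 - P) = - (1 - P)\<close>, the entry at the row word \<open>j i\<close> is a multiple of the one at \<open>i j\<close>. It remains to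
treat \<open>i < j\<close> and those column words in which the entries of \<open>f\<close> can be nonzero.\<close>

lemma pair_defect_eq_zeroI:
  assumes zero: "\<And>i j k l. \<not> is_rearrangement a i j c k l \<Longrightarrow> f i j k l = 0"
    and ordered: "\<And>i j k l. i \<in> {1..N} \<Longrightarrow> j \<in> {1..N} \<Longrightarrow> i < j \<Longrightarrow>
      is_rearrangement a i j c k l \<Longrightarrow> pair_defect f i j k l = 0"
    and "i \<in> {1..N}" "j \<in> {1..N}"
  shows "pair_defect f i j k l = 0"
proof -
  have "pair_defect f i j k l = 0" if "i < j" "i \<in> {1..N}" "j \<in> {1..N}" for i j
  proof (cases "is_rearrangement a i j c k l")
    case False
    then have "\<not> is_rearrangement a j i c k l" "\<not> is_rearrangement a i j c l k"
      "\<not> is_rearrangement a j i c l k"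
      unfolding is_rearrangement_def by blast+
    with False show ?thesis
      by (simp add: pair_defect_def zero)
  qed (use ordered that in blast)
  then show ?thesis
    using assms(3,4) pair_defect_swap_left[of f i j k l]
    by (cases i j rule: linorder_cases) (auto simp: pair_defect_def swap_weight_def)
qed

text \<open>The relative positions of three letters, each with all its consequences for comparisons, so that conditional expressions in
these comparisons can be evaluated by rewriting alone.\<close>

lemma three_positions:
  assumes "i < (j::nat)"
    "i < j \<Longrightarrow> a < i \<Longrightarrow> a < j \<Longrightarrow> a \<noteq> i \<Longrightarrow> i \<noteq> a \<Longrightarrow> a \<noteq> j \<Longrightarrow> j \<noteq> a \<Longrightarrow> \<not> i < a \<Longrightarrow> \<not> j < a \<Longrightarrow> i \<noteq> j \<Longrightarrow> j \<noteq> i \<Longrightarrow> \<not> j < i \<Longrightarrow> P"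
    "a = i \<Longrightarrow> i < j \<Longrightarrow> i \<noteq> j \<Longrightarrow> j \<noteq> i \<Longrightarrow> \<not> j < i \<Longrightarrow> P"
    "i < j \<Longrightarrow> i < a \<Longrightarrow> a < j \<Longrightarrow> a \<noteq> i \<Longrightarrow> i \<noteq> a \<Longrightarrow> a \<noteq> j \<Longrightarrow> j \<noteq> a \<Longrightarrow> \<not> a < i \<Longrightarrow> \<not> j < a \<Longrightarrow> i \<noteq> j \<Longrightarrow> j \<noteq> i \<Longrightarrow> \<not> j < i \<Longrightarrow> P"
    "a = j \<Longrightarrow> i < j \<Longrightarrow> i \<noteq> j \<Longrightarrow> j \<noteq> i \<Longrightarrow> \<not> j < i \<Longrightarrow> P"
    "i < j \<Longrightarrow> i < a \<Longrightarrow> j < a \<Longrightarrow> a \<noteq> i \<Longrightarrow> i \<noteq> a \<Longrightarrow> a \<noteq> j \<Longrightarrow> j \<noteq> a \<Longrightarrow> \<not> a < i \<Longrightarrow> \<not> a < j \<Longrightarrow> i \<noteq> j \<Longrightarrow> j \<noteq> i \<Longrightarrow> \<not> j < i \<Longrightarrow> P"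
  shows P
proof -
  from assms(1) consider "a < i" | "a = i" | "i < a" "a < j" | "a = j" | "j < a" by linarith
  then show ?thesis
    using assms by cases simp_all
qed

lemma fps_exp_half:
  fixes x :: "complex fps"
  shows "fps_exp (1/2) * fps_exp (-1/2) = (1::complex fps)" "fps_exp (-1/2) * fps_exp (1/2) = (1::complex fps)"
    "fps_exp (1/2) * (fps_exp (-1/2) * x) = x" "fps_exp (-1/2) * (fps_exp (1/2) * x) = x"
  by (simp_all add: fps_exp_mult_collect)

lemma fps_exp_minus_one: "fps_exp (-1) = fps_exp (-1/2) * (fps_exp (-1/2) :: complex fps)"
  by (simp add: fps_exp_mult_collect)

text \<open>The next three lemmas are, up to units, the coefficients of \<open>y\<^sup>2\<close>, \<open>z\<^sup>2\<close> and \<open>y z\<close> in the fusion identity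
\<open>(1 - P\<^sub>1\<^sub>2) R\<^sub>0\<^sub>2(y, exp(-h) z) R\<^sub>0\<^sub>1(y, z) (1 + P\<^sub>1\<^sub>2) = 0\<close>. Only the six rearrangements of the row word can occur
as column word, and for each of them the entry depends only on the relative position of \<open>a\<close> and \<open>i < j\<close>; in every case
the claim is a polynomial identity in \<open>q\<close> and \<open>1/q\<close>.\<close>

lemma r_hi_fusion:
  assumes "a \<in> {1..N}" "i \<in> {1..N}" "j \<in> {1..N}"
  shows "pair_defect (\<lambda>i j k l. (\<Sum>e\<in>{1..N}. r_hi a j e l * r_hi e i c k)) i j k l = 0"
proof (rule pair_defect_eq_zeroI[OF _ _ assms(2,3)])
  fix i j k l assume "\<not> is_rearrangement a i j c k l"
  then show "(\<Sum>e\<in>{1..N}. r_hi a j e l * r_hi e i c k) = 0"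
    by (rule entry_product_eq_0[OF weight_preserving_r(1) weight_preserving_r(1)])
next
  fix i j k l assume ij: "i \<in> {1..N}" "j \<in> {1..N}" and "i < j" "is_rearrangement a i j c k l"
  then show "pair_defect (\<lambda>i j k l. (\<Sum>e\<in>{1..N}. r_hi a j e l * r_hi e i c k)) i j k l = 0"
    unfolding pair_defect_def r_hi_sum[OF assms(1) ij(1)] r_hi_sum[OF assms(1) ij(2)] is_rearrangement_def
      fps_exp_minus_one
    by - (elim disjE conjE; hypsubst_thin; erule three_positions[of i j a]; hypsubst_thin?;
      simp only: r_hi_def r_lo_def swap_weight_def if_True if_False simp_thms less_irrefl;
      simp (no_asm) only: fps_exp_half ring_distribs mult_ac mult_minus_left mult_minus_right
        mult_1_left mult_1_right mult_zero_left mult_zero_right diff_conv_add_uminus minus_add_distrib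
        minus_minus minus_zero add_0_left add_0_right; simp (no_asm))
qed

lemma r_lo_fusion:
  assumes "a \<in> {1..N}" "i \<in> {1..N}" "j \<in> {1..N}"
  shows "pair_defect (\<lambda>i j k l. (\<Sum>e\<in>{1..N}. r_lo a j e l * r_lo e i c k)) i j k l = 0"
proof (rule pair_defect_eq_zeroI[OF _ _ assms(2,3)])
  fix i j k l assume "\<not> is_rearrangement a i j c k l"
  then show "(\<Sum>e\<in>{1..N}. r_lo a j e l * r_lo e i c k) = 0"
    by (rule entry_product_eq_0[OF weight_preserving_r(2) weight_preserving_r(2)])
next
  fix i j k l assume ij: "i \<in> {1..N}" "j \<in> {1..N}" and "i < j" "is_rearrangement a i j c k l"
  then show "pair_defect (\<lambda>i j k l. (\<Sum>e\<in>{1..N}. r_lo a j e l * r_lo e i c k)) i j k l = 0"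
    unfolding pair_defect_def r_lo_sum[OF assms(1) ij(1)] r_lo_sum[OF assms(1) ij(2)] is_rearrangement_def
      fps_exp_minus_one
    by - (elim disjE conjE; hypsubst_thin; erule three_positions[of i j a]; hypsubst_thin?;
      simp only: r_hi_def r_lo_def swap_weight_def if_True if_False simp_thms less_irrefl;
      simp (no_asm) only: fps_exp_half ring_distribs mult_ac mult_minus_left mult_minus_right
        mult_1_left mult_1_right mult_zero_left mult_zero_right diff_conv_add_uminus minus_add_distrib
        minus_minus minus_zero add_0_left add_0_right; simp (no_asm))
qed

lemma r_mixed_fusion:
  assumes "a \<in> {1..N}" "i \<in> {1..N}" "j \<in> {1..N}"
  shows "pair_defect (\<lambda>i j k l. (\<Sum>e\<in>{1..N}. r_hi a j e l * r_lo e i c k)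
    + fps_exp (-1) * (\<Sum>e\<in>{1..N}. r_lo a j e l * r_hi e i c k)) i j k l = 0"
proof (rule pair_defect_eq_zeroI[OF _ _ assms(2,3)])
  fix i j k l assume "\<not> is_rearrangement a i j c k l"
  then show "(\<Sum>e\<in>{1..N}. r_hi a j e l * r_lo e i c k)
    + fps_exp (-1) * (\<Sum>e\<in>{1..N}. r_lo a j e l * r_hi e i c k) = 0"
    by (simp only: entry_product_eq_0[OF weight_preserving_r(1) weight_preserving_r(2)] entry_product_eq_0[OF weight_preserving_r(2) weight_preserving_r(1)]
        not_False_eq_True mult_zero_right add_0_left)
next
  fix i j k l assume ij: "i \<in> {1..N}" "j \<in> {1..N}" and "i < j" "is_rearrangement a i j c k l"
  then show "pair_defect (\<lambda>i j k l. (\<Sum>e\<in>{1..N}. r_hi a j e l * r_lo e i c k)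
    + fps_exp (-1) * (\<Sum>e\<in>{1..N}. r_lo a j e l * r_hi e i c k)) i j k l = 0"
    unfolding pair_defect_def r_hi_sum[OF assms(1) ij(1)] r_hi_sum[OF assms(1) ij(2)]
      r_lo_sum[OF assms(1) ij(1)] r_lo_sum[OF assms(1) ij(2)] is_rearrangement_def
      fps_exp_minus_one
    by - (elim disjE conjE; hypsubst_thin; erule three_positions[of i j a]; hypsubst_thin?;
      simp only: r_hi_def r_lo_def swap_weight_def if_True if_False simp_thms less_irrefl;
      simp (no_asm) only: fps_exp_half ring_distribs mult_ac mult_minus_left mult_minus_right
        mult_1_left mult_1_right mult_zero_left mult_zero_right diff_conv_add_uminus minus_add_distrib
        minus_minus minus_zero add_0_left add_0_right; simp (no_asm))
qed

context central_scalars
begin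

definition R_entry :: "'a \<Rightarrow> 'a \<Rightarrow> nat \<Rightarrow> nat \<Rightarrow> nat \<Rightarrow> nat \<Rightarrow> 'a" where
  "R_entry y z a b c d = s (r_hi a b c d) * y + s (r_lo a b c d) * z"

lemma R_entry_commute:
  assumes "\<And>x. y * x = x * y" and "\<And>x. z * x = x * z"
  shows "R_entry y z a b c d * x = x * R_entry y z a b c d"
  by (simp add: R_entry_def distrib_left distrib_right mult.assoc s_left_commute[of x]
      assms(1)[of x] assms(2)[of x])

text \<open>Expand the product of the two R-matrices in powers of the central elements \<open>y\<close> and \<open>z\<close>.\<close>

lemma R_entry_fusion:
  assumes y: "\<And>x. y * x = x * y" and z: "\<And>x. z * x = x * z"
    and "a \<in> {1..N}" "i \<in> {1..N}" "j \<in> {1..N}"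
    and f_def: "\<And>i j k l. f i j k l =
      (\<Sum>e\<in>{1..N}. R_entry y (s (fps_exp (-1)) * z) a j e l * R_entry y z e i c k)"
  shows "f i j k l - s (swap_weight i j) * f j i k l
    + s (swap_weight l k) * (f i j l k - s (swap_weight i j) * f j i l k) = 0"
proof -
  let ?p = "fps_exp (-1) :: complex fps"
  define A where "A i j k l = (\<Sum>e\<in>{1..N}. r_hi a j e l * r_hi e i c k)" for i j k l
  define B where "B i j k l = (\<Sum>e\<in>{1..N}. r_hi a j e l * r_lo e i c k)
    + ?p * (\<Sum>e\<in>{1..N}. r_lo a j e l * r_hi e i c k)" for i j k l
  define C where "C i j k l = (\<Sum>e\<in>{1..N}. r_lo a j e l * r_lo e i c k)" for i j k l
  have prod: "(s \<alpha> * y + s \<beta> * (s ?p * z)) * (s \<gamma> * y + s \<delta> * z)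
      = s (\<alpha> * \<gamma>) * (y * y) + s (\<alpha> * \<delta> + ?p * (\<beta> * \<gamma>)) * (y * z) + s (?p * (\<beta> * \<delta>)) * (z * z)"
    for \<alpha> \<beta> \<gamma> \<delta>
    by (simp add: distrib_left distrib_right s_add s_mult mult.assoc s_left_commute[of y]
        s_left_commute[of z] s_commute z[of y] add.assoc)
  have f: "f i j k l = s (A i j k l) * (y * y) + s (B i j k l) * (y * z) + s (?p * C i j k l) * (z * z)"
    for i j k l
    unfolding f_def A_def B_def C_def R_entry_def prod
    by (simp add: sum.distrib sum_distrib_left s_sum sum_distrib_right s_add distrib_right)
  have A: "pair_defect A i j k l = 0"
    unfolding A_def by (rule r_hi_fusion[OF assms(3-5)])
  have B: "pair_defect B i j k l = 0"
    unfolding B_def by (rule r_mixed_fusion[OF assms(3-5)])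
  have C: "pair_defect C i j k l = 0"
    unfolding C_def by (rule r_lo_fusion[OF assms(3-5)])
  have "f i j k l - s (swap_weight i j) * f j i k l
      + s (swap_weight l k) * (f i j l k - s (swap_weight i j) * f j i l k)
    = s (pair_defect A i j k l) * (y * y) + s (pair_defect B i j k l) * (y * z)
      + s (?p * pair_defect C i j k l) * (z * z)"
    unfolding f pair_defect_def
    by (simp add: s_add s_diff s_mult distrib_left distrib_right right_diff_distrib left_diff_distrib
        mult.assoc s_commute)
  then show ?thesis
    by (simp add: A B C)
qed

end

section \<open>The quantum determinant of a chain of RTT relations\<close>

lemma sum_multi_Suc:
  "(\<Sum>K\<in>multi N (Suc n). f K) = (\<Sum>K\<in>multi N n. \<Sum>b\<in>{1..N}. f (K(Suc n := b)))"
proof -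
  have "{1..Suc n} = insert (Suc n) {1..n}" by auto
  then have "multi N (Suc n) = (\<lambda>(b, K). K(Suc n := b)) ` ({1..N} \<times> multi N n)"
    unfolding multi_def by (simp add: PiE_insert_eq)
  moreover have "inj_on (\<lambda>(b, K). K(Suc n := b)) ({1..N} \<times> multi N n)"
  proof (rule inj_onI, clarsimp)
    fix b K b' K' assume K: "K \<in> multi N n" "K' \<in> multi N n" and eq: "K(Suc n := b) = K'(Suc n := b')"
    have "K i = K' i" for i
      using fun_cong[OF eq, of i] K by (cases "i = Suc n") (auto simp: multi_def PiE_iff extensional_def)
    then show "b = b' \<and> K = K'"
      using fun_cong[OF eq, of "Suc n"] by auto
  qed
  ultimately have "sum f (multi N (Suc n)) = (\<Sum>(b, K)\<in>{1..N} \<times> multi N n. f (K(Suc n := b)))"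
    by (simp add: sum.reindex case_prod_unfold)
  also have "\<dots> = (\<Sum>b\<in>{1..N}. \<Sum>K\<in>multi N n. f (K(Suc n := b)))"
    by (simp add: sum.cartesian_product)
  also have "\<dots> = (\<Sum>K\<in>multi N n. \<Sum>b\<in>{1..N}. f (K(Suc n := b)))"
    by (rule sum.swap)
  finally show ?thesis .
qed

lemma move_central:
  fixes r v :: "'a::ring_1"
  assumes r: "\<And>x. r * x = x * r" and v: "\<And>x. v * x = x * v"
  shows "r * (w * (x * v)) * u = w * (r * (x * u)) * v"
proof -
  have "r * (w * (x * v)) * u = r * (w * x) * (v * u)"
    by (simp only: mult.assoc)
  also have "\<dots> = w * x * r * (u * v)"
    by (simp only: r[of "w * x"] v[of u])
  also have "\<dots> = w * (x * r) * (u * v)"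
    by (simp only: mult.assoc)
  also have "\<dots> = w * (r * (x * u)) * v"
    by (simp only: r[of x, symmetric] mult.assoc)
  finally show ?thesis .
qed

text \<open>The data for the centrality argument: \<open>t0\<close> is the matrix \<open>T\<^sub>0(y)\<close>, \<open>t k\<close> is \<open>T\<^sub>k(z k)\<close>, and the points \<open>z k\<close> form a
geometric progression with ratio \<open>exp(-h)\<close>. The assumption \<open>rtt\<close> is the RTT relation between \<open>T\<^sub>0\<close> and \<open>T\<^sub>k\<close>, and
\<open>fusion\<close> says \<open>(1 - P\<^sub>k) T\<^sub>k T\<^sub>k\<^sub>+\<^sub>1 (1 + P\<^sub>k) = 0\<close>.\<close>

locale rtt_chain = central_scalars s for s :: "complex fps \<Rightarrow> 'a::ring_1" +
  fixes N :: nat and y :: 'a and z :: "nat \<Rightarrow> 'a"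
    and t0 :: "nat \<Rightarrow> nat \<Rightarrow> 'a" and t :: "nat \<Rightarrow> nat \<Rightarrow> nat \<Rightarrow> 'a"
  assumes y_central: "y * x = x * y" and z_central: "z k * x = x * z k"
    and z_Suc: "z (Suc k) = s (fps_exp (-1)) * z k"
    and rtt: "\<lbrakk>k \<in> {1..N}; a \<in> {1..N}; b \<in> {1..N}; c \<in> {1..N}; d \<in> {1..N}\<rbrakk> \<Longrightarrow>
      (\<Sum>e\<in>{1..N}. \<Sum>f\<in>{1..N}. R_entry y (z k) a b e f * (t0 e c * t k f d)) =
      (\<Sum>e\<in>{1..N}. \<Sum>f\<in>{1..N}. t k b f * t0 a e * R_entry y (z k) e f c d)"
    and fusion: "\<lbrakk>k \<in> {1..<N}; i \<in> {1..N}; j \<in> {1..N}; c \<in> {1..N}; d \<in> {1..N}\<rbrakk> \<Longrightarrow>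
      t k i c * t (Suc k) j d - s (swap_weight i j) * (t k j c * t (Suc k) i d)
      + s (swap_weight d c) * (t k i d * t (Suc k) j c
        - s (swap_weight i j) * (t k j d * t (Suc k) i c)) = 0"
begin

text \<open>The entries of \<open>T\<^sub>1 \<dots> T\<^sub>n\<close>, and below those of \<open>R\<^sub>0\<^sub>n \<dots> R\<^sub>0\<^sub>1\<close>; \<open>a\<close> and \<open>c\<close> index the factor 0.\<close>

primrec word_prod :: "nat \<Rightarrow> (nat \<Rightarrow> nat) \<Rightarrow> (nat \<Rightarrow> nat) \<Rightarrow> 'a" where
  "word_prod 0 K L = 1"
| "word_prod (Suc n) K L = word_prod n K L * t (Suc n) (K (Suc n)) (L (Suc n))"

primrec chain :: "nat \<Rightarrow> nat \<Rightarrow> (nat \<Rightarrow> nat) \<Rightarrow> nat \<Rightarrow> (nat \<Rightarrow> nat) \<Rightarrow> 'a" where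
  "chain 0 a K c L = of_bool (a = c)"
| "chain (Suc n) a K c L =
    (\<Sum>e\<in>{1..N}. R_entry y (z (Suc n)) a (K (Suc n)) e (L (Suc n)) * chain n e K c L)"

lemma word_prod_cong:
  "(\<And>i. i \<in> {1..n} \<Longrightarrow> K i = K' i \<and> L i = L' i) \<Longrightarrow> word_prod n K L = word_prod n K' L'"
  by (induction n) simp_all

lemma chain_cong:
  "(\<And>i. i \<in> {1..n} \<Longrightarrow> K i = K' i \<and> L i = L' i) \<Longrightarrow> chain n a K c L = chain n a K' c L'"
proof (induction n arbitrary: a)
  case (Suc n)
  have "chain n e K c L = chain n e K' c L'" for e
    using Suc.prems by (intro Suc.IH) simp
  then show ?case using Suc.prems[of "Suc n"] by simp
qed simp

lemma R_entry_central: "R_entry y (z k) a b c d * x = x * R_entry y (z k) a b c d"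
  by (rule R_entry_commute[OF y_central z_central])

lemma chain_central: "chain n a K c L * x = x * chain n a K c L"
proof (induction n arbitrary: a)
  case (Suc n)
  have "R_entry y (z (Suc n)) a k e l * chain n e K c L * x
      = x * (R_entry y (z (Suc n)) a k e l * chain n e K c L)" for e k l
    by (metis Suc.IH R_entry_central mult.assoc)
  then show ?case by (simp add: sum_distrib_left sum_distrib_right)
qed simp

text \<open>The operator \<open>P\<^sub>k\<close> commutes with every \<open>T\<^sub>j\<close> except \<open>T\<^sub>k\<close> and \<open>T\<^sub>k\<^sub>+\<^sub>1\<close>. In \<open>chain_fusion\<close> it commutes with every
\<open>R\<^sub>0\<^sub>j\<close> except \<open>R\<^sub>0\<^sub>k\<close> and \<open>R\<^sub>0\<^sub>k\<^sub>+\<^sub>1\<close>.\<close>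

lemma word_prod_fusion:
  assumes k: "k \<in> {1..<N}" and K: "K \<in> multi N N" and L: "L \<in> multi N N" and n: "Suc k \<le> n"
  shows "fusion_defect k (word_prod n) K L = 0"
  using n
proof (induction n rule: dec_induct)
  case base
  obtain m where m: "k = Suc m" using k by (cases k) auto
  have w: "word_prod m (swap_at k K) L = word_prod m K L"
    "word_prod m K (swap_at k L) = word_prod m K L"
    "word_prod m (swap_at k K) (swap_at k L) = word_prod m K L"
    by (rule word_prod_cong; simp add: m)+
  have "fusion_defect k (word_prod (Suc k)) K L = word_prod m K L *
      (t k (K k) (L k) * t (Suc k) (K (Suc k)) (L (Suc k))
       - s (swap_weight (K k) (K (Suc k))) * (t k (K (Suc k)) (L k) * t (Suc k) (K k) (L (Suc k)))
       + s (swap_weight (L (Suc k)) (L k)) * (t k (K k) (L (Suc k)) * t (Suc k) (K (Suc k)) (L k)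
        - s (swap_weight (K k) (K (Suc k))) * (t k (K (Suc k)) (L (Suc k)) * t (Suc k) (K k) (L k))))"
    using w unfolding fusion_defect_def m
    by (simp add: distrib_left right_diff_distrib mult.assoc s_left_commute[of "word_prod m K L"])
  also have "\<dots> = 0"
    using fusion[OF k, of "K k" "K (Suc k)" "L k" "L (Suc k)"] k multi_range[OF K] multi_range[OF L] by simp
  finally show ?case .
next
  case (step n)
  have "fusion_defect k (word_prod (Suc n)) K L =
      fusion_defect k (word_prod n) K L * t (Suc n) (K (Suc n)) (L (Suc n))"
    using step.hyps unfolding fusion_defect_def
    by (simp add: distrib_right left_diff_distrib mult.assoc)
  then show ?case by (simp only: step.IH mult_zero_left)
qed

lemma chain_fusion:
  assumes k: "k \<in> {1..<N}" and K: "K \<in> multi N N" and L: "L \<in> multi N N" and n: "Suc k \<le> n"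
    and a: "a \<in> {1..N}"
  shows "fusion_defect k (\<lambda>K L. chain n a K c L) K L = 0"
  using n a
proof (induction n arbitrary: a rule: dec_induct)
  case base
  obtain m where m: "k = Suc m" using k by (cases k) auto
  have w: "chain m f (swap_at k K) c L = chain m f K c L"
    "chain m f K c (swap_at k L) = chain m f K c L"
    "chain m f (swap_at k K) c (swap_at k L) = chain m f K c L" for f
    by (rule chain_cong; simp add: m)+
  define g where "g f i j k' l = (\<Sum>e\<in>{1..N}. R_entry y (z (Suc k)) a j e l * R_entry y (z k) e i f k')" for f i j k' l
  have two: "chain (Suc k) a K' c L' =
      (\<Sum>f\<in>{1..N}. g f (K' k) (K' (Suc k)) (L' k) (L' (Suc k)) * chain m f K' c L')" for K' L'
    unfolding g_def m chain.simps sum_distrib_left sum_distrib_right mult.assoc by (rule sum.swap)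
  have "fusion_defect k (\<lambda>K L. chain (Suc k) a K c L) K L = (\<Sum>f\<in>{1..N}.
      (g f (K k) (K (Suc k)) (L k) (L (Suc k))
       - s (swap_weight (K k) (K (Suc k))) * g f (K (Suc k)) (K k) (L k) (L (Suc k))
       + s (swap_weight (L (Suc k)) (L k)) * (g f (K k) (K (Suc k)) (L (Suc k)) (L k)
        - s (swap_weight (K k) (K (Suc k))) * g f (K (Suc k)) (K k) (L (Suc k)) (L k))) * chain m f K c L)"
    unfolding fusion_defect_def two w
    by (simp add: sum.distrib sum_subtractf sum_distrib_left distrib_right left_diff_distrib right_diff_distrib mult.assoc)
  also have "\<dots> = 0"
  proof (rule sum.neutral, rule ballI)
    fix f
    show "(g f (K k) (K (Suc k)) (L k) (L (Suc k))
       - s (swap_weight (K k) (K (Suc k))) * g f (K (Suc k)) (K k) (L k) (L (Suc k))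
       + s (swap_weight (L (Suc k)) (L k)) * (g f (K k) (K (Suc k)) (L (Suc k)) (L k)
        - s (swap_weight (K k) (K (Suc k))) * g f (K (Suc k)) (K k) (L (Suc k)) (L k))) * chain m f K c L = 0"
      by (subst R_entry_fusion[where f = "g f" and z = "z k" and a = a and c = f, OF y_central z_central base.prems])
        (use k multi_range[OF K] in \<open>simp_all add: g_def z_Suc\<close>)
  qed
  finally show ?case .
next
  case (step n)
  have "fusion_defect k (\<lambda>K L. chain (Suc n) a K c L) K L = (\<Sum>e\<in>{1..N}.
      R_entry y (z (Suc n)) a (K (Suc n)) e (L (Suc n)) * fusion_defect k (\<lambda>K L. chain n e K c L) K L)"
    using step.hyps unfolding fusion_defect_def
    by (simp add: sum.distrib sum_subtractf sum_distrib_left distrib_left right_diff_distrib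
        s_left_commute[of "R_entry _ _ _ _ _ _"])
  then show ?case using step.IH by simp
qed

lemma sum_rotate4:
  "(\<Sum>w\<in>A. \<Sum>b\<in>B. \<Sum>e\<in>C. \<Sum>f\<in>D. F w b e f) = (\<Sum>b\<in>B. \<Sum>f\<in>D. \<Sum>w\<in>A. \<Sum>e\<in>C. F w b e f)"
proof -
  have "(\<Sum>w\<in>A. \<Sum>b\<in>B. \<Sum>e\<in>C. \<Sum>f\<in>D. F w b e f) = (\<Sum>b\<in>B. \<Sum>w\<in>A. \<Sum>f\<in>D. \<Sum>e\<in>C. F w b e f)"
    by (subst sum.swap) (intro sum.cong refl sum.swap)
  also have "\<dots> = (\<Sum>b\<in>B. \<Sum>f\<in>D. \<Sum>w\<in>A. \<Sum>e\<in>C. F w b e f)"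
    by (intro sum.cong refl sum.swap)
  finally show ?thesis .
qed

lemma sum_reverse3:
  "(\<Sum>e\<in>A. \<Sum>f\<in>B. \<Sum>b\<in>C. F e f b) = (\<Sum>b\<in>C. \<Sum>f\<in>B. \<Sum>e\<in>A. F e f b)"
proof -
  have "(\<Sum>e\<in>A. \<Sum>f\<in>B. \<Sum>b\<in>C. F e f b) = (\<Sum>e\<in>A. \<Sum>b\<in>C. \<Sum>f\<in>B. F e f b)"
    by (intro sum.cong refl sum.swap)
  also have "\<dots> = (\<Sum>b\<in>C. \<Sum>e\<in>A. \<Sum>f\<in>B. F e f b)"
    by (rule sum.swap)
  also have "\<dots> = (\<Sum>b\<in>C. \<Sum>f\<in>B. \<Sum>e\<in>A. F e f b)"
    by (intro sum.cong refl sum.swap)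
  finally show ?thesis .
qed

lemma sum_unrotate4:
  "(\<Sum>b\<in>B. \<Sum>f\<in>D. \<Sum>w\<in>A. \<Sum>e\<in>C. F w b e f) = (\<Sum>w\<in>A. \<Sum>e\<in>C. \<Sum>f\<in>D. \<Sum>b\<in>B. F w b e f)"
proof -
  have "(\<Sum>b\<in>B. \<Sum>f\<in>D. \<Sum>w\<in>A. \<Sum>e\<in>C. F w b e f) = (\<Sum>w\<in>A. \<Sum>b\<in>B. \<Sum>e\<in>C. \<Sum>f\<in>D. F w b e f)"
    by (rule sum_rotate4[symmetric])
  also have "\<dots> = (\<Sum>w\<in>A. \<Sum>e\<in>C. \<Sum>f\<in>D. \<Sum>b\<in>B. F w b e f)"
    by (rule sum.cong[OF refl]) (simp only: sum.swap[of _ _ B])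
  finally show ?thesis .
qed

text \<open>By induction \<open>R\<^sub>0\<^sub>n \<dots> R\<^sub>0\<^sub>1 T\<^sub>0 T\<^sub>1 \<dots> T\<^sub>n = T\<^sub>1 \<dots> T\<^sub>n T\<^sub>0 R\<^sub>0\<^sub>n \<dots> R\<^sub>0\<^sub>1\<close>: the hypothesis moves \<open>T\<^sub>0\<close> past
\<open>T\<^sub>1 \<dots> T\<^sub>n\<close>, then the RTT relation moves it past \<open>T\<^sub>n\<^sub>+\<^sub>1\<close>. Scalar entries of R-matrices commute with everything, only
their indices have to be tracked.\<close>

lemma chain_intertwines:
  assumes "n \<le> N" "\<And>i. i \<in> {1..n} \<Longrightarrow> K i \<in> {1..N} \<and> L i \<in> {1..N}" "a \<in> {1..N}" "c \<in> {1..N}"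
  shows "(\<Sum>K'\<in>multi N n. \<Sum>e\<in>{1..N}. chain n a K e K' * (t0 e c * word_prod n K' L)) =
    (\<Sum>K'\<in>multi N n. \<Sum>e\<in>{1..N}. word_prod n K K' * (t0 a e * chain n e K' c L))"
  using assms
proof (induction n arbitrary: a c)
  case 0
  have "multi N 0 = {\<lambda>_. undefined}" by (simp add: multi_def)
  then show ?case using 0 by (simp add: of_bool_def if_distrib[of "\<lambda>x. x * _"] if_distrib[of "\<lambda>x. _ * x"] cong: if_cong)
next
  case (Suc n)
  let ?k = "K (Suc n)" and ?l = "L (Suc n)" and ?R = "R_entry y (z (Suc n))" and ?t = "t (Suc n)"
  have kl: "?k \<in> {1..N}" "?l \<in> {1..N}" and N: "Suc n \<in> {1..N}"
    using Suc.prems(1,2) by simp_all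
  have upd: "word_prod n (K'(Suc n := b)) L = word_prod n K' L"
    "word_prod n K (K'(Suc n := b)) = word_prod n K K'"
    "chain n e K f (K'(Suc n := b)) = chain n e K f K'"
    "chain n e (K'(Suc n := b)) f L = chain n e K' f L" for K' b e f
    by (rule word_prod_cong chain_cong; simp)+
  have IH: "(\<Sum>K'\<in>multi N n. \<Sum>e\<in>{1..N}. chain n f K e K' * (t0 e c * word_prod n K' L)) =
    (\<Sum>K'\<in>multi N n. \<Sum>e\<in>{1..N}. word_prod n K K' * (t0 f e * chain n e K' c L))" if "f \<in> {1..N}" for f
    using Suc.prems that by (intro Suc.IH) simp_all
  have "(\<Sum>K'\<in>multi N (Suc n). \<Sum>e\<in>{1..N}. chain (Suc n) a K e K' * (t0 e c * word_prod (Suc n) K' L))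
    = (\<Sum>K'\<in>multi N n. \<Sum>b\<in>{1..N}. \<Sum>e\<in>{1..N}. \<Sum>f\<in>{1..N}.
        ?R a ?k f b * (chain n f K e K' * (t0 e c * word_prod n K' L)) * ?t b ?l)"
    unfolding sum_multi_Suc by (simp add: upd sum_distrib_right mult.assoc)
  also have "\<dots> = (\<Sum>b\<in>{1..N}. \<Sum>f\<in>{1..N}. ?R a ?k f b *
       (\<Sum>K'\<in>multi N n. \<Sum>e\<in>{1..N}. chain n f K e K' * (t0 e c * word_prod n K' L)) * ?t b ?l)"
    unfolding sum_distrib_left sum_distrib_right by (rule sum_rotate4)
  also have "\<dots> = (\<Sum>b\<in>{1..N}. \<Sum>f\<in>{1..N}. ?R a ?k f b *
       (\<Sum>K'\<in>multi N n. \<Sum>e\<in>{1..N}. word_prod n K K' * (t0 f e * chain n e K' c L)) * ?t b ?l)"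
    by (intro sum.cong refl) (simp only: IH)
  also have "\<dots> = (\<Sum>K'\<in>multi N n. \<Sum>e\<in>{1..N}.
      word_prod n K K' * (\<Sum>f\<in>{1..N}. \<Sum>b\<in>{1..N}. ?R a ?k f b * (t0 f e * ?t b ?l)) * chain n e K' c L)"
    unfolding sum_distrib_left sum_distrib_right
    by (subst sum_unrotate4) (intro sum.cong refl move_central R_entry_central chain_central)
  also have "\<dots> = (\<Sum>K'\<in>multi N n. \<Sum>e\<in>{1..N}.
      word_prod n K K' * (\<Sum>f\<in>{1..N}. \<Sum>b\<in>{1..N}. ?t ?k b * t0 a f * ?R f b e ?l) * chain n e K' c L)"
    by (intro sum.cong refl) (simp only: rtt[OF N Suc.prems(3) kl(1) _ kl(2)])
  also have "\<dots> = (\<Sum>K'\<in>multi N n. \<Sum>b\<in>{1..N}. \<Sum>f\<in>{1..N}.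
      word_prod n K K' * ?t ?k b * (t0 a f * (\<Sum>e\<in>{1..N}. ?R f b e ?l * chain n e K' c L)))"
    unfolding sum_distrib_left sum_distrib_right mult.assoc
    by (rule sum.cong[OF refl]) (rule sum_reverse3)
  also have "\<dots> = (\<Sum>K'\<in>multi N (Suc n). \<Sum>e\<in>{1..N}.
      word_prod (Suc n) K K' * (t0 a e * chain (Suc n) e K' c L))"
    unfolding sum_multi_Suc by (simp add: upd)
  finally show ?case .
qed

text \<open>The scalar \<open>f = (y/q - q z\<^sub>1) (y - z\<^sub>2) \<dots> (y - z\<^sub>n)\<close>; the claim is that
\<open>\<epsilon> R\<^sub>0\<^sub>N \<dots> R\<^sub>0\<^sub>1 = f \<epsilon>\<close> for \<open>n = N\<close>.\<close>

primrec eigenvalue :: "nat \<Rightarrow> 'a" where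
  "eigenvalue 0 = 1"
| "eigenvalue (Suc n) =
    (if n = 0 then s (fps_exp (-1/2)) * y - s (fps_exp (1/2)) * z (Suc n) else y - z (Suc n)) * eigenvalue n"

text \<open>If the column word starts with the letter \<open>c\<close> of the factor 0, then \<open>R\<^sub>0\<^sub>1\<close> acts diagonally. If a later \<open>R\<^sub>0\<^sub>k\<close> exchanges
the letter of the factor 0 with another one, then \<open>c\<close> occurs twice in the row word. For row words without repetition only the
diagonal terms survive.\<close>

lemma chain_on_permutation:
  assumes "n \<ge> 1" "inj_on K {1..n}" "inj_on L {1..n}" "c = L 1" "c \<in> {1..N}"
  shows "chain n a K c L = of_bool (a = c \<and> (\<forall>i\<in>{1..n}. K i = L i)) * eigenvalue n"
  using assms(1-3)
proof (induction n arbitrary: a rule: dec_induct)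
  case base
  have "chain 1 a K c L = (\<Sum>e\<in>{1..N}. if e = c then R_entry y (z 1) a (K 1) e (L 1) else 0)"
    unfolding One_nat_def chain.simps by (rule sum.cong) auto
  also have "\<dots> = R_entry y (z 1) a (K 1) c (L 1)"
    using assms(5) by simp
  finally show ?case
    unfolding assms(4) by (simp add: R_entry_def r_hi_def r_lo_def s_minus)
next
  case (step n)
  let ?k = "K (Suc n)" and ?l = "L (Suc n)"
  have inj: "inj_on K {1..n}" "inj_on L {1..n}"
    using step.prems by (auto intro: inj_on_subset)
  have l: "?l \<noteq> c"
    using inj_onD[OF step.prems(2), of "Suc n" 1] step.hyps(1) assms(4) by auto
  have k: "?k \<noteq> c" if "\<forall>i\<in>{1..n}. K i = L i"
    using inj_onD[OF step.prems(1), of "Suc n" 1] step.hyps(1) assms(4) that by auto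
  have "chain (Suc n) a K c L = (\<Sum>e\<in>{1..N}. if e = c then
      R_entry y (z (Suc n)) a ?k e ?l * (of_bool (\<forall>i\<in>{1..n}. K i = L i) * eigenvalue n) else 0)"
    unfolding chain.simps step.IH[OF inj] by (rule sum.cong) (auto simp: of_bool_def)
  also have "\<dots> = R_entry y (z (Suc n)) a ?k c ?l * (of_bool (\<forall>i\<in>{1..n}. K i = L i) * eigenvalue n)"
    using assms(5) by simp
  also have "\<dots> = of_bool (a = c \<and> ?k = ?l \<and> (\<forall>i\<in>{1..n}. K i = L i)) * eigenvalue (Suc n)"
    using k l step.hyps(1) by (auto simp: R_entry_def r_hi_def r_lo_def s_minus)
  finally show ?case
    by (simp add: atLeastAtMostSuc_conv)
qed

text \<open>The entries of \<open>\<epsilon> R\<^sub>0\<^sub>N \<dots> R\<^sub>0\<^sub>1\<close>.\<close>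

definition chain_row :: "nat \<Rightarrow> nat \<Rightarrow> (nat \<Rightarrow> nat) \<Rightarrow> 'a" where
  "chain_row a c L = (\<Sum>K\<in>multi N N. s (q_sign N K) * chain N a K c L)"

lemma chain_row_skew:
  assumes "L \<in> multi N N" "a \<in> {1..N}"
  shows "chain_row a c L = s (q_sign N L) * chain_row a c (id_word N)"
  unfolding chain_row_def using assms chain_fusion by (intro q_minor_expansion) simp_all

text \<open>By skew-symmetry the coefficient at \<open>1 2 \<dots> N\<close> can be computed from any column word without repetition. The choice of one
that starts with \<open>c\<close> makes \<open>chain_on_permutation\<close> applicable.\<close>

lemma chain_row_eigenvalue:
  assumes a: "a \<in> {1..N}" and c: "c \<in> {1..N}"
  shows "chain_row a c (id_word N) = of_bool (a = c) * eigenvalue N"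
proof -
  define L where "L = id_word N \<circ> transpose 1 c"
  have perm: "transpose 1 c permutes {1..N}"
    using c by (intro permutes_swap_id) auto
  have L: "L \<in> multi N N"
    unfolding L_def by (rule multi_comp_permutes[OF id_word_multi perm])
  have inj: "inj_on L {1..N}"
    unfolding L_def using permutes_inj_on[OF perm] permutes_image[OF perm]
    by (intro comp_inj_on) (simp_all add: id_word_def inj_on_def)
  have L1: "c = L 1"
    using c by (simp add: L_def id_word_def)
  have "1 \<le> N"
    using c by simp
  \<comment> \<open>The sign factor of \<open>L\<close> is a unit and can be cancelled below.\<close>
  have unit: "(- fps_exp (1/2)) ^ Ph_inversions N L * q_sign N L = 1"
    using inj unfolding q_sign_def by (simp only: if_True power_mult_distrib[symmetric] fps_exp_half minus_mult_minus power_one)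
  have "chain_row a c L = (\<Sum>K\<in>multi N N. if K = L then s (q_sign N L) * (of_bool (a = c) * eigenvalue N) else 0)"
    unfolding chain_row_def
  proof (rule sum.cong[OF refl])
    fix K assume K: "K \<in> multi N N"
    have eq: "(\<forall>i\<in>{1..N}. K i = L i) \<longleftrightarrow> K = L"
      using K L by (auto simp: multi_def intro: PiE_ext)
    show "s (q_sign N K) * chain N a K c L =
        (if K = L then s (q_sign N L) * (of_bool (a = c) * eigenvalue N) else 0)"
    proof (cases "inj_on K {1..N}")
      case True
      have "chain N a K c L = of_bool (a = c \<and> K = L) * eigenvalue N"
        using chain_on_permutation[OF \<open>1 \<le> N\<close> True inj L1 c, of a] by (simp only: eq)
      then show ?thesis by auto
    next
      case False
      then have "K \<noteq> L" using inj by blast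
      then show ?thesis using False by (simp add: q_sign_def)
    qed
  qed
  also have "\<dots> = s (q_sign N L) * (of_bool (a = c) * eigenvalue N)"
    using L by simp
  finally have "s (q_sign N L) * chain_row a c (id_word N) = s (q_sign N L) * (of_bool (a = c) * eigenvalue N)"
    using chain_row_skew[OF L a] by simp
  then have "s ((- fps_exp (1/2)) ^ Ph_inversions N L) * (s (q_sign N L) * chain_row a c (id_word N))
      = s ((- fps_exp (1/2)) ^ Ph_inversions N L) * (s (q_sign N L) * (of_bool (a = c) * eigenvalue N))"
    by (rule arg_cong)
  then show ?thesis
    unfolding mult.assoc[symmetric] s_mult[symmetric] unit by simp
qed

text \<open>The entry of \<open>\<epsilon> T\<^sub>1 \<dots> T\<^sub>N\<close> at the column \<open>1 2 \<dots> N\<close>.\<close>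

definition qdet :: 'a where
  "qdet = (\<Sum>K\<in>multi N N. s (q_sign N K) * word_prod N K (id_word N))"

lemma word_prod_skew:
  assumes "L \<in> multi N N"
  shows "(\<Sum>K\<in>multi N N. s (q_sign N K) * word_prod N K L) = s (q_sign N L) * qdet"
  unfolding qdet_def using assms word_prod_fusion by (intro q_minor_expansion) simp_all

lemma eigenvalue_central: "eigenvalue n * x = x * eigenvalue n"
proof (induction n arbitrary: x)
  case (Suc n)
  have *: "f * eigenvalue n * x = x * (f * eigenvalue n)" if "\<And>x. f * x = x * f" for f
  proof -
    have "f * eigenvalue n * x = f * x * eigenvalue n"
      by (simp only: mult.assoc Suc.IH[of x])
    then show ?thesis by (simp only: that[of x] mult.assoc)
  qed
  show ?case
    unfolding eigenvalue.simps
  proof (rule *)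
    fix x
    show "(if n = 0 then s (fps_exp (-1/2)) * y - s (fps_exp (1/2)) * z (Suc n) else y - z (Suc n)) * x
      = x * (if n = 0 then s (fps_exp (-1/2)) * y - s (fps_exp (1/2)) * z (Suc n) else y - z (Suc n))"
      by (simp add: left_diff_distrib right_diff_distrib mult.assoc s_left_commute[of x]
        y_central[of x] z_central[of _ x])
  qed
qed simp

lemma sum_outer_to_inner:
  "(\<Sum>w\<in>A. \<Sum>b\<in>B. \<Sum>e\<in>C. F w b e) = (\<Sum>b\<in>B. \<Sum>e\<in>C. \<Sum>w\<in>A. F w b e)"
proof -
  have "(\<Sum>w\<in>A. \<Sum>b\<in>B. \<Sum>e\<in>C. F w b e) = (\<Sum>b\<in>B. \<Sum>w\<in>A. \<Sum>e\<in>C. F w b e)"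
    by (rule sum.swap)
  also have "\<dots> = (\<Sum>b\<in>B. \<Sum>e\<in>C. \<Sum>w\<in>A. F w b e)"
    by (rule sum.cong[OF refl]) (rule sum.swap)
  finally show ?thesis .
qed

text \<open>Apply \<open>\<epsilon>\<close> from the left to the intertwining relation. On one side it first meets the R-matrices and becomes \<open>f \<epsilon>\<close>, then
\<open>\<epsilon> T\<^sub>1 \<dots> T\<^sub>N\<close> gives \<open>D\<close>; on the other side it happens in the opposite order.\<close>

lemma qdet_commutes:
  assumes a: "a \<in> {1..N}" and c: "c \<in> {1..N}"
  shows "eigenvalue N * (t0 a c * qdet - qdet * t0 a c) = 0"
proof -
  let ?I = "id_word N" and ?M = "multi N N"
  have "(\<Sum>K\<in>?M. s (q_sign N K) *
        (\<Sum>K'\<in>?M. \<Sum>e\<in>{1..N}. chain N a K e K' * (t0 e c * word_prod N K' ?I)))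
      = (\<Sum>K'\<in>?M. \<Sum>e\<in>{1..N}. chain_row a e K' * (t0 e c * word_prod N K' ?I))"
    unfolding chain_row_def sum_distrib_left sum_distrib_right mult.assoc by (rule sum_outer_to_inner)
  also have "\<dots> = (\<Sum>K'\<in>?M. \<Sum>e\<in>{1..N}. if e = a then
      eigenvalue N * (t0 a c * (s (q_sign N K') * word_prod N K' ?I)) else 0)"
  proof (intro sum.cong refl)
    fix K' e assume "K' \<in> ?M" "e \<in> {1..N}"
    then show "chain_row a e K' * (t0 e c * word_prod N K' ?I) =
       (if e = a then eigenvalue N * (t0 a c * (s (q_sign N K') * word_prod N K' ?I)) else 0)"
      using a chain_row_skew[of K' a e] chain_row_eigenvalue[of a e]
      by (auto simp: mult.assoc s_left_commute[of "eigenvalue N"] s_left_commute[of "t0 a c"])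
  qed
  also have "\<dots> = eigenvalue N * (t0 a c * qdet)"
    using a by (simp add: qdet_def sum_distrib_left)
  finally have left: "(\<Sum>K\<in>?M. s (q_sign N K) *
        (\<Sum>K'\<in>?M. \<Sum>e\<in>{1..N}. chain N a K e K' * (t0 e c * word_prod N K' ?I)))
      = eigenvalue N * (t0 a c * qdet)" .
  have "(\<Sum>K\<in>?M. s (q_sign N K) *
        (\<Sum>K'\<in>?M. \<Sum>e\<in>{1..N}. word_prod N K K' * (t0 a e * chain N e K' c ?I)))
      = (\<Sum>K'\<in>?M. \<Sum>e\<in>{1..N}. (\<Sum>K\<in>?M. s (q_sign N K) * word_prod N K K') * (t0 a e * chain N e K' c ?I))"
    unfolding sum_distrib_left sum_distrib_right mult.assoc by (rule sum_outer_to_inner)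
  also have "\<dots> = (\<Sum>K'\<in>?M. \<Sum>e\<in>{1..N}. qdet * (t0 a e * (s (q_sign N K') * chain N e K' c ?I)))"
    by (intro sum.cong refl) (simp add: word_prod_skew mult.assoc s_left_commute[of "t0 _ _"] s_left_commute[of qdet])
  also have "\<dots> = (\<Sum>e\<in>{1..N}. qdet * (t0 a e * chain_row e c ?I))"
    unfolding chain_row_def sum_distrib_left by (rule sum.swap)
  also have "\<dots> = (\<Sum>e\<in>{1..N}. if e = c then qdet * (t0 a c * eigenvalue N) else 0)"
    using c by (intro sum.cong refl) (auto simp: chain_row_eigenvalue)
  also have "\<dots> = qdet * (t0 a c * eigenvalue N)"
    using c by simp
  finally have right: "(\<Sum>K\<in>?M. s (q_sign N K) *
        (\<Sum>K'\<in>?M. \<Sum>e\<in>{1..N}. word_prod N K K' * (t0 a e * chain N e K' c ?I)))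
      = qdet * (t0 a c * eigenvalue N)" .
  have "(\<Sum>K\<in>?M. s (q_sign N K) *
        (\<Sum>K'\<in>?M. \<Sum>e\<in>{1..N}. chain N a K e K' * (t0 e c * word_prod N K' ?I)))
      = (\<Sum>K\<in>?M. s (q_sign N K) *
        (\<Sum>K'\<in>?M. \<Sum>e\<in>{1..N}. word_prod N K K' * (t0 a e * chain N e K' c ?I)))"
  proof (rule sum.cong[OF refl])
    fix K assume K: "K \<in> ?M"
    have "K i \<in> {1..N} \<and> ?I i \<in> {1..N}" if "i \<in> {1..N}" for i
      using multi_range[OF K that] multi_range[OF id_word_multi that] by blast
    from chain_intertwines[OF le_refl this a c]
    show "s (q_sign N K) * (\<Sum>K'\<in>?M. \<Sum>e\<in>{1..N}. chain N a K e K' * (t0 e c * word_prod N K' ?I))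
      = s (q_sign N K) * (\<Sum>K'\<in>?M. \<Sum>e\<in>{1..N}. word_prod N K K' * (t0 a e * chain N e K' c ?I))"
      by (rule arg_cong)
  qed
  then have "eigenvalue N * (t0 a c * qdet) = qdet * (t0 a c * eigenvalue N)"
    unfolding left right .
  also have "\<dots> = eigenvalue N * (qdet * t0 a c)"
    using eigenvalue_central[of N "qdet * t0 a c"] by (simp only: mult.assoc)
  finally show ?thesis by (simp add: right_diff_distrib)
qed

end

section \<open>Fusion of the coefficients of currents\<close>

context central_scalars
begin

lemma s_power_shift: "s (fps_exp (- of_int (n + 1))) = s (fps_exp (-1)) * s (fps_exp (- of_int n))"
  by (simp add: fps_exp_mult_collect algebra_simps flip: s_mult)

text \<open>The scalars \<open>exp(-n h)\<close> change by the factor \<open>exp(-h)\<close> from one term to the next, so summation by parts turns the sum of the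
\<open>exp(-n h) e n\<close> into \<open>1 - exp(-h)\<close> times that of the \<open>exp(-n h) E n\<close>, where \<open>E\<close> are the partial sums of \<open>e\<close>; and the \<open>g n\<close> are
\<open>- (1/q - q) E n\<close>. Since \<open>1/q - q = - q (1 - exp(-h))\<close>, no division by \<open>h\<close> occurs. The antisymmetry of \<open>e\<close> makes the
boundary term at the upper end vanish.\<close>

lemma abel_summation:
  fixes e g :: "int \<Rightarrow> 'a" and l u :: int
  assumes step: "\<And>n. g n - g (n - 1) = - s (fps_exp (-1/2) - fps_exp (1/2)) * e n"
    and start: "g (l - 1) = 0"
    and antisym: "\<And>n. e (l + u - n) = - e n"
  shows "(\<Sum>n=l..u. s (fps_exp (- of_int n)) * g n) =
    s (fps_exp (1/2)) * (\<Sum>n=l..u. s (fps_exp (- of_int n)) * e n)"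
proof (cases "l - 1 \<le> u")
  case True
  let ?\<delta> = "s (fps_exp (-1/2) - fps_exp (1/2))"
  let ?c = "\<lambda>n::int. s (fps_exp (- of_int n))"
  define E where "E n = (\<Sum>j=l..n. e j)" for n
  have E_step: "E (n + 1) = E n + e (n + 1)" if "n \<ge> l - 1" for n
  proof -
    have "{l..n + 1} = insert (n + 1) {l..n}" using that by auto
    then show ?thesis by (simp add: E_def add.commute)
  qed
  have g: "g n = - ?\<delta> * E n" if "n \<ge> l - 1" for n
    using that
  proof (induction n rule: int_ge_induct)
    case base
    then show ?case by (simp add: start E_def)
  next
    case (step n)
    have "g (n + 1) = g n - ?\<delta> * e (n + 1)"
      using assms(1)[of "n + 1"] by (simp add: algebra_simps)
    then show ?case
      by (simp only: step.IH E_step[OF step.hyps]) (simp add: distrib_left)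
  qed
  have "(\<Sum>j=l..u. e j) = (\<Sum>j=l..u. e (l + u - j))"
    by (rule sum.reindex_bij_witness[of _ "\<lambda>j. l + u - j" "\<lambda>j. l + u - j"]) auto
  also have "\<dots> = - (\<Sum>j=l..u. e j)"
    by (simp only: antisym sum_negf)
  finally have E_end: "E u = 0"
    unfolding E_def by (rule eq_zero_of_eq_minus)
  have abel: "(\<Sum>n=l..M. ?c n * e n) = s (1 - fps_exp (-1)) * (\<Sum>n=l..M. ?c n * E n) + ?c (M + 1) * E M"
    if "M \<ge> l - 1" for M
    using that
  proof (induction M rule: int_ge_induct)
    case base
    then show ?case by (simp add: E_def)
  next
    case (step M)
    have "{l..M + 1} = insert (M + 1) {l..M}" using step.hyps by auto
    then show ?case
      using step.IH s_power_shift[of "M + 1"]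
      by (simp add: E_step[OF step.hyps, unfolded add.commute[of M 1]] algebra_simps s_diff del: of_int_add)
  qed
  have "(\<Sum>n=l..u. ?c n * g n) = - ?\<delta> * (\<Sum>n=l..u. ?c n * E n)"
    unfolding sum_distrib_left by (rule sum.cong) (simp_all add: g s_commute)
  also have "- ?\<delta> = s (fps_exp (1/2)) * s (1 - fps_exp (-1))"
    by (simp add: s_diff algebra_simps fps_exp_mult_collect flip: s_mult)
  finally show ?thesis
    unfolding abel[OF True] E_end by (simp add: mult.assoc)
qed simp

end

text \<open>Coefficients of series \<open>t\<^sub>i\<^sub>j(x) = \<Sum>\<^sub>r t\<^sub>i\<^sub>j(r) x\<^sup>r\<close> that are bounded above in \<open>r\<close>. The assumption \<open>rtt_coeff\<close> compares the
coefficients of \<open>x\<^sup>m y\<^sup>n\<close> in \<open>R(x, y) T\<^sub>1(x) T\<^sub>2(y) = T\<^sub>2(y) T\<^sub>1(x) R(x, y)\<close>.\<close>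

locale rtt_currents = central_scalars s for s :: "complex fps \<Rightarrow> 'a::ring_1" +
  fixes N :: nat and p :: int and t :: "nat \<Rightarrow> nat \<Rightarrow> int \<Rightarrow> 'a"
  assumes bounded: "r > p \<Longrightarrow> t i j r = 0"
    and rtt_coeff: "\<lbrakk>a \<in> {1..N}; b \<in> {1..N}; c \<in> {1..N}; d \<in> {1..N}\<rbrakk> \<Longrightarrow>
      (\<Sum>e\<in>{1..N}. \<Sum>f\<in>{1..N}. s (r_hi a b e f) * (t e c (m - 1) * t f d n)
        + s (r_lo a b e f) * (t e c m * t f d (n - 1))) =
      (\<Sum>e\<in>{1..N}. \<Sum>f\<in>{1..N}. s (r_hi e f c d) * (t b f n * t a e (m - 1))
        + s (r_lo e f c d) * (t b f (n - 1) * t a e m))"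
begin

lemma sum_row_support:
  assumes a: "a \<in> {1..N}" "b \<in> {1..N}" and ab: "a \<noteq> b"
    and F: "\<And>e f. \<not> (a = e \<and> b = f \<or> a = f \<and> b = e) \<Longrightarrow> F e f = (0::'a)"
  shows "(\<Sum>e\<in>{1..N}. \<Sum>f\<in>{1..N}. F e f) = F a b + F b a"
proof -
  have "(\<Sum>e\<in>{1..N}. \<Sum>f\<in>{1..N}. F e f) = (\<Sum>(e, f)\<in>{1..N} \<times> {1..N}. F e f)"
    by (simp add: sum.cartesian_product)
  also have "\<dots> = (\<Sum>(e, f)\<in>{(a, b), (b, a)}. F e f)"
  proof (rule sum.mono_neutral_right)
    show "\<forall>x\<in>{1..N} \<times> {1..N} - {(a, b), (b, a)}. (case x of (e, f) \<Rightarrow> F e f) = 0"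
      using F by (clarsimp, metis)
  qed (use a in auto)
  finally show ?thesis using ab by simp
qed

lemma sum_diagonal_support:
  assumes a: "a \<in> {1..N}" and F: "\<And>e f. \<not> (a = e \<and> a = f) \<Longrightarrow> F e f = (0::'a)"
  shows "(\<Sum>e\<in>{1..N}. \<Sum>f\<in>{1..N}. F e f) = F a a"
proof -
  have "(\<Sum>e\<in>{1..N}. \<Sum>f\<in>{1..N}. F e f) = (\<Sum>(e, f)\<in>{1..N} \<times> {1..N}. F e f)"
    by (simp add: sum.cartesian_product)
  also have "\<dots> = (\<Sum>(e, f)\<in>{(a, a)}. F e f)"
  proof (rule sum.mono_neutral_right)
    show "\<forall>x\<in>{1..N} \<times> {1..N} - {(a, a)}. (case x of (e, f) \<Rightarrow> F e f) = 0"
      using F by (clarsimp, metis)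
  qed (use a in auto)
  finally show ?thesis by simp
qed

text \<open>The coefficients of \<open>z\<^sup>K\<close> in the entries of \<open>T\<^sub>1(z) T\<^sub>2(z exp(-h))\<close> and, below, of \<open>T\<^sub>2(z exp(-h)) T\<^sub>1(z)\<close>. Terms outside the
range of summation vanish.\<close>

definition conv :: "int \<Rightarrow> nat \<Rightarrow> nat \<Rightarrow> nat \<Rightarrow> nat \<Rightarrow> 'a" where
  "conv K a c b d = (\<Sum>r=K-p..p. s (fps_exp (- of_int r)) * (t a c (K - r) * t b d r))"

definition conv_op :: "int \<Rightarrow> nat \<Rightarrow> nat \<Rightarrow> nat \<Rightarrow> nat \<Rightarrow> 'a" where
  "conv_op K b d a c = (\<Sum>r=K-p..p. s (fps_exp (- of_int r)) * (t b d r * t a c (K - r)))"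

text \<open>The identity \<open>(1 - P) T\<^sub>1(z) T\<^sub>2(z exp(-h)) = T\<^sub>2(z exp(-h)) T\<^sub>1(z) (1 - P)\<close>. Let \<open>F\<close> be the flip of the two factors and
\<open>U = 1 - P + q F\<close>. Then \<open>R(x, y) = (x - y) U + (1/q - q) x F\<close>, and the RTT relation becomes
\<open>(x - y) (U T\<^sub>1 T\<^sub>2 - T\<^sub>2 T\<^sub>1 U) = (q - 1/q) x (F T\<^sub>1 T\<^sub>2 - T\<^sub>2 T\<^sub>1 F)\<close>. At \<open>y = x exp(-h)\<close> both sides carry the
factor \<open>1 - exp(-h)\<close>, which \<open>abel_summation\<close> cancels; what remains is
\<open>U T\<^sub>1 T\<^sub>2 - T\<^sub>2 T\<^sub>1 U = q (F T\<^sub>1 T\<^sub>2 - T\<^sub>2 T\<^sub>1 F)\<close>, that is, the claim.\<close>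

lemma conv_exchange:
  assumes a: "a \<in> {1..N}" and b: "b \<in> {1..N}" and c: "c \<in> {1..N}" and d: "d \<in> {1..N}"
    and ab: "a \<noteq> b"
  shows "conv K a c b d - s (swap_weight a b) * conv K b c a d =
    conv_op K b d a c - s (swap_weight d c) * conv_op K b c a d"
proof -
  let ?\<delta> = "fps_exp (-1/2) - fps_exp (1/2) :: complex fps"
  \<comment> \<open>The diagonal entry of \<open>U\<close> at the word \<open>c d\<close>, and minus its off-diagonal entries in the column \<open>c d\<close> and in the row \<open>a b\<close>.\<close>
  define \<kappa> where "\<kappa> = (if c = d then fps_exp (1/2) else 1 :: complex fps)"
  define \<nu> where "\<nu> = (if d < c then ?\<delta> else 0)"
  define \<mu> where "\<mu> = (if a < b then ?\<delta> else 0)"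
  \<comment> \<open>The coefficients of \<open>x\<^sup>m y\<^sup>n\<close> in \<open>U T\<^sub>1 T\<^sub>2 - T\<^sub>2 T\<^sub>1 U\<close> and in \<open>F T\<^sub>1 T\<^sub>2 - T\<^sub>2 T\<^sub>1 F\<close>; the latter is \<open>H m n - H n m\<close>.\<close>
  define G where "G m n = t a c m * t b d n - s \<mu> * (t b c m * t a d n)
      - (s \<kappa> * (t b d n * t a c m) - s \<nu> * (t b c n * t a d m))" for m n
  define H where "H m n = t b c m * t a d n" for m n
  have left: "(\<Sum>e\<in>{1..N}. \<Sum>f\<in>{1..N}. s (r_hi a b e f) * (t e c (m - 1) * t f d n)
        + s (r_lo a b e f) * (t e c m * t f d (n - 1)))
    = t a c (m - 1) * t b d n - t a c m * t b d (n - 1)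
      + s (?\<delta> - \<mu>) * H (m - 1) n + s \<mu> * H m (n - 1)" for m n
    using ab by (subst sum_row_support[OF a b ab])
      (auto simp: r_hi_def r_lo_def \<mu>_def H_def s_minus)
  have right: "(\<Sum>e\<in>{1..N}. \<Sum>f\<in>{1..N}. s (r_hi e f c d) * (t b f n * t a e (m - 1))
        + s (r_lo e f c d) * (t b f (n - 1) * t a e m))
    = s \<kappa> * (t b d n * t a c (m - 1)) - s \<kappa> * (t b d (n - 1) * t a c m)
      + s (?\<delta> - \<nu>) * H n (m - 1) + s \<nu> * H (n - 1) m" for m n
  proof (cases "c = d")
    case True
    show ?thesis
      unfolding True by (subst sum_diagonal_support[OF d])
        (auto simp: r_hi_def r_lo_def \<kappa>_def \<nu>_def True H_def s_minus s_diff algebra_simps)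
  next
    case False
    then show ?thesis
      by (subst sum_row_support[OF c d False])
        (auto simp: r_hi_def r_lo_def \<kappa>_def \<nu>_def H_def s_minus)
  qed
  have step: "G (m - 1) n - G m (n - 1) = - s ?\<delta> * (H (m - 1) n - H n (m - 1))" for m n
    using rtt_coeff[OF a b c d, of m n] unfolding left right
    by (simp add: G_def H_def s_diff s_add algebra_simps)
  have G_bound: "G m n = 0" if "m > p" for m n
    using bounded[OF that] by (simp add: G_def)
  have "(\<Sum>r=K-p..p. s (fps_exp (- of_int r)) * G (K - r) r)
      = s (fps_exp (1/2)) * (\<Sum>r=K-p..p. s (fps_exp (- of_int r)) * (H (K - r) r - H r (K - r)))"
  proof (rule abel_summation)
    show "G (K - n) n - G (K - (n - 1)) (n - 1) = - s ?\<delta> * (H (K - n) n - H n (K - n))" for n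
      using step[of "K - n + 1" n] by (simp add: algebra_simps)
  qed (simp_all add: G_bound)
  then have "conv K a c b d - s \<mu> * conv K b c a d - (s \<kappa> * conv_op K b d a c - s \<nu> * conv_op K b c a d)
    = s (fps_exp (1/2)) * (conv K b c a d - conv_op K b c a d)"
    unfolding conv_def conv_op_def G_def H_def sum_distrib_left
    by (simp add: sum_subtractf[symmetric] right_diff_distrib s_commute sum_distrib_left)
  moreover have "swap_weight a b = \<mu> + fps_exp (1/2)"
    using ab by (auto simp: swap_weight_def \<mu>_def)
  ultimately have main: "conv K a c b d - s (swap_weight a b) * conv K b c a d =
     s \<kappa> * conv_op K b d a c - s (\<nu> + fps_exp (1/2)) * conv_op K b c a d"
    by (simp add: s_add algebra_simps)
  show ?thesis
  proof (cases "c = d")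
    case True
    then show ?thesis unfolding main by (simp add: \<kappa>_def \<nu>_def swap_weight_def)
  next
    case False
    then have "swap_weight d c = \<nu> + fps_exp (1/2)" "\<kappa> = 1"
      by (auto simp: swap_weight_def \<nu>_def \<kappa>_def)
    then show ?thesis unfolding main by simp
  qed
qed

text \<open>Multiply \<open>conv_exchange\<close> by \<open>1 + P\<close> from the right and use that \<open>P\<close> is an involution.\<close>

lemma conv_fusion:
  assumes "i \<in> {1..N}" "j \<in> {1..N}" "c \<in> {1..N}" "d \<in> {1..N}"
  shows "conv K i c j d - s (swap_weight i j) * conv K j c i d
    + s (swap_weight d c) * (conv K i d j c - s (swap_weight i j) * conv K j d i c) = 0"
proof (cases "i = j")
  case True
  then show ?thesis by (simp add: swap_weight_def)
next
  case False
  have cancel: "s (swap_weight d c) * (s (swap_weight c d) * x) = x" for x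
    by (simp add: swap_weight_inverse flip: mult.assoc s_mult)
  show ?thesis
    unfolding conv_exchange[OF assms False] conv_exchange[OF assms(1,2,4,3) False]
    by (simp add: right_diff_distrib cancel)
qed

end

section \<open>Currents as Laurent series\<close>

notation fls_nth (infixl "$$" 75)

text \<open>A coefficient of a product as a sum over any finite set that contains all nonzero terms, irrespective of the exact order of
vanishing of the factors.\<close>

lemma fls_times_nth_support:
  fixes F G :: "'a::ring_1 fls"
  assumes "finite A" and supp: "\<And>i. F $$ i \<noteq> 0 \<Longrightarrow> G $$ (n - i) \<noteq> 0 \<Longrightarrow> i \<in> A"
  shows "(F * G) $$ n = (\<Sum>i\<in>A. F $$ i * G $$ (n - i))"
proof -
  let ?B = "{fls_subdegree F..n - fls_subdegree G}"
  have "(F * G) $$ n = (\<Sum>i\<in>?B. F $$ i * G $$ (n - i))"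
    by (rule fls_times_nth(2))
  also have "\<dots> = (\<Sum>i\<in>A \<union> ?B. F $$ i * G $$ (n - i))"
  proof (rule sum.mono_neutral_left)
    show "\<forall>i\<in>A \<union> ?B - ?B. F $$ i * G $$ (n - i) = 0"
    proof
      fix i assume "i \<in> A \<union> ?B - ?B"
      then have "i < fls_subdegree F \<or> n - i < fls_subdegree G" by auto
      then show "F $$ i * G $$ (n - i) = 0" by auto
    qed
  qed (use assms(1) in auto)
  also have "\<dots> = (\<Sum>i\<in>A. F $$ i * G $$ (n - i))"
  proof (rule sum.mono_neutral_right)
    show "\<forall>i\<in>A \<union> ?B - A. F $$ i * G $$ (n - i) = 0"
      using supp by (metis DiffE mult_zero_left mult_zero_right)
  qed (use assms(1) in auto)
  finally show ?thesis .
qed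

lemma fls_const_sum: "fls_const (sum f A) = (\<Sum>i\<in>A. fls_const (f i :: 'a::ring_1))"
  by (induction A rule: infinite_finite_induct) (simp_all flip: fls_plus_const)

lemma fls_const_inject: "fls_const a = fls_const b \<Longrightarrow> a = (b :: 'a::ring_1)"
  by (metis (full_types) fls_const_nth)

lemma fls_X_inv_commute: "fls_X_inv * x = x * (fls_X_inv :: 'a::ring_1 fls)"
  by (simp add: fls_X_inv_times_conv_shift)

text \<open>The equation determines each coefficient of \<open>x\<close> by the preceding one, and the coefficients of low degree are zero.\<close>

lemma linear_factor_regular:
  fixes x :: "'a::ring_1 fls"
  assumes "u' * u = 1" and zero: "(fls_const u * fls_X_inv - fls_const v) * x = 0"
  shows "x = 0"
proof -
  have nth: "x $$ (n + 1) = u' * (v * x $$ n)" for n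
  proof -
    have "((fls_const u * fls_X_inv - fls_const v) * x) $$ n = u * x $$ (n + 1) - v * x $$ n"
      by (simp add: left_diff_distrib mult.assoc fls_X_inv_times_conv_shift(1))
    then have "u * x $$ (n + 1) = v * x $$ n" using zero by simp
    then show ?thesis using assms(1) by (metis mult.assoc mult_1_left)
  qed
  have "x $$ n = 0" for n
  proof (cases "n \<ge> fls_subdegree x - 1")
    case True
    then show ?thesis
      by (induction n rule: int_ge_induct) (simp_all add: nth)
  qed simp
  then show ?thesis by (rule fls_zero_eqI)
qed

context central_scalars
begin

lemma central_scalars_fls: "central_scalars (\<lambda>c. fls_const (s c))"
proof
  fix c and x :: "'a fls"
  show "fls_const (s c) * x = x * fls_const (s c)"
    by (rule fls_eqI) (simp add: s_central)
qed (simp_all add: s_add s_mult fls_plus_const)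

end

context rtt_currents
begin

text \<open>The series \<open>t\<^sub>i\<^sub>j(z exp(-(k-1)h))\<close> as Laurent series in \<open>1/z\<close>; the degree in \<open>1/z\<close> is minus the exponent of \<open>z\<close>. Below,
\<open>spectator\<close> and \<open>variable\<close> are \<open>t\<^sub>i\<^sub>j(x)\<close> and the point \<open>z exp(-(k-1)h)\<close> as Laurent series in \<open>1/x\<close> over Laurent series in \<open>1/z\<close>.\<close>

definition current :: "nat \<Rightarrow> nat \<Rightarrow> nat \<Rightarrow> 'a fls" where
  "current k i j = Abs_fls (\<lambda>n. s (fps_exp (of_int ((int k - 1) * n))) * t i j (- n))"

lemma current_nth: "current k i j $$ n = s (fps_exp (of_int ((int k - 1) * n))) * t i j (- n)"
  unfolding current_def by (rule nth_Abs_fls_lower_bound[of "- p"]) (simp add: bounded)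

definition spectator :: "nat \<Rightarrow> nat \<Rightarrow> 'a fls fls" where
  "spectator i j = Abs_fls (\<lambda>n. fls_const (t i j (- n)))"

lemma spectator_nth: "spectator i j $$ n = fls_const (t i j (- n))"
  unfolding spectator_def by (rule nth_Abs_fls_lower_bound[of "- p"]) (simp add: bounded)

definition variable :: "nat \<Rightarrow> 'a fls fls" where
  "variable k = fls_const (fls_const (s (fps_exp (- of_int (int k - 1)))) * fls_X_inv)"

lemma current_product:
  "(current k a c * current (Suc k) b d) $$ n = s (fps_exp (of_int ((int k - 1) * n))) * conv (- n) a c b d"
proof -
  have "(current k a c * current (Suc k) b d) $$ n =
      (\<Sum>i=- p..p + n. current k a c $$ i * current (Suc k) b d $$ (n - i))"
  proof (rule fls_times_nth_support)
    fix i assume "current k a c $$ i \<noteq> 0" "current (Suc k) b d $$ (n - i) \<noteq> 0"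
    then have "\<not> - i > p" "\<not> - (n - i) > p"
      using bounded unfolding current_nth by fastforce+
    then show "i \<in> {- p..p + n}" by simp
  qed simp
  also have "\<dots> = (\<Sum>r=- n - p..p. current k a c $$ (r + n) * current (Suc k) b d $$ (- r))"
    by (rule sum.reindex_bij_witness[of _ "\<lambda>r. r + n" "\<lambda>i. i - n"]) auto
  also have "\<dots> = (\<Sum>r=- n - p..p. s (fps_exp (of_int ((int k - 1) * n))) *
      (s (fps_exp (- of_int r)) * (t a c (- n - r) * t b d r)))"
  proof (rule sum.cong[OF refl])
    fix r
    have "fps_exp (of_int ((int k - 1) * (r + n))) * fps_exp (of_int (int k * (- r))) =
        fps_exp (of_int ((int k - 1) * n)) * (fps_exp (- of_int r) :: complex fps)"
      by (simp add: fps_exp_mult_collect algebra_simps)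
    then have weights: "s (fps_exp (of_int ((int k - 1) * (r + n)))) * s (fps_exp (of_int (int k * (- r)))) =
        s (fps_exp (of_int ((int k - 1) * n))) * s (fps_exp (- of_int r))"
      by (simp only: s_mult[symmetric])
    have left: "current k a c $$ (r + n) = s (fps_exp (of_int ((int k - 1) * (r + n)))) * t a c (- n - r)"
    proof -
      have "- (r + n) = - n - r" by simp
      then show ?thesis by (simp only: current_nth)
    qed
    have right: "current (Suc k) b d $$ (- r) = s (fps_exp (of_int (int k * (- r)))) * t b d r"
      by (simp add: current_nth)
    show "current k a c $$ (r + n) * current (Suc k) b d $$ (- r) =
      s (fps_exp (of_int ((int k - 1) * n))) * (s (fps_exp (- of_int r)) * (t a c (- n - r) * t b d r))"
      unfolding left right mult.assoc s_left_commute[of "t a c (- n - r)"]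
      by (simp only: mult.assoc[symmetric] weights)
  qed
  finally show ?thesis by (simp add: conv_def sum_distrib_left)
qed

text \<open>The first argument \<open>T\<^sub>0(x)\<close> and the currents at \<open>z exp(-(k-1)h)\<close> lie in different variables, so the RTT relation between them can be
checked on coefficients; for two neighbouring currents, which share \<open>z\<close>, the fusion property is \<open>conv_fusion\<close>.\<close>

sublocale loop: rtt_chain "\<lambda>c. fls_const (fls_const (s c))" N fls_X_inv variable spectator
  "\<lambda>k i j. fls_const (current k i j)"
proof -
  interpret inner: central_scalars "\<lambda>c. fls_const (s c)" by (rule central_scalars_fls)
  interpret outer: central_scalars "\<lambda>c. fls_const (fls_const (s c))" by (rule inner.central_scalars_fls)
  have variable_commute: "variable k * x = x * variable k" for k x
  proof (rule fls_eqI)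
    fix n
    have "fls_const (s c) * fls_X_inv * f = f * (fls_const (s c) * fls_X_inv)" for c and f :: "'a fls"
      by (metis fls_X_inv_commute inner.s_central mult.assoc)
    then show "(variable k * x) $$ n = (x * variable k) $$ n"
      by (simp add: variable_def)
  qed
  show "rtt_chain (\<lambda>c. fls_const (fls_const (s c))) N fls_X_inv variable spectator
      (\<lambda>k i j. fls_const (current k i j))"
  proof unfold_locales
    show "fls_X_inv * x = x * fls_X_inv" for x :: "'a fls fls"
      by (rule fls_X_inv_commute)
    show "variable k * x = x * variable k" for k x
      by (rule variable_commute)
    show "variable (Suc k) = fls_const (fls_const (s (fps_exp (- 1)))) * variable k" for k
      by (simp add: variable_def mult.assoc[symmetric] fps_exp_mult_collect algebra_simps flip: s_mult)
  next
    fix k a b c d assume k: "k \<in> {1..N}" and abcd: "a \<in> {1..N}" "b \<in> {1..N}" "c \<in> {1..N}" "d \<in> {1..N}"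
    \<comment> \<open>Multiplication by \<open>x\<close> or \<open>z\<close> lowers the degree in \<open>1/x\<close> or \<open>1/z\<close> by one.\<close>
    have entry: "(outer.R_entry fls_X_inv (variable k) i j i' j' * x) $$ m $$ n =
        s (r_hi i j i' j') * (x $$ (m + 1) $$ n)
        + s (r_lo i j i' j') * (s (fps_exp (- of_int (int k - 1))) * (x $$ m $$ (n + 1)))"
      for i j i' j' x m n
      by (simp add: outer.R_entry_def variable_def distrib_right mult.assoc fls_X_inv_times_conv_shift(1))
    have entry': "(x * outer.R_entry fls_X_inv (variable k) i j i' j') $$ m $$ n =
        s (r_hi i j i' j') * (x $$ (m + 1) $$ n)
        + s (r_lo i j i' j') * (s (fps_exp (- of_int (int k - 1))) * (x $$ m $$ (n + 1)))"
      for i j i' j' x m n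
      unfolding outer.R_entry_commute[OF fls_X_inv_commute variable_commute, symmetric] by (rule entry)
    \<comment> \<open>The scalar \<open>\<omega> n\<close> is the one contained in the coefficient of degree \<open>n\<close> of the \<open>k\<close>-th current.\<close>
    define \<omega> where "\<omega> n = s (fps_exp (of_int ((int k - 1) * n)))" for n
    have \<omega>_commute: "x * (\<omega> n * x') = \<omega> n * (x * x')" for x x' n
      unfolding \<omega>_def by (rule s_left_commute)
    have gen: "(spectator i j * fls_const (current k i' j')) $$ m $$ n =
        \<omega> n * (t i j (- m) * t i' j' (- n))"
      "(fls_const (current k i' j') * spectator i j) $$ m $$ n =
        \<omega> n * (t i' j' (- n) * t i j (- m))" for i j i' j' m n
      unfolding fls_mult_const_nth spectator_nth current_nth \<omega>_def[symmetric]
      by (simp_all only: \<omega>_commute mult.assoc)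
    have weight: "s (fps_exp (- of_int (int k - 1))) * (\<omega> (n + 1) * x) = \<omega> n * x" for n x
      by (simp add: \<omega>_def fps_exp_mult_collect algebra_simps flip: s_mult mult.assoc)
    have neg: "- (x + 1) = - x - 1" for x :: int
      by simp
    show "(\<Sum>e\<in>{1..N}. \<Sum>f\<in>{1..N}. outer.R_entry fls_X_inv (variable k) a b e f *
          (spectator e c * fls_const (current k f d))) =
      (\<Sum>e\<in>{1..N}. \<Sum>f\<in>{1..N}. fls_const (current k b f) * spectator a e *
          outer.R_entry fls_X_inv (variable k) e f c d)" (is "?l = ?r")
    proof (rule fls_eqI, rule fls_eqI)
      fix m n
      have "?l $$ m $$ n = \<omega> n * (\<Sum>e\<in>{1..N}. \<Sum>f\<in>{1..N}.
          s (r_hi a b e f) * (t e c (- m - 1) * t f d (- n))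
          + s (r_lo a b e f) * (t e c (- m) * t f d (- n - 1)))"
        unfolding fls_nth_sum entry gen weight neg
        unfolding sum_distrib_left \<omega>_commute distrib_left by (rule refl)
      also have "\<dots> = \<omega> n * (\<Sum>e\<in>{1..N}. \<Sum>f\<in>{1..N}.
          s (r_hi e f c d) * (t b f (- n) * t a e (- m - 1))
          + s (r_lo e f c d) * (t b f (- n - 1) * t a e (- m)))"
        by (simp only: rtt_coeff[OF abcd])
      also have "\<dots> = ?r $$ m $$ n"
        unfolding fls_nth_sum entry' gen weight neg
        unfolding sum_distrib_left \<omega>_commute distrib_left by (rule refl)
      finally show "?l $$ m $$ n = ?r $$ m $$ n" .
    qed
  next
    fix k i j c d assume k: "k \<in> {1..<N}" and ij: "i \<in> {1..N}" "j \<in> {1..N}" "c \<in> {1..N}" "d \<in> {1..N}"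
    have "current k i c * current (Suc k) j d
        - fls_const (s (swap_weight i j)) * (current k j c * current (Suc k) i d)
      + fls_const (s (swap_weight d c)) * (current k i d * current (Suc k) j c
        - fls_const (s (swap_weight i j)) * (current k j d * current (Suc k) i c)) = 0" (is "?x = 0")
    proof (rule fls_zero_eqI)
      fix n
      define w where "w = s (fps_exp (of_int ((int k - 1) * n)))"
      have w: "s c * (w * x) = w * (s c * x)" for c x
        unfolding w_def by (rule s_commute)
      have "?x $$ n = w * (conv (- n) i c j d - s (swap_weight i j) * conv (- n) j c i d
         + s (swap_weight d c) * (conv (- n) i d j c - s (swap_weight i j) * conv (- n) j d i c))"
        unfolding fls_plus_nth fls_minus_nth fls_mult_const_nth current_product w_def[symmetric]
        by (simp only: right_diff_distrib distrib_left w)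
      then show "?x $$ n = 0"
        by (simp only: conv_fusion[OF ij] mult_zero_right)
    qed
    from arg_cong[OF this, of fls_const]
    show "fls_const (current k i c) * fls_const (current (Suc k) j d)
        - fls_const (fls_const (s (swap_weight i j))) * (fls_const (current k j c) * fls_const (current (Suc k) i d))
      + fls_const (fls_const (s (swap_weight d c))) * (fls_const (current k i d) * fls_const (current (Suc k) j c)
        - fls_const (fls_const (s (swap_weight i j))) * (fls_const (current k j d) * fls_const (current (Suc k) i c))) = 0"
      by (simp add: fls_plus_const fls_minus_const)
  qed
qed

section \<open>The quantum determinant of the currents\<close>

text \<open>As Laurent series in \<open>1/x\<close>, the factors of the eigenvalue have an invertible coefficient at \<open>x\<close>.\<close>

lemma eigenvalue_regular: "loop.eigenvalue n * x = 0 \<Longrightarrow> x = 0"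
proof (induction n)
  case (Suc n)
  define v where "v = fls_const (s (fps_exp (- of_int (int (Suc n) - 1)))) * (fls_X_inv :: 'a fls)"
  have v: "variable (Suc n) = fls_const v"
    by (simp only: variable_def v_def)
  have "loop.eigenvalue n * x = 0"
  proof (cases "n = 0")
    case True
    show ?thesis
    proof (rule linear_factor_regular)
      show "fls_const (s (fps_exp (1/2))) * fls_const (s (fps_exp (-1/2))) = 1"
        by (simp add: fps_exp_mult_collect flip: s_mult)
      show "(fls_const (fls_const (s (fps_exp (-1/2)))) * fls_X_inv
          - fls_const (fls_const (s (fps_exp (1/2))) * v)) * (loop.eigenvalue n * x) = 0"
        using Suc.prems True v by (simp add: mult.assoc)
    qed
  next
    case False
    show ?thesis
    proof (rule linear_factor_regular)
      show "(fls_const 1 * fls_X_inv - fls_const v) * (loop.eigenvalue n * x) = 0"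
        using Suc.prems False by (simp add: v mult.assoc)
    qed simp
  qed
  then show ?case by (rule Suc.IH)
qed simp

primrec current_word :: "nat \<Rightarrow> (nat \<Rightarrow> nat) \<Rightarrow> (nat \<Rightarrow> nat) \<Rightarrow> 'a fls" where
  "current_word 0 K L = 1"
| "current_word (Suc n) K L = current_word n K L * current (Suc n) (K (Suc n)) (L (Suc n))"

lemma word_prod_current: "loop.word_prod n K L = fls_const (current_word n K L)"
  by (induction n) simp_all

definition current_qdet :: "'a fls" where
  "current_qdet = (\<Sum>K\<in>multi N N. fls_const (s (q_sign N K)) * current_word N K (id_word N))"

lemma loop_qdet: "loop.qdet = fls_const current_qdet"
  by (simp add: loop.qdet_def current_qdet_def word_prod_current fls_const_sum)

lemma current_word_skew:
  assumes "L \<in> multi N N"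
  shows "(\<Sum>K\<in>multi N N. s (q_sign N K) * current_word N K L $$ n) = s (q_sign N L) * current_qdet $$ n"
proof -
  have "fls_const (\<Sum>K\<in>multi N N. fls_const (s (q_sign N K)) * current_word N K L)
      = fls_const (fls_const (s (q_sign N L)) * current_qdet)"
    using loop.word_prod_skew[OF assms]
    by (simp add: word_prod_current loop_qdet fls_const_sum)
  then have "(\<Sum>K\<in>multi N N. fls_const (s (q_sign N K)) * current_word N K L)
      = fls_const (s (q_sign N L)) * current_qdet"
    by (rule fls_const_inject)
  from arg_cong[OF this, of "\<lambda>f. f $$ n"] show ?thesis
    by (simp add: fls_nth_sum)
qed

lemma current_qdet_central:
  assumes "a \<in> {1..N}" "c \<in> {1..N}"
  shows "t a c r * current_qdet $$ n = current_qdet $$ n * t a c r"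
proof -
  have "spectator a c * loop.qdet - loop.qdet * spectator a c = 0"
    by (rule eigenvalue_regular[OF loop.qdet_commutes[OF assms]])
  then have "spectator a c * fls_const current_qdet = fls_const current_qdet * spectator a c"
    by (simp add: loop_qdet)
  from arg_cong[OF this, of "\<lambda>f. f $$ (- r) $$ n"] show ?thesis
    by (simp add: spectator_nth)
qed

definition exponents :: "nat \<Rightarrow> int \<Rightarrow> (nat \<Rightarrow> int) set" where
  "exponents m n = {r \<in> {1..m} \<rightarrow>\<^sub>E {..p}. (\<Sum>k\<in>{1..m}. r k) = n}"

primrec coeff_word :: "nat \<Rightarrow> (nat \<Rightarrow> nat) \<Rightarrow> (nat \<Rightarrow> nat) \<Rightarrow> (nat \<Rightarrow> int) \<Rightarrow> 'a" where
  "coeff_word 0 K L r = 1"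
| "coeff_word (Suc m) K L r = coeff_word m K L r *
    (s (fps_exp (- of_int ((int (Suc m) - 1) * r (Suc m)))) * t (K (Suc m)) (L (Suc m)) (r (Suc m)))"

lemma coeff_word_cong: "(\<And>k. k \<in> {1..m} \<Longrightarrow> r k = r' k) \<Longrightarrow> coeff_word m K L r = coeff_word m K L r'"
  by (induction m) simp_all

lemma exponents_0: "exponents 0 n = (if n = 0 then {\<lambda>_. undefined} else {})"
  by (auto simp: exponents_def)

lemma exponents_bound:
  assumes "r \<in> exponents m n"
  shows "n \<le> int m * p"
proof -
  have "(\<Sum>k\<in>{1..m}. r k) \<le> (\<Sum>k\<in>{1..m}. p)"
    using assms by (intro sum_mono) (auto simp: exponents_def PiE_iff)
  then show ?thesis using assms by (simp add: exponents_def)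
qed

text \<open>The choice of the last exponent \<open>q\<close>; it ranges over a finite interval because the other exponents are at most \<open>p\<close>.\<close>

lemma exponents_Suc:
  "bij_betw (\<lambda>(q, r). r(Suc m := q)) (SIGMA q:{n - int m * p..p}. exponents m (n - q)) (exponents (Suc m) n)"
proof (rule bij_betwI[where g = "\<lambda>r. (r (Suc m), r(Suc m := undefined))"])
  have split: "(\<Sum>k\<in>{1..Suc m}. f k) = (\<Sum>k\<in>{1..m}. f k) + f (Suc m)" for f :: "nat \<Rightarrow> int"
    by simp
  show "(\<lambda>(q, r). r(Suc m := q)) \<in> (SIGMA q:{n - int m * p..p}. exponents m (n - q)) \<rightarrow> exponents (Suc m) n"
    unfolding exponents_def split by (auto simp: PiE_iff extensional_def)
  show "(\<lambda>r. (r (Suc m), r(Suc m := undefined))) \<in> exponents (Suc m) n \<rightarrow>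
      (SIGMA q:{n - int m * p..p}. exponents m (n - q))"
  proof
    fix r assume r: "r \<in> exponents (Suc m) n"
    then have restr: "r(Suc m := undefined) \<in> exponents m (n - r (Suc m))"
      unfolding exponents_def split by (auto simp: PiE_iff extensional_def)
    from r have "r (Suc m) \<le> p"
      by (auto simp: exponents_def PiE_iff)
    then show "(r (Suc m), r(Suc m := undefined)) \<in> (SIGMA q:{n - int m * p..p}. exponents m (n - q))"
      using restr exponents_bound[OF restr] by simp
  qed
  show "(\<lambda>r. (r (Suc m), r(Suc m := undefined))) ((\<lambda>(q, r). r(Suc m := q)) x) = x"
    if "x \<in> (SIGMA q:{n - int m * p..p}. exponents m (n - q))" for x
    using that by (auto simp: exponents_def PiE_iff extensional_def fun_eq_iff)
  show "(\<lambda>(q, r). r(Suc m := q)) (r (Suc m), r(Suc m := undefined)) = r" for r :: "nat \<Rightarrow> int"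
    by simp
qed

lemma finite_exponents: "finite (exponents m n)"
proof (induction m arbitrary: n)
  case (Suc m)
  have "finite (SIGMA q:{n - int m * p..p}. exponents m (n - q))"
    using Suc.IH by simp
  then show ?case using bij_betw_finite[OF exponents_Suc] by blast
qed (simp add: exponents_0)

lemma current_word_coeff: "current_word m K L $$ (- n) = (\<Sum>r\<in>exponents m n. coeff_word m K L r)"
proof (induction m arbitrary: n)
  case 0
  then show ?case by (simp add: exponents_0)
next
  case (Suc m)
  have "current_word (Suc m) K L $$ (- n) =
      (\<Sum>i=- p..int m * p - n. current_word m K L $$ (- n - i) * current (Suc m) (K (Suc m)) (L (Suc m)) $$ i)"
  proof -
    have "current_word (Suc m) K L $$ (- n) = (\<Sum>i=- (int m * p)..p - n.
        current_word m K L $$ i * current (Suc m) (K (Suc m)) (L (Suc m)) $$ (- n - i))"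
      unfolding current_word.simps
    proof (rule fls_times_nth_support)
      fix i assume nz: "current_word m K L $$ i \<noteq> 0"
        "current (Suc m) (K (Suc m)) (L (Suc m)) $$ (- n - i) \<noteq> 0"
      have "exponents m (- i) \<noteq> {}"
        using nz(1) Suc.IH[of "- i"] by auto
      then have "- i \<le> int m * p"
        using exponents_bound by blast
      moreover have "\<not> - (- n - i) > p"
        using nz(2) bounded unfolding current_nth by fastforce
      ultimately show "i \<in> {- (int m * p)..p - n}" by simp
    qed simp
    also have "\<dots> = (\<Sum>i=- p..int m * p - n. current_word m K L $$ (- n - i) *
        current (Suc m) (K (Suc m)) (L (Suc m)) $$ i)"
      by (rule sum.reindex_bij_witness[of _ "\<lambda>i. - n - i" "\<lambda>i. - n - i"]) auto
    finally show ?thesis .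
  qed
  also have "\<dots> = (\<Sum>q=n - int m * p..p. current_word m K L $$ (- (n - q)) *
      current (Suc m) (K (Suc m)) (L (Suc m)) $$ (- q))"
    by (rule sum.reindex_bij_witness[of _ uminus uminus]) auto
  also have "\<dots> = (\<Sum>q=n - int m * p..p. \<Sum>r\<in>exponents m (n - q). coeff_word (Suc m) K L (r(Suc m := q)))"
  proof (rule sum.cong[OF refl])
    fix q
    have "coeff_word (Suc m) K L (r(Suc m := q)) = coeff_word m K L r *
        current (Suc m) (K (Suc m)) (L (Suc m)) $$ (- q)" for r
      using coeff_word_cong[of m "r(Suc m := q)" r K L] by (simp add: current_nth)
    then show "current_word m K L $$ (- (n - q)) * current (Suc m) (K (Suc m)) (L (Suc m)) $$ (- q)
        = (\<Sum>r\<in>exponents m (n - q). coeff_word (Suc m) K L (r(Suc m := q)))"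
      by (simp only: Suc.IH sum_distrib_right)
  qed
  also have "\<dots> = (\<Sum>(q, r)\<in>(SIGMA q:{n - int m * p..p}. exponents m (n - q)). coeff_word (Suc m) K L (r(Suc m := q)))"
    by (rule sum.Sigma) (simp_all add: finite_exponents)
  also have "\<dots> = (\<Sum>r\<in>exponents (Suc m) n. coeff_word (Suc m) K L r)"
    using sum.reindex_bij_betw[OF exponents_Suc, of "coeff_word (Suc m) K L" m n]
    by (simp only: case_prod_unfold)
  finally show ?case .
qed

end

section \<open>The antisymmetrizer\<close>

lemma at_pair_Ph:
  assumes K: "K \<in> multi N N" and J: "J \<in> multi N N" and k: "k \<in> {1..<N}"
  shows "at_pair fps_ring N k (Ph N) K J =
    (if K = swap_at k J then swap_weight (J (Suc k)) (J k) else 0)"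
proof -
  have range: "K k \<in> {1..N}" "J k \<in> {1..N}" "K (Suc k) \<in> {1..N}" "J (Suc k) \<in> {1..N}"
    using multi_range[OF K] multi_range[OF J] k by simp_all
  have eq: "K = swap_at k J \<longleftrightarrow> (\<forall>a\<in>{1..N} - {k, Suc k}. K a = J a) \<and> K k = J (Suc k) \<and> K (Suc k) = J k"
    (is "_ \<longleftrightarrow> ?R")
  proof
    assume R: ?R
    show "K = swap_at k J"
    proof
      fix a
      consider "a = k" | "a = Suc k" | "a \<in> {1..N} - {k, Suc k}" | "a \<notin> {1..N}" "a \<noteq> k" "a \<noteq> Suc k"
        using k by auto
      then show "K a = swap_at k J a"
        using R K J by cases (auto simp: multi_def PiE_iff extensional_def transpose_def)
    qed
  qed (auto simp: transpose_def)
  have at: "at_pair fps_ring N k (Ph N) K J = (if \<forall>a\<in>{1..N} - {k, Suc k}. K a = J a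
      then Ph N (K k) (J k) (K (Suc k)) (J (Suc k)) else 0)"
    by (simp add: at_pair_def)
  show ?thesis
  proof (cases "K = swap_at k J")
    case True
    have "Ph N (K k) (J k) (K (Suc k)) (J (Suc k)) = swap_weight (J (Suc k)) (J k)"
      using True unfolding eq Ph_entry[OF range] by (simp only: swap_weight_def simp_thms if_True)
    moreover have all: "\<forall>a\<in>{1..N} - {k, Suc k}. K a = J a"
      using True unfolding eq by blast
    ultimately show ?thesis
      unfolding at if_P[OF all] if_P[OF True] by blast
  next
    case False
    then have "\<not> (\<forall>a\<in>{1..N} - {k, Suc k}. K a = J a) \<or> Ph N (K k) (J k) (K (Suc k)) (J (Suc k)) = 0"
      unfolding eq Ph_entry[OF range] by argo
    then show ?thesis
      unfolding at if_not_P[OF False] by (split if_split) blast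
  qed
qed

lemma fps_central_scalars: "central_scalars (\<lambda>c :: complex fps. c)"
  by standard (simp_all add: mult.commute)

text \<open>Right multiplication by an adjacent transposition is a bijection of the symmetric group that changes the sign.\<close>

lemma antisymmetrizer_skew:
  assumes I: "I \<in> multi N N"
  shows "central_scalars.skew (\<lambda>c. c) N (antisymmetrizer N I)"
  unfolding central_scalars.skew_def[OF fps_central_scalars]
proof (intro ballI)
  fix J k assume J: "J \<in> multi N N" and k: "k \<in> {1..<N}"
  let ?t = "transpose k (Suc k)" and ?w = "swap_weight (J (Suc k)) (J k)" and ?\<rho> = "Ph_action N"
  have t: "?t permutes {1..N}"
    using transpose_permutes[OF k] by simp
  have action: "?\<rho> (p \<circ> ?t) I J = ?w * ?\<rho> p I (swap_at k J)" if p: "p permutes {1..N}" for p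
  proof -
    have "?\<rho> (p \<circ> ?t) I J = (\<Sum>K\<in>multi N N. ?\<rho> p I K * ?\<rho> ?t K J)"
      using Ph_action_exists[of N] I J p t unfolding is_Ph_action_def
      by (simp add: tmul_def)
    also have "\<dots> = (\<Sum>K\<in>multi N N. if K = swap_at k J then ?w * ?\<rho> p I K else 0)"
    proof (rule sum.cong[OF refl])
      fix K assume K: "K \<in> multi N N"
      then have "?\<rho> ?t K J = at_pair fps_ring N k (Ph N) K J"
        using Ph_action_exists[of N] J k unfolding is_Ph_action_def by simp
      then have "?\<rho> ?t K J = (if K = swap_at k J then ?w else 0)"
        unfolding at_pair_Ph[OF K J k] .
      then show "?\<rho> p I K * ?\<rho> ?t K J = (if K = swap_at k J then ?w * ?\<rho> p I K else 0)"
        by (simp only: mult.commute[of "?\<rho> p I K"] mult_zero_left if_distrib[of "\<lambda>x. x * ?\<rho> p I K"])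
    qed
    also have "\<dots> = ?w * ?\<rho> p I (swap_at k J)"
      using swap_at_multi[OF J k] by simp
    finally show ?thesis .
  qed
  let ?S = "{p. p permutes {1..N}}"
  have "?w * (\<Sum>p\<in>?S. of_int (sign p) * ?\<rho> p I (swap_at k J))
      = (\<Sum>p\<in>?S. - (of_int (sign (p \<circ> ?t)) * ?\<rho> (p \<circ> ?t) I J))"
    unfolding sum_distrib_left
  proof (rule sum.cong[OF refl])
    fix p assume "p \<in> ?S"
    then have p: "p permutes {1..N}" by simp
    have "permutation p" "permutation ?t"
      using p t by (auto intro: permutes_imp_permutation)
    then have "sign (p \<circ> ?t) = sign p * sign ?t"
      by (rule sign_compose)
    then have sign: "sign (p \<circ> ?t) = - sign p"
      by (simp add: sign_swap_id)
    show "?w * (of_int (sign p) * ?\<rho> p I (swap_at k J)) = - (of_int (sign (p \<circ> ?t)) * ?\<rho> (p \<circ> ?t) I J)"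
      unfolding sign action[OF p] of_int_minus mult_minus_left minus_minus by (rule mult.left_commute)
  qed
  also have "\<dots> = - (\<Sum>p\<in>?S. of_int (sign (p \<circ> ?t)) * ?\<rho> (p \<circ> ?t) I J)"
    by (rule sum_negf)
  also have "(\<Sum>p\<in>?S. of_int (sign (p \<circ> ?t)) * ?\<rho> (p \<circ> ?t) I J) = (\<Sum>p\<in>?S. of_int (sign p) * ?\<rho> p I J)"
  proof (rule sum.reindex_bij_witness[of _ "\<lambda>p. p \<circ> ?t" "\<lambda>p. p \<circ> ?t"])
    fix p assume "p \<in> ?S"
    then show "p \<circ> ?t \<in> ?S" "p \<circ> ?t \<in> ?S"
      using permutes_compose[OF t, of p] by simp_all
    show "(p \<circ> ?t) \<circ> ?t = p" "(p \<circ> ?t) \<circ> ?t = p"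
      by (rule swap_at_swap_at)+
  qed (rule refl)
  finally have sum: "?w * (\<Sum>p\<in>?S. of_int (sign p) * ?\<rho> p I (swap_at k J))
      = - (\<Sum>p\<in>?S. of_int (sign p) * ?\<rho> p I J)" .
  show "antisymmetrizer N I J + ?w * antisymmetrizer N I (swap_at k J) = 0"
    unfolding antisymmetrizer_def mult.left_commute[of ?w] sum mult_minus_right by (rule right_minus)
qed

lemma antisymmetrizer_row:
  assumes "I \<in> multi N N" "J \<in> multi N N"
  shows "antisymmetrizer N I J = antisymmetrizer N I (id_word N) * q_sign N J"
  using central_scalars.skew_determined[OF fps_central_scalars antisymmetrizer_skew[OF assms(1)] assms(2)]
  by (simp add: mult.commute)

section \<open>A ring type containing all algebras\<close>

text \<open>A ring record with a central structure map \<open>\<sigma>\<close> from \<open>\<complex>[[h]]\<close>.\<close>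

definition fps_algebra :: "'a ring \<Rightarrow> (complex fps \<Rightarrow> 'a) \<Rightarrow> bool" where
  "fps_algebra R \<sigma> \<longleftrightarrow> ring R \<and> \<sigma> \<in> ring_hom fps_ring R \<and>
     (\<forall>c. \<forall>x\<in>carrier R. \<sigma> c \<otimes>\<^bsub>R\<^esub> x = x \<otimes>\<^bsub>R\<^esub> \<sigma> c)"

lemma fps_algebra_ring: "fps_algebra R \<sigma> \<Longrightarrow> ring R"
  by (simp add: fps_algebra_def)

lemma fps_algebra_scalar:
  assumes "fps_algebra R \<sigma>"
  shows "\<sigma> c \<in> carrier R" "\<sigma> 1 = \<one>\<^bsub>R\<^esub>" "\<sigma> (c + d) = \<sigma> c \<oplus>\<^bsub>R\<^esub> \<sigma> d" "\<sigma> (c * d) = \<sigma> c \<otimes>\<^bsub>R\<^esub> \<sigma> d"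
    "x \<in> carrier R \<Longrightarrow> \<sigma> c \<otimes>\<^bsub>R\<^esub> x = x \<otimes>\<^bsub>R\<^esub> \<sigma> c"
proof -
  have hom: "\<sigma> \<in> ring_hom fps_ring R"
    using assms unfolding fps_algebra_def by blast
  show "\<sigma> c \<in> carrier R"
    by (rule ring_hom_closed[OF hom]) simp
  show "\<sigma> 1 = \<one>\<^bsub>R\<^esub>"
    using ring_hom_one[OF hom] unfolding fps_ring_simps .
  show "\<sigma> (c + d) = \<sigma> c \<oplus>\<^bsub>R\<^esub> \<sigma> d"
    using ring_hom_add[OF hom, of c d] unfolding fps_ring_simps by blast
  show "\<sigma> (c * d) = \<sigma> c \<otimes>\<^bsub>R\<^esub> \<sigma> d"
    using ring_hom_mult[OF hom, of c d] unfolding fps_ring_simps by blast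
  show "x \<in> carrier R \<Longrightarrow> \<sigma> c \<otimes>\<^bsub>R\<^esub> x = x \<otimes>\<^bsub>R\<^esub> \<sigma> c"
    using assms unfolding fps_algebra_def by blast
qed

type_synonym 'a algebra_family = "'a ring \<Rightarrow> (complex fps \<Rightarrow> 'a) \<Rightarrow> 'a"

text \<open>Elements of the product of all algebras with elements in \<open>'a\<close>, as functions of the ring and its structure map. The value outside
the index set is fixed, so that such a function is determined by its components.\<close>

definition families :: "'a algebra_family set" where
  "families = {f. \<forall>R \<sigma>. if fps_algebra R \<sigma> then f R \<sigma> \<in> carrier R else f R \<sigma> = undefined}"

definition over_algebras :: "'a algebra_family \<Rightarrow> 'a algebra_family" where
  "over_algebras F R \<sigma> = (if fps_algebra R \<sigma> then F R \<sigma> else undefined)"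

lemma over_algebras_family:
  "(\<And>R \<sigma>. fps_algebra R \<sigma> \<Longrightarrow> F R \<sigma> \<in> carrier R) \<Longrightarrow> over_algebras F \<in> families"
  by (simp add: families_def over_algebras_def)

text \<open>A type that contains every algebra on \<open>'a\<close>. The additional factor \<open>\<complex>[[h]]\<close> ensures that 0 and 1 are different, also when
all algebras on \<open>'a\<close> are trivial.\<close>

typedef 'a algebra_product = "UNIV \<times> families :: (complex fps \<times> 'a algebra_family) set"
proof -
  have "over_algebras (\<lambda>R \<sigma>. \<zero>\<^bsub>R\<^esub>) \<in> (families :: 'a algebra_family set)"
    by (rule over_algebras_family) (frule fps_algebra_ring, simp add: ring.ring_simprules(2,6))
  then show ?thesis by blast
qed

definition base :: "'a algebra_product \<Rightarrow> complex fps" where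
  "base x = fst (Rep_algebra_product x)"

definition component :: "'a algebra_product \<Rightarrow> 'a algebra_family" where
  "component x = snd (Rep_algebra_product x)"

definition product_of :: "complex fps \<Rightarrow> 'a algebra_family \<Rightarrow> 'a algebra_product" where
  "product_of c F = Abs_algebra_product (c, over_algebras F)"

lemma component_family: "component x \<in> families"
  using Rep_algebra_product[of x] unfolding component_def by (simp add: mem_Times_iff)

lemma component_closed: "fps_algebra R \<sigma> \<Longrightarrow> component x R \<sigma> \<in> carrier R"
  using component_family[of x] unfolding families_def
  by (drule_tac CollectD, drule_tac spec[of _ R], drule_tac spec[of _ \<sigma>]) simp

lemma algebra_product_eqI:
  assumes "base x = base y" and "\<And>R \<sigma>. fps_algebra R \<sigma> \<Longrightarrow> component x R \<sigma> = component y R \<sigma>"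
  shows "x = y"
proof -
  have "component x R \<sigma> = component y R \<sigma>" for R \<sigma>
  proof (cases "fps_algebra R \<sigma>")
    case False
    have "component z R \<sigma> = undefined" for z :: "'a algebra_product"
      using component_family[of z] unfolding families_def
      by (drule_tac CollectD, drule_tac spec[of _ R], drule_tac spec[of _ \<sigma>]) (simp add: False)
    then show ?thesis by simp
  qed (rule assms(2))
  then have "Rep_algebra_product x = Rep_algebra_product y"
    using assms(1) by (intro prod_eqI) (auto simp: base_def component_def)
  then show ?thesis by (simp add: Rep_algebra_product_inject)
qed

lemma product_of_simps:
  assumes "\<And>R \<sigma>. fps_algebra R \<sigma> \<Longrightarrow> F R \<sigma> \<in> carrier R"
  shows "base (product_of c F) = c" "fps_algebra R \<sigma> \<Longrightarrow> component (product_of c F) R \<sigma> = F R \<sigma>"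
proof -
  have "Rep_algebra_product (product_of c F) = (c, over_algebras F)"
    unfolding product_of_def
    by (rule Abs_algebra_product_inverse) (simp add: over_algebras_family[OF assms])
  then show "base (product_of c F) = c" "fps_algebra R \<sigma> \<Longrightarrow> component (product_of c F) R \<sigma> = F R \<sigma>"
    by (simp_all add: base_def component_def over_algebras_def)
qed

instantiation algebra_product :: (type) ring_1
begin

definition "0 = product_of 0 (\<lambda>R \<sigma>. \<zero>\<^bsub>R\<^esub>)"
definition "1 = product_of 1 (\<lambda>R \<sigma>. \<one>\<^bsub>R\<^esub>)"
definition "- x = product_of (- base x) (\<lambda>R \<sigma>. \<ominus>\<^bsub>R\<^esub> component x R \<sigma>)"
definition "x + y = product_of (base x + base y) (\<lambda>R \<sigma>. component x R \<sigma> \<oplus>\<^bsub>R\<^esub> component y R \<sigma>)"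
definition "x - y = product_of (base x - base y) (\<lambda>R \<sigma>. component x R \<sigma> \<ominus>\<^bsub>R\<^esub> component y R \<sigma>)"
definition "x * y = product_of (base x * base y) (\<lambda>R \<sigma>. component x R \<sigma> \<otimes>\<^bsub>R\<^esub> component y R \<sigma>)"

lemma base_simps:
  "base (0 :: 'a algebra_product) = 0" "base (1 :: 'a algebra_product) = 1" "base (- x) = - base x"
  "base (x + y) = base x + base y" "base (x - y) = base x - base y" "base (x * y) = base x * base y"
  for x y :: "'a algebra_product"
  unfolding zero_algebra_product_def one_algebra_product_def uminus_algebra_product_def
    plus_algebra_product_def minus_algebra_product_def times_algebra_product_def
  by (rule product_of_simps(1), frule fps_algebra_ring, simp add: ring.ring_simprules(1-6) component_closed)+

lemma component_simps:
  assumes "fps_algebra R \<sigma>"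
  shows "component 0 R \<sigma> = \<zero>\<^bsub>R\<^esub>" "component 1 R \<sigma> = \<one>\<^bsub>R\<^esub>" "component (- x) R \<sigma> = \<ominus>\<^bsub>R\<^esub> component x R \<sigma>"
    "component (x + y) R \<sigma> = component x R \<sigma> \<oplus>\<^bsub>R\<^esub> component y R \<sigma>"
    "component (x - y) R \<sigma> = component x R \<sigma> \<ominus>\<^bsub>R\<^esub> component y R \<sigma>"
    "component (x * y) R \<sigma> = component x R \<sigma> \<otimes>\<^bsub>R\<^esub> component y R \<sigma>"
  unfolding zero_algebra_product_def one_algebra_product_def uminus_algebra_product_def
    plus_algebra_product_def minus_algebra_product_def times_algebra_product_def
  by (rule product_of_simps(2)[OF _ assms], frule fps_algebra_ring,
      simp add: ring.ring_simprules(1-6) component_closed)+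

instance
proof
  fix a b c :: "'a algebra_product"
  have eqI: "x = y" if "base x = base y"
    "\<And>R \<sigma>. fps_algebra R \<sigma> \<Longrightarrow> ring R \<Longrightarrow> component x R \<sigma> = component y R \<sigma>"
    for x y :: "'a algebra_product"
    using that by (intro algebra_product_eqI) (auto intro: fps_algebra_ring)
  show "a + b + c = a + (b + c)"
    by (rule eqI, simp only: base_simps add.assoc, simp only: component_simps,
        rule ring.ring_simprules(7), (assumption | rule component_closed)+)
  show "a + b = b + a"
    by (rule eqI, simp only: base_simps add.commute, simp only: component_simps,
        rule ring.ring_simprules(10), (assumption | rule component_closed)+)
  show "0 + a = a"
    by (rule eqI, simp only: base_simps add_0_left, simp only: component_simps,
        rule ring.ring_simprules(8), (assumption | rule component_closed)+)
  show "- a + a = 0"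
    by (rule eqI, simp only: base_simps left_minus, simp only: component_simps,
        rule ring.ring_simprules(9), (assumption | rule component_closed)+)
  show "a - b = a + - b"
    by (rule eqI, simp only: base_simps diff_conv_add_uminus, simp only: component_simps,
        rule a_minus_def)
  show "a * b * c = a * (b * c)"
    by (rule eqI, simp only: base_simps mult.assoc, simp only: component_simps,
        rule ring.ring_simprules(11), (assumption | rule component_closed)+)
  show "(a + b) * c = a * c + b * c"
    by (rule eqI, simp only: base_simps distrib_right, simp only: component_simps,
        rule ring.ring_simprules(13), (assumption | rule component_closed)+)
  show "a * (b + c) = a * b + a * c"
    by (rule eqI, simp only: base_simps distrib_left, simp only: component_simps,
        rule ring.ring_simprules(23), (assumption | rule component_closed)+)
  show "1 * a = a"
    by (rule eqI, simp only: base_simps mult_1_left, simp only: component_simps,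
        rule ring.ring_simprules(12), (assumption | rule component_closed)+)
  show "a * 1 = a"
    by (rule eqI, simp only: base_simps mult_1_right, simp only: component_simps,
        rule monoid.r_one[OF ring.is_monoid], (assumption | rule component_closed)+)
  show "(0 :: 'a algebra_product) \<noteq> 1"
    using base_simps(1,2) by (metis zero_neq_one)
qed

end

definition scalar :: "complex fps \<Rightarrow> 'a algebra_product" where
  "scalar c = product_of c (\<lambda>R \<sigma>. \<sigma> c)"

lemma base_scalar: "base (scalar c) = c"
  unfolding scalar_def by (rule product_of_simps(1)) (rule fps_algebra_scalar(1))

lemma component_scalar: "fps_algebra R \<sigma> \<Longrightarrow> component (scalar c) R \<sigma> = \<sigma> c"
  unfolding scalar_def by (rule product_of_simps(2)) (rule fps_algebra_scalar(1))

interpretation algebra_product: central_scalars "scalar :: complex fps \<Rightarrow> 'a algebra_product"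
proof
  show "scalar 1 = (1 :: 'a algebra_product)"
    by (rule algebra_product_eqI, simp only: base_simps base_scalar,
        simp only: component_simps component_scalar, rule fps_algebra_scalar(2))
  show "scalar (c + d) = (scalar c + scalar d :: 'a algebra_product)" for c d
    by (rule algebra_product_eqI, simp only: base_simps base_scalar,
        simp only: component_simps component_scalar, rule fps_algebra_scalar(3))
  show "scalar (c * d) = (scalar c * scalar d :: 'a algebra_product)" for c d
    by (rule algebra_product_eqI, simp only: base_simps base_scalar,
        simp only: component_simps component_scalar, rule fps_algebra_scalar(4))
  show "scalar c * x = x * scalar c" for c and x :: "'a algebra_product"
  proof (rule algebra_product_eqI)
    fix R :: "'a ring" and \<sigma> assume alg: "fps_algebra R \<sigma>"
    show "component (scalar c * x) R \<sigma> = component (x * scalar c) R \<sigma>"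
      unfolding component_simps[OF alg] component_scalar[OF alg]
      by (rule fps_algebra_scalar(5)[OF alg component_closed[OF alg]])
  qed (simp add: base_simps mult.commute)
qed

text \<open>The inclusion of one factor into the product: all other components are 0. It is compatible with sums, products and scalars, but
does not send 1 to 1.\<close>

definition embed :: "'a ring \<Rightarrow> (complex fps \<Rightarrow> 'a) \<Rightarrow> 'a \<Rightarrow> 'a algebra_product" where
  "embed R0 \<sigma>0 x = product_of 0 (\<lambda>R \<sigma>. if R = R0 \<and> \<sigma> = \<sigma>0 \<and> x \<in> carrier R then x else \<zero>\<^bsub>R\<^esub>)"

lemma embed_value_closed:
  assumes "fps_algebra R \<sigma>"
  shows "(if R = R0 \<and> \<sigma> = \<sigma>0 \<and> x \<in> carrier R then x else \<zero>\<^bsub>R\<^esub>) \<in> carrier R"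
  using ring.ring_simprules(2)[OF fps_algebra_ring[OF assms]] by (split if_split) blast

lemma base_embed: "base (embed R0 \<sigma>0 x) = 0"
  unfolding embed_def by (rule product_of_simps(1)) (rule embed_value_closed)

lemma component_embed:
  assumes "fps_algebra R \<sigma>"
  shows "component (embed R0 \<sigma>0 x) R \<sigma> =
    (if R = R0 \<and> \<sigma> = \<sigma>0 \<and> x \<in> carrier R then x else \<zero>\<^bsub>R\<^esub>)"
  unfolding embed_def by (rule product_of_simps(2)[OF embed_value_closed assms])

locale embedded_algebra =
  fixes R :: "'a ring" and \<sigma> :: "complex fps \<Rightarrow> 'a"
  assumes algebra: "fps_algebra R \<sigma>"
begin

sublocale ring R
  using algebra by (simp add: fps_algebra_def)

abbreviation \<iota> :: "'a \<Rightarrow> 'a algebra_product" where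
  "\<iota> \<equiv> embed R \<sigma>"

lemma \<sigma>_closed [simp]: "\<sigma> c \<in> carrier R"
  by (rule fps_algebra_scalar(1)[OF algebra])

lemma embed_add:
  assumes "x \<in> carrier R" "y \<in> carrier R"
  shows "\<iota> (x \<oplus>\<^bsub>R\<^esub> y) = \<iota> x + \<iota> y"
proof (rule algebra_product_eqI)
  fix S :: "'a ring" and \<tau> assume alg: "fps_algebra S \<tau>"
  show "component (\<iota> (x \<oplus>\<^bsub>R\<^esub> y)) S \<tau> = component (\<iota> x + \<iota> y) S \<tau>"
    unfolding component_simps[OF alg] component_embed[OF alg] component_scalar[OF alg]
    using assms ring.ring_simprules(1,2,8)[OF fps_algebra_ring[OF alg]]
    by (cases "S = R \<and> \<tau> = \<sigma>") simp_all
qed (simp only: base_simps base_embed base_scalar add_0_left mult_zero_left mult_zero_right)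

lemma embed_mult:
  assumes "x \<in> carrier R" "y \<in> carrier R"
  shows "\<iota> (x \<otimes>\<^bsub>R\<^esub> y) = \<iota> x * \<iota> y"
proof (rule algebra_product_eqI)
  fix S :: "'a ring" and \<tau> assume alg: "fps_algebra S \<tau>"
  show "component (\<iota> (x \<otimes>\<^bsub>R\<^esub> y)) S \<tau> = component (\<iota> x * \<iota> y) S \<tau>"
    unfolding component_simps[OF alg] component_embed[OF alg] component_scalar[OF alg]
    using assms ring.ring_simprules(2,5,24)[OF fps_algebra_ring[OF alg]]
    by (cases "S = R \<and> \<tau> = \<sigma>") simp_all
qed (simp only: base_simps base_embed base_scalar add_0_left mult_zero_left mult_zero_right)

lemma embed_zero:
  shows "\<iota> \<zero>\<^bsub>R\<^esub> = 0"
proof (rule algebra_product_eqI)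
  fix S :: "'a ring" and \<tau> assume alg: "fps_algebra S \<tau>"
  show "component (\<iota> \<zero>\<^bsub>R\<^esub>) S \<tau> = component (0) S \<tau>"
    unfolding component_simps[OF alg] component_embed[OF alg] component_scalar[OF alg]
    using ring.ring_simprules(2)[OF fps_algebra_ring[OF alg]]
    by (cases "S = R \<and> \<tau> = \<sigma>") simp_all
qed (simp only: base_simps base_embed base_scalar add_0_left mult_zero_left mult_zero_right)

lemma embed_scalar:
  assumes "x \<in> carrier R"
  shows "\<iota> (\<sigma> c \<otimes>\<^bsub>R\<^esub> x) = scalar c * \<iota> x"
proof (rule algebra_product_eqI)
  fix S :: "'a ring" and \<tau> assume alg: "fps_algebra S \<tau>"
  show "component (\<iota> (\<sigma> c \<otimes>\<^bsub>R\<^esub> x)) S \<tau> = component (scalar c * \<iota> x) S \<tau>"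
    unfolding component_simps[OF alg] component_embed[OF alg] component_scalar[OF alg]
    using assms ring.ring_simprules(2,5,25)[OF fps_algebra_ring[OF alg]] fps_algebra_scalar(1)[OF alg, of c]
    by (cases "S = R \<and> \<tau> = \<sigma>") simp_all
qed (simp only: base_simps base_embed base_scalar add_0_left mult_zero_left mult_zero_right)

lemma embed_inject:
  assumes "x \<in> carrier R" "y \<in> carrier R" "\<iota> x = \<iota> y"
  shows "x = y"
  using arg_cong[OF assms(3), of "\<lambda>z. component z R \<sigma>"] assms(1,2)
  by (simp add: component_embed[OF algebra])

lemma embed_finsum:
  assumes "finite A" "\<And>a. a \<in> A \<Longrightarrow> f a \<in> carrier R"
  shows "\<iota> (finsum R f A) = (\<Sum>a\<in>A. \<iota> (f a))"
  using assms by (induction A) (simp_all add: embed_zero embed_add finsum_insert Pi_def)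

end

section \<open>The free algebra and the defining relations\<close>

lemma ring_hom_finsum:
  assumes "ring R" "ring S" and h: "h \<in> ring_hom R S" and "finite A"
    and "\<And>a. a \<in> A \<Longrightarrow> f a \<in> carrier R"
  shows "h (finsum R f A) = finsum S (\<lambda>a. h (f a)) A"
proof -
  interpret R: ring R by fact
  interpret S: ring S by fact
  show ?thesis
    using assms(4,5)
  proof (induction A)
    case empty
    then show ?case using ring_hom_zero[OF h assms(1,2)] by simp
  next
    case (insert a A)
    then have "h (finsum R f (insert a A)) = h (f a \<oplus>\<^bsub>R\<^esub> finsum R f A)"
      by (subst R.finsum_insert) auto
    also have "\<dots> = h (f a) \<oplus>\<^bsub>S\<^esub> finsum S (\<lambda>a. h (f a)) A"
      using insert by (subst ring_hom_add[OF h]) auto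
    also have "\<dots> = finsum S (\<lambda>a. h (f a)) (insert a A)"
      using insert ring_hom_closed[OF h] by (subst S.finsum_insert) auto
    finally show ?case .
  qed
qed

lemma free_finsum:
  assumes "finite A" "\<And>a. a \<in> A \<Longrightarrow> f a \<in> carrier (free_alg N)"
  shows "finsum (free_alg N) f A = sum f A"
proof -
  interpret ring "free_alg N" by (rule free_alg_ring)
  show ?thesis
    using assms by (induction A) (simp_all add: finsum_insert Pi_def)
qed

lemma letters_zero [simp]: "letters 0 = []"
  unfolding zero_fmonoid_def by (rule fmonoid.sel)

lemma single_closed:
  assumes "set (letters w) \<subseteq> {1..N} \<times> {1..N} \<times> UNIV"
  shows "Poly_Mapping.single w c \<in> carrier (free_alg N)"
  unfolding free_alg_carrier_iff
proof
  fix v assume "v \<in> Poly_Mapping.keys (Poly_Mapping.single w c)"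
  then have "v = w" by (simp split: if_splits)
  then show "set (letters v) \<subseteq> {1..N} \<times> {1..N} \<times> UNIV" using assms by (simp only:)
qed

lemma fscal_closed: "fscal c \<in> carrier (free_alg N)"
  unfolding fscal_def by (rule single_closed) (simp only: letters_zero list.set empty_subsetI)

lemma ftau_closed: "i \<in> {1..N} \<Longrightarrow> j \<in> {1..N} \<Longrightarrow> ftau i j r \<in> carrier (free_alg N)"
  unfolding ftau_def by (rule single_closed) simp

lemma zero_free_closed: "0 \<in> carrier (free_alg N)"
  unfolding free_alg_carrier_iff by simp

lemma fscal_hom: "fscal \<in> ring_hom fps_ring (free_alg N)"
proof (rule ring_hom_memI)
  show "fscal (c \<otimes>\<^bsub>fps_ring\<^esub> d) = fscal c \<otimes>\<^bsub>free_alg N\<^esub> fscal d" for c d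
    by (simp add: fscal_def mult_single)
  show "fscal (c \<oplus>\<^bsub>fps_ring\<^esub> d) = fscal c \<oplus>\<^bsub>free_alg N\<^esub> fscal d" for c d
    by (simp add: fscal_def single_add)
  show "fscal \<one>\<^bsub>fps_ring\<^esub> = \<one>\<^bsub>free_alg N\<^esub>"
    by (simp add: fscal_def)
qed (rule fscal_closed)

lemma poly_mapping_sum_singles:
  fixes f :: "'k \<Rightarrow>\<^sub>0 'v::comm_monoid_add"
  shows "(\<Sum>w\<in>Poly_Mapping.keys f. Poly_Mapping.single w (Poly_Mapping.lookup f w)) = f"
proof (rule poly_mapping_eqI)
  fix v
  have "Poly_Mapping.lookup (\<Sum>w\<in>Poly_Mapping.keys f. Poly_Mapping.single w (Poly_Mapping.lookup f w)) v
      = (\<Sum>w\<in>Poly_Mapping.keys f. if w = v then Poly_Mapping.lookup f v else 0)"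
    unfolding lookup_sum by (rule sum.cong) (simp_all add: lookup_single when_def)
  also have "\<dots> = Poly_Mapping.lookup f v"
    by (simp add: in_keys_iff)
  finally show "Poly_Mapping.lookup (\<Sum>w\<in>Poly_Mapping.keys f. Poly_Mapping.single w (Poly_Mapping.lookup f w)) v = Poly_Mapping.lookup f v" .
qed

lemma fscal_central: "fscal c * f = f * fscal c"
proof -
  have "fscal c * (\<Sum>w\<in>Poly_Mapping.keys f. Poly_Mapping.single w (Poly_Mapping.lookup f w))
      = (\<Sum>w\<in>Poly_Mapping.keys f. Poly_Mapping.single w (Poly_Mapping.lookup f w)) * fscal c"
    unfolding sum_distrib_left sum_distrib_right fscal_def mult_single by (simp add: mult.commute)
  then show ?thesis by (simp add: poly_mapping_sum_singles)
qed

text \<open>Every element is a finite sum of scalar multiples of words in the generators.\<close>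

lemma free_alg_induct:
  assumes f: "f \<in> carrier (free_alg N)"
    and add: "\<And>f g. f \<in> carrier (free_alg N) \<Longrightarrow> g \<in> carrier (free_alg N) \<Longrightarrow> P f \<Longrightarrow> P g \<Longrightarrow> P (f + g)"
    and mult: "\<And>f g. f \<in> carrier (free_alg N) \<Longrightarrow> g \<in> carrier (free_alg N) \<Longrightarrow> P f \<Longrightarrow> P g \<Longrightarrow> P (f * g)"
    and scal: "\<And>c. P (fscal c)"
    and tau: "\<And>i j r. i \<in> {1..N} \<Longrightarrow> j \<in> {1..N} \<Longrightarrow> P (ftau i j r)"
  shows "P f"
proof -
  interpret ring "free_alg N" by (rule free_alg_ring)
  have word: "P (Poly_Mapping.single (Word u) c) \<and> Poly_Mapping.single (Word u) c \<in> carrier (free_alg N)"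
    if "set u \<subseteq> {1..N} \<times> {1..N} \<times> UNIV" for u c
    using that
  proof (induction u)
    case Nil
    then show ?case
      using scal[of c] fscal_closed[of c] by (simp add: fscal_def zero_fmonoid_def)
  next
    case (Cons x u)
    obtain i j r where x: "x = (i, j, r)" by (cases x) auto
    have ij: "i \<in> {1..N}" "j \<in> {1..N}" using Cons.prems x by auto
    have "Poly_Mapping.single (Word (x # u)) c = ftau i j r * Poly_Mapping.single (Word u) c"
      by (simp add: ftau_def mult_single plus_fmonoid_def x)
    moreover have "P (Poly_Mapping.single (Word u) c)" "Poly_Mapping.single (Word u) c \<in> carrier (free_alg N)"
      using Cons by simp_all
    ultimately show ?case
      using mult[OF ftau_closed[OF ij] _ tau[OF ij]] m_closed[OF ftau_closed[OF ij]] by simp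
  qed
  have "P (\<Sum>w\<in>W. Poly_Mapping.single w (Poly_Mapping.lookup f w)) \<and>
      (\<Sum>w\<in>W. Poly_Mapping.single w (Poly_Mapping.lookup f w)) \<in> carrier (free_alg N)"
    if "finite W" "W \<subseteq> Poly_Mapping.keys f" for W
    using that
  proof (induction W)
    case empty
    then show ?case using scal[of 0] zero_free_closed by (simp add: fscal_def)
  next
    case (insert w W)
    have "set (letters w) \<subseteq> {1..N} \<times> {1..N} \<times> UNIV"
      using f insert.prems by (auto simp: free_alg_carrier_iff)
    from word[OF this] have "P (Poly_Mapping.single w (Poly_Mapping.lookup f w))"
      "Poly_Mapping.single w (Poly_Mapping.lookup f w) \<in> carrier (free_alg N)"
      by simp_all
    then show ?case
      using insert add a_closed by simp
  qed
  from this[of "Poly_Mapping.keys f"] show ?thesis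
    by (simp add: poly_mapping_sum_singles)
qed

lemma unit2_sum:
  assumes "a \<in> {1..N}" "\<And>i. finite (S i)"
  shows "(\<Sum>i\<in>{1..N}. \<Sum>j\<in>S i. unit2 i j j i a b c d :: complex fps poly) = of_bool (a = d \<and> b = c \<and> b \<in> S a)"
    "(\<Sum>i\<in>{1..N}. \<Sum>j\<in>S i. unit2 i i j j a b c d :: complex fps poly) = of_bool (a = b \<and> c = d \<and> c \<in> S a)"
    "(\<Sum>i\<in>{1..N}. unit2 i i i i a b c d :: complex fps poly) = of_bool (a = b \<and> c = d \<and> a = c)"
proof -
  have collapse: "(\<Sum>i\<in>{1..N}. if i = a then h i else 0) = (h a :: complex fps poly)" for h
    using assms(1) by simp
  have inner: "(\<Sum>j\<in>S a. if j = x then of_bool Q else 0) = (of_bool (Q \<and> x \<in> S a) :: complex fps poly)" for x Q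
    using assms(2)[of a] by simp
  have "(\<Sum>i\<in>{1..N}. \<Sum>j\<in>S i. unit2 i j j i a b c d :: complex fps poly)
      = (\<Sum>i\<in>{1..N}. if i = a then (\<Sum>j\<in>S a. if j = b then of_bool (a = d \<and> b = c) else 0) else 0)"
    by (intro sum.cong refl) (auto simp: unit2_def intro!: sum.neutral sum.cong)
  then show "(\<Sum>i\<in>{1..N}. \<Sum>j\<in>S i. unit2 i j j i a b c d :: complex fps poly) = of_bool (a = d \<and> b = c \<and> b \<in> S a)"
    unfolding collapse inner by simp
  have "(\<Sum>i\<in>{1..N}. \<Sum>j\<in>S i. unit2 i i j j a b c d :: complex fps poly)
      = (\<Sum>i\<in>{1..N}. if i = a then (\<Sum>j\<in>S a. if j = c then of_bool (a = b \<and> c = d) else 0) else 0)"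
    by (intro sum.cong refl) (auto simp: unit2_def intro!: sum.neutral sum.cong)
  then show "(\<Sum>i\<in>{1..N}. \<Sum>j\<in>S i. unit2 i i j j a b c d :: complex fps poly) = of_bool (a = b \<and> c = d \<and> c \<in> S a)"
    unfolding collapse inner by simp
  have "(\<Sum>i\<in>{1..N}. unit2 i i i i a b c d :: complex fps poly)
      = (\<Sum>i\<in>{1..N}. if i = a then of_bool (a = b \<and> c = d \<and> a = c) else 0)"
    by (intro sum.cong refl) (auto simp: unit2_def)
  then show "(\<Sum>i\<in>{1..N}. unit2 i i i i a b c d :: complex fps poly) = of_bool (a = b \<and> c = d \<and> a = c)"
    unfolding collapse by simp
qed

text \<open>The arguments of \<^const>\<open>Rhat\<close> are the indices of two matrix units \<open>e\<^sub>a\<^sub>c \<otimes> e\<^sub>b\<^sub>d\<close>, those of \<^const>\<open>r_hi\<close> are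
a row word and a column word.\<close>

lemma Rhat_coeffs:
  assumes "a \<in> {1..N}" "b \<in> {1..N}" "c \<in> {1..N}" "d \<in> {1..N}"
  shows "coeff (Rhat N a c b d) 0 = fps_exp (-1/2) * r_lo a b c d"
    and "coeff (Rhat N a c b d) 1 = fps_exp (-1/2) * r_hi a b c d"
proof -
  have expand: "Rmat N [:0, 1:] 1 a c b d =
      ([:0, 1:] * [:fps_exp (-1/2):] - 1 * [:fps_exp (1/2):]) * of_bool (a = c \<and> b = d \<and> a = b)
      + ([:0, 1:] - 1) * of_bool (a = c \<and> b = d \<and> b \<in> {1..N} - {a})
      + [:fps_exp (-1/2) - fps_exp (1/2):] * [:0, 1:] * of_bool (a = d \<and> c = b \<and> c \<in> {1..<a})
      + [:fps_exp (-1/2) - fps_exp (1/2):] * 1 * of_bool (a = d \<and> c = b \<and> c \<in> {a<..N})"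
    unfolding Rmat_def
    by (simp only: unit2_sum(3)[OF assms(1), of "\<lambda>_. {}"] unit2_sum(2)[OF assms(1), of "\<lambda>i. {1..N} - {i}"]
      unit2_sum(1)[OF assms(1), of "\<lambda>i. {1..<i}"] unit2_sum(1)[OF assms(1), of "\<lambda>i. {i<..N}"]
      finite_atLeastAtMost finite_Diff finite_atLeastLessThan finite_greaterThanAtMost finite.emptyI)
  consider "a = c" "b = d" "a = b" | "a = c" "b = d" "a \<noteq> b" | "a = d" "b = c" "a < b"
    | "a = d" "b = c" "b < a" | "\<not> (a = c \<and> b = d)" "\<not> (a = d \<and> b = c)"
    by linarith
  then have "Rmat N [:0, 1:] 1 a c b d = [:r_lo a b c d, r_hi a b c d:]"
    unfolding expand using assms
    by cases (auto simp: r_lo_def r_hi_def one_pCons)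
  then have "Rhat N a c b d = [:fps_exp (-1/2):] * [:r_lo a b c d, r_hi a b c d:]"
    unfolding Rhat_def by (rule arg_cong)
  then show "coeff (Rhat N a c b d) 0 = fps_exp (-1/2) * r_lo a b c d"
    "coeff (Rhat N a c b d) 1 = fps_exp (-1/2) * r_hi a b c d"
    by simp_all
qed

definition pair_word :: "nat \<Rightarrow> nat \<Rightarrow> nat \<Rightarrow> nat" where
  "pair_word e f = (\<lambda>_. undefined)(1 := e, 2 := f)"

lemma pair_word_simps [simp]: "pair_word e f 1 = e" "pair_word e f (Suc 0) = e" "pair_word e f 2 = f"
  by (simp_all add: pair_word_def)

lemma pair_word_multi: "e \<in> {1..N} \<Longrightarrow> f \<in> {1..N} \<Longrightarrow> pair_word e f \<in> multi N 2"
  by (auto simp: pair_word_def multi_def PiE_iff extensional_def)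

lemma sum_multi_2: "(\<Sum>K\<in>multi N 2. g K) = (\<Sum>e\<in>{1..N}. \<Sum>f\<in>{1..N}. g (pair_word e f))"
proof -
  have "multi N 0 = {\<lambda>_. undefined}" by (simp add: multi_def)
  then show ?thesis
    unfolding numeral_2_eq_2 sum_multi_Suc by (simp add: pair_word_def numeral_2_eq_2 fun_upd_def)
qed

lemma indices_2: "{1..2::nat} - {1} = {2}" "{1..2::nat} - {2} = {1}" "{1..2::nat} - {1, 1 + 1} = {}"
  by auto

lemma tmul_free:
  assumes "\<And>K. K \<in> multi N m \<Longrightarrow> A I K \<in> carrier (free_alg N)"
    and "\<And>K. K \<in> multi N m \<Longrightarrow> B K J \<in> carrier (free_alg N)"
  shows "tmul (free_alg N) N m A B I J = (\<Sum>K\<in>multi N m. A I K * B K J)"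
    "tmul (free_alg N) N m A B I J \<in> carrier (free_alg N)"
proof -
  interpret ring "free_alg N" by (rule free_alg_ring)
  have "A I K * B K J \<in> carrier (free_alg N)" if "K \<in> multi N m" for K
    using m_closed[OF assms(1)[OF that] assms(2)[OF that]] by simp
  then show "tmul (free_alg N) N m A B I J = (\<Sum>K\<in>multi N m. A I K * B K J)"
    "tmul (free_alg N) N m A B I J \<in> carrier (free_alg N)"
    using finsum_closed[of "\<lambda>K. A I K * B K J" "multi N m"]
    unfolding tmul_def by (simp_all add: free_finsum Pi_def)
qed

lemma ftau_at_closed:
  assumes "K \<in> multi N 2" "L \<in> multi N 2" "k \<in> {1, 2}"
  shows "ftau_at N k r K L \<in> carrier (free_alg N)"
  using multi_range[OF assms(1), of k] multi_range[OF assms(2), of k] assms(3)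
  unfolding ftau_at_def at_factor_def by (auto intro: ftau_closed zero_free_closed)

lemma Rhat_coeff_entry:
  "Rhat_coeff N s I J = fscal (coeff (Rhat N (I 1) (J 1) (I 2) (J 2)) s)"
  unfolding Rhat_coeff_def at_pair_def indices_2 by (simp add: numeral_2_eq_2)

lemma Rhat_coeff_closed: "Rhat_coeff N s I J \<in> carrier (free_alg N)"
  unfolding Rhat_coeff_entry by (rule fscal_closed)

lemma ftau_at_entry:
  "ftau_at N 1 r (pair_word a b) (pair_word c d) = (if b = d then ftau a c (- r) else 0)"
  "ftau_at N 2 r (pair_word a b) (pair_word c d) = (if a = c then ftau b d (- r) else 0)"
  unfolding ftau_at_def at_factor_def indices_2 by simp_all

lemma multi_2_eq: "I \<in> multi N 2 \<Longrightarrow> I = pair_word (I 1) (I 2)"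
  by (rule ext) (auto simp: multi_def pair_word_def PiE_iff extensional_def)

lemma ftau_at_product:
  assumes "a \<in> {1..N}" "b \<in> {1..N}" "c \<in> {1..N}" "d \<in> {1..N}"
  shows "tmul (free_alg N) N 2 (ftau_at N 1 q) (ftau_at N 2 r) (pair_word a b) (pair_word c d)
      = ftau a c (- q) * ftau b d (- r)"
    "tmul (free_alg N) N 2 (ftau_at N 2 r) (ftau_at N 1 q) (pair_word a b) (pair_word c d)
      = ftau b d (- r) * ftau a c (- q)"
proof -
  have 1: "(\<Sum>e\<in>{1..N}. \<Sum>f\<in>{1..N}. if e = x \<and> f = y then g else 0) = (g :: free)"
    if "x \<in> {1..N}" "y \<in> {1..N}" for x y g
  proof -
    have "(\<Sum>f\<in>{1..N}. if e = x \<and> f = y then g else 0) = (if e = x then g else 0)" for e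
      using that(2) by (cases "e = x") simp_all
    then show ?thesis using that(1) by simp
  qed
  have "(\<Sum>e\<in>{1..N}. \<Sum>f\<in>{1..N}. (if b = f then ftau a e (- q) else 0) * (if e = c then ftau f d (- r) else 0))
      = (\<Sum>e\<in>{1..N}. \<Sum>f\<in>{1..N}. if e = c \<and> f = b then ftau a c (- q) * ftau b d (- r) else 0)"
    by (intro sum.cong refl) auto
  then show "tmul (free_alg N) N 2 (ftau_at N 1 q) (ftau_at N 2 r) (pair_word a b) (pair_word c d)
      = ftau a c (- q) * ftau b d (- r)"
    using assms by (subst tmul_free(1))
      (simp_all add: ftau_at_closed pair_word_multi sum_multi_2 ftau_at_entry[unfolded One_nat_def] 1[unfolded One_nat_def])
  have "(\<Sum>e\<in>{1..N}. \<Sum>f\<in>{1..N}. (if a = e then ftau b f (- r) else 0) * (if f = d then ftau e c (- q) else 0))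
      = (\<Sum>e\<in>{1..N}. \<Sum>f\<in>{1..N}. if e = a \<and> f = d then ftau b d (- r) * ftau a c (- q) else 0)"
    by (intro sum.cong refl) auto
  then show "tmul (free_alg N) N 2 (ftau_at N 2 r) (ftau_at N 1 q) (pair_word a b) (pair_word c d)
      = ftau b d (- r) * ftau a c (- q)"
    using assms by (subst tmul_free(1))
      (simp_all add: ftau_at_closed pair_word_multi sum_multi_2 ftau_at_entry[unfolded One_nat_def] 1[unfolded One_nat_def])
qed

text \<open>The two sides of the defining relation without operators on tensor factors.\<close>

lemma rtt_expand:
  assumes "a \<in> {1..N}" "b \<in> {1..N}" "c \<in> {1..N}" "d \<in> {1..N}"
  shows "rtt_lhs N m n (pair_word a b) (pair_word c d) = (\<Sum>s\<in>{0, 1}. \<Sum>e\<in>{1..N}. \<Sum>f\<in>{1..N}.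
      fscal (coeff (Rhat N a e b f) s) * (ftau e c (- (m - int s)) * ftau f d (- (n + int s))))" (is ?l)
    and "rtt_rhs N m n (pair_word a b) (pair_word c d) = (\<Sum>s\<in>{0, 1}. \<Sum>e\<in>{1..N}. \<Sum>f\<in>{1..N}.
      (ftau b f (- (n + int s)) * ftau a e (- (m - int s))) * fscal (coeff (Rhat N e c f d) s))" (is ?r)
    and "rtt_lhs N m n (pair_word a b) (pair_word c d) \<in> carrier (free_alg N)" (is ?lc)
    and "rtt_rhs N m n (pair_word a b) (pair_word c d) \<in> carrier (free_alg N)" (is ?rc)
proof -
  interpret ring "free_alg N" by (rule free_alg_ring)
  let ?T12 = "\<lambda>s. tmul (free_alg N) N 2 (ftau_at N 1 (m - int s)) (ftau_at N 2 (n + int s))"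
  let ?T21 = "\<lambda>s. tmul (free_alg N) N 2 (ftau_at N 2 (n + int s)) (ftau_at N 1 (m - int s))"
  have w: "pair_word a b \<in> multi N 2" "pair_word c d \<in> multi N 2"
    using assms by (simp_all add: pair_word_multi)
  have T12: "?T12 s K L \<in> carrier (free_alg N)" and T21: "?T21 s K L \<in> carrier (free_alg N)"
    if "K \<in> multi N 2" "L \<in> multi N 2" for s K L
    using that by (intro tmul_free(2) ftau_at_closed; simp)+
  have lhs: "tmul (free_alg N) N 2 (Rhat_coeff N s) (?T12 s) (pair_word a b) (pair_word c d) =
      (\<Sum>K\<in>multi N 2. Rhat_coeff N s (pair_word a b) K * ?T12 s K (pair_word c d))"
    "tmul (free_alg N) N 2 (Rhat_coeff N s) (?T12 s) (pair_word a b) (pair_word c d) \<in> carrier (free_alg N)" for s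
    by (rule tmul_free, rule Rhat_coeff_closed, rule T12[OF _ w(2)], assumption)+
  have rhs: "tmul (free_alg N) N 2 (?T21 s) (Rhat_coeff N s) (pair_word a b) (pair_word c d) =
      (\<Sum>K\<in>multi N 2. ?T21 s (pair_word a b) K * Rhat_coeff N s K (pair_word c d))"
    "tmul (free_alg N) N 2 (?T21 s) (Rhat_coeff N s) (pair_word a b) (pair_word c d) \<in> carrier (free_alg N)" for s
    by (rule tmul_free, rule T21[OF w(1)], assumption, rule Rhat_coeff_closed)+
  have lhs_sum: "rtt_lhs N m n (pair_word a b) (pair_word c d) =
      (\<Sum>s\<in>{0, 1}. tmul (free_alg N) N 2 (Rhat_coeff N s) (?T12 s) (pair_word a b) (pair_word c d))"
    unfolding rtt_lhs_def by (rule free_finsum) (simp_all only: finite.intros lhs(2))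
  have rhs_sum: "rtt_rhs N m n (pair_word a b) (pair_word c d) =
      (\<Sum>s\<in>{0, 1}. tmul (free_alg N) N 2 (?T21 s) (Rhat_coeff N s) (pair_word a b) (pair_word c d))"
    unfolding rtt_rhs_def by (rule free_finsum) (simp_all only: finite.intros rhs(2))
  show ?l
    unfolding lhs_sum lhs(1) sum_multi_2
    by (rule sum.cong[OF refl], rule sum.cong[OF refl], rule sum.cong[OF refl])
      (simp only: Rhat_coeff_entry ftau_at_product assms pair_word_simps)
  show ?r
    unfolding rhs_sum rhs(1) sum_multi_2
    by (rule sum.cong[OF refl], rule sum.cong[OF refl], rule sum.cong[OF refl])
      (simp only: Rhat_coeff_entry ftau_at_product assms pair_word_simps)
  show ?lc
    unfolding rtt_lhs_def by (rule finsum_closed, rule Pi_I, rule lhs(2))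
  show ?rc
    unfolding rtt_rhs_def by (rule finsum_closed, rule Pi_I, rule rhs(2))
qed

lemma rtt_ideal: "ideal (rtt_ideal N) (free_alg N)"
proof -
  interpret ring "free_alg N" by (rule free_alg_ring)
  show ?thesis
    unfolding rtt_ideal_def
  proof (rule genideal_ideal, clarify)
    fix m n I J assume I: "I \<in> multi N 2" and J: "J \<in> multi N 2"
    have range: "I 1 \<in> {1..N}" "I 2 \<in> {1..N}" "J 1 \<in> {1..N}" "J 2 \<in> {1..N}"
      using multi_range[OF I] multi_range[OF J] by simp_all
    show "rtt_lhs N m n I J \<ominus>\<^bsub>free_alg N\<^esub> rtt_rhs N m n I J \<in> carrier (free_alg N)"
      using rtt_expand(3,4)[OF range, of m n]
      unfolding multi_2_eq[OF I, symmetric] multi_2_eq[OF J, symmetric] by (rule minus_closed)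
  qed
qed

lemma rtt_relation_mem:
  assumes "I \<in> multi N 2" "J \<in> multi N 2"
  shows "rtt_lhs N m n I J \<ominus>\<^bsub>free_alg N\<^esub> rtt_rhs N m n I J \<in> rtt_ideal N"
proof -
  interpret ring "free_alg N" by (rule free_alg_ring)
  have "{rtt_lhs N a b I J \<ominus>\<^bsub>free_alg N\<^esub> rtt_rhs N a b I J | a b I J. I \<in> multi N 2 \<and> J \<in> multi N 2}
      \<subseteq> rtt_ideal N"
    unfolding rtt_ideal_def genideal_def by blast
  then show ?thesis using assms by blast
qed

section \<open>The algebra and its truncations\<close>

lemma ring_Y: "ring (Y N)"
  unfolding Y_def by (rule ideal.quotient_is_ring[OF rtt_ideal])

definition y_class :: "nat \<Rightarrow> free \<Rightarrow> free set" where
  "y_class N f = rtt_ideal N +>\<^bsub>free_alg N\<^esub> f"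

lemma y_class_hom: "y_class N \<in> ring_hom (free_alg N) (Y N)"
  unfolding y_class_def Y_def by (rule ideal.rcos_ring_hom[OF rtt_ideal])

lemma yscal_class: "yscal N c = y_class N (fscal c)"
  by (simp add: yscal_def y_class_def)

lemma tau_class: "tau N i j r = y_class N (ftau i j r)"
  by (simp add: tau_def y_class_def)

lemma yscal_closed: "yscal N c \<in> carrier (Y N)"
  unfolding yscal_class by (rule ring_hom_closed[OF y_class_hom fscal_closed])

lemma tau_closed: "i \<in> {1..N} \<Longrightarrow> j \<in> {1..N} \<Longrightarrow> tau N i j r \<in> carrier (Y N)"
  unfolding tau_class by (rule ring_hom_closed[OF y_class_hom ftau_closed])

lemma y_class_surj: "y \<in> carrier (Y N) \<Longrightarrow> \<exists>f\<in>carrier (free_alg N). y = y_class N f"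
  by (auto simp: Y_def y_class_def FactRing_def A_RCOSETS_def')

lemma I_generators_closed:
  "{yscal N (fps_X ^ (p + 1))} \<union>
    {tau N i j (- r) | i j r. i \<in> {1..N} \<and> j \<in> {1..N} \<and> r > int p} \<subseteq> carrier (Y N)"
  using yscal_closed tau_closed by blast

lemma I_ideal: "ideal (I_ideal N p) (Y N)"
  unfolding I_ideal_def by (rule ring.genideal_ideal[OF ring_Y I_generators_closed])

lemma I_ideal_tau:
  assumes "i \<in> {1..N}" "j \<in> {1..N}" "r > int p"
  shows "tau N i j (- r) \<in> I_ideal N p"
  using ring.genideal_self[OF ring_Y I_generators_closed, of N p] assms unfolding I_ideal_def by blast

lemma I_ideal_antimono: "I_ideal N (Suc p) \<subseteq> I_ideal N p"
proof -
  interpret Y: ring "Y N" by (rule ring_Y)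
  interpret I: ideal "I_ideal N p" "Y N" by (rule I_ideal)
  have "yscal N (fps_X ^ (p + 1)) \<in> I_ideal N p"
    using Y.genideal_self[OF I_generators_closed, of p] unfolding I_ideal_def by blast
  then have "yscal N fps_X \<otimes>\<^bsub>Y N\<^esub> yscal N (fps_X ^ (p + 1)) \<in> I_ideal N p"
    by (rule I.I_l_closed) (rule yscal_closed)
  also have "yscal N fps_X \<otimes>\<^bsub>Y N\<^esub> yscal N (fps_X ^ (p + 1)) = yscal N (fps_X ^ (Suc p + 1))"
    unfolding yscal_class ring_hom_mult[OF y_class_hom fscal_closed fscal_closed, symmetric]
    by (simp add: fscal_def mult_single)
  finally have "yscal N (fps_X ^ (Suc p + 1)) \<in> I_ideal N p" .
  moreover have "tau N i j (- r) \<in> I_ideal N p" if "i \<in> {1..N}" "j \<in> {1..N}" "r > int (Suc p)" for i j r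
    using that by (intro I_ideal_tau) simp_all
  ultimately show ?thesis
    unfolding I_ideal_def[of N "Suc p"] by (intro Y.genideal_minimal[OF I_ideal]) blast
qed

abbreviation level :: "nat \<Rightarrow> nat \<Rightarrow> free set set ring" where
  "level N p \<equiv> Y N Quot I_ideal N p"

lemma ring_level: "ring (level N p)"
  by (rule ideal.quotient_is_ring[OF I_ideal])

lemma to_compl_hom: "(\<lambda>y. to_compl N y p) \<in> ring_hom (Y N) (level N p)"
  unfolding to_compl_def by (rule ideal.rcos_ring_hom[OF I_ideal])

lemma to_compl_surj: "x \<in> carrier (level N p) \<Longrightarrow> \<exists>y\<in>carrier (Y N). x = to_compl N y p"
  by (auto simp: to_compl_def FactRing_def A_RCOSETS_def')

lemma to_compl_ideal: "y \<in> I_ideal N p \<Longrightarrow> to_compl N y p = \<zero>\<^bsub>level N p\<^esub>"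
  unfolding to_compl_def FactRing_def
  using ring.a_rcos_zero[OF ring_Y I_ideal] by simp

definition level_class :: "nat \<Rightarrow> nat \<Rightarrow> free \<Rightarrow> free set set" where
  "level_class N p f = to_compl N (y_class N f) p"

lemma level_class_hom: "level_class N p \<in> ring_hom (free_alg N) (level N p)"
  using ring_hom_trans[OF y_class_hom to_compl_hom, of N p] by (simp add: level_class_def[abs_def] comp_def)

lemma level_class_surj: "x \<in> carrier (level N p) \<Longrightarrow> \<exists>f\<in>carrier (free_alg N). x = level_class N p f"
  using to_compl_surj y_class_surj unfolding level_class_def by metis

lemma level_algebra: "fps_algebra (level N p) (\<lambda>c. level_class N p (fscal c))"
  unfolding fps_algebra_def
proof (intro conjI allI ballI)
  show "ring (level N p)" by (rule ring_level)
  show "(\<lambda>c. level_class N p (fscal c)) \<in> ring_hom fps_ring (level N p)"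
    using ring_hom_trans[OF fscal_hom level_class_hom, of N p] by (simp add: comp_def)
  fix c x assume "x \<in> carrier (level N p)"
  then obtain f where f: "f \<in> carrier (free_alg N)" and x: "x = level_class N p f"
    using level_class_surj by blast
  show "level_class N p (fscal c) \<otimes>\<^bsub>level N p\<^esub> x = x \<otimes>\<^bsub>level N p\<^esub> level_class N p (fscal c)"
    unfolding x
    using ring_hom_mult[OF level_class_hom f fscal_closed, of p c]
      ring_hom_mult[OF level_class_hom fscal_closed f, of p c] fscal_central[of c f]
    by (simp only: free_alg_simps)
qed

section \<open>The currents of a truncation\<close>

text \<open>Fix \<open>p\<close> and work in the quotient by \<open>I\<^sub>p\<close>, embedded into a ring type.\<close>

locale at_level =
  fixes N p :: nat
begin

sublocale embedded_algebra "level N p" "\<lambda>c. level_class N p (fscal c)"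
  by (rule embedded_algebra.intro) (rule level_algebra)

definition Y_image :: "free set \<Rightarrow> free set set algebra_product" where
  "Y_image y = \<iota> (to_compl N y p)"

lemma to_compl_closed: "y \<in> carrier (Y N) \<Longrightarrow> to_compl N y p \<in> carrier (level N p)"
  using ring_hom_closed[OF to_compl_hom] .

lemma Y_image_mult: "x \<in> carrier (Y N) \<Longrightarrow> y \<in> carrier (Y N) \<Longrightarrow> Y_image (x \<otimes>\<^bsub>Y N\<^esub> y) = Y_image x * Y_image y"
  unfolding Y_image_def by (simp only: ring_hom_mult[OF to_compl_hom] embed_mult to_compl_closed)

lemma Y_image_zero: "Y_image \<zero>\<^bsub>Y N\<^esub> = 0"
  unfolding Y_image_def by (simp only: ring_hom_zero[OF to_compl_hom ring_Y ring_level] embed_zero)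

lemma Y_image_scalar:
  assumes "y \<in> carrier (Y N)"
  shows "Y_image (yscal N c \<otimes>\<^bsub>Y N\<^esub> y) = scalar c * Y_image y"
proof -
  have "to_compl N (yscal N c \<otimes>\<^bsub>Y N\<^esub> y) p = level_class N p (fscal c) \<otimes>\<^bsub>level N p\<^esub> to_compl N y p"
    using ring_hom_mult[OF to_compl_hom yscal_closed assms] by (simp only: level_class_def yscal_class)
  then show ?thesis
    by (simp only: Y_image_def embed_scalar[OF to_compl_closed[OF assms]])
qed

lemma Y_image_finsum:
  assumes "finite A" "\<And>a. a \<in> A \<Longrightarrow> f a \<in> carrier (Y N)"
  shows "Y_image (finsum (Y N) f A) = (\<Sum>a\<in>A. Y_image (f a))"
proof -
  have "to_compl N (finsum (Y N) f A) p = finsum (level N p) (\<lambda>a. to_compl N (f a) p) A"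
    by (rule ring_hom_finsum[OF ring_Y ring_level to_compl_hom assms])
  then show ?thesis
    unfolding Y_image_def by (simp only: embed_finsum[OF assms(1) to_compl_closed[OF assms(2)]])
qed

text \<open>The coefficient of \<open>x\<^sup>r\<close> in \<open>t\<^sub>i\<^sub>j(x)\<close>. Indices out of range give 0, so that the series are bounded for all indices.\<close>

definition gen :: "nat \<Rightarrow> nat \<Rightarrow> int \<Rightarrow> free set set algebra_product" where
  "gen i j r = (if i \<in> {1..N} \<and> j \<in> {1..N} then Y_image (tau N i j (- r)) else 0)"

lemma gen_bounded: "r > int p \<Longrightarrow> gen i j r = 0"
  using I_ideal_tau[of i N j p r] to_compl_ideal[of "tau N i j (- r)" N p]
  by (auto simp: gen_def Y_image_def embed_zero)

text \<open>The relation for the normalized matrix in the variable \<open>x/y\<close>, taken at \<open>x\<^sup>m y\<^sup>n\<^sup>-\<^sup>1\<close>, is up to the unit \<open>exp(-h/2)\<close> the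
relation for \<open>R(x, y) = y R(x/y, 1)\<close> at \<open>x\<^sup>m y\<^sup>n\<close>.\<close>

lemma gen_rtt:
  assumes "a \<in> {1..N}" "b \<in> {1..N}" "c \<in> {1..N}" "d \<in> {1..N}"
  shows "(\<Sum>e\<in>{1..N}. \<Sum>f\<in>{1..N}. scalar (r_hi a b e f) * (gen e c (m - 1) * gen f d n)
      + scalar (r_lo a b e f) * (gen e c m * gen f d (n - 1))) =
    (\<Sum>e\<in>{1..N}. \<Sum>f\<in>{1..N}. scalar (r_hi e f c d) * (gen b f n * gen a e (m - 1))
      + scalar (r_lo e f c d) * (gen b f (n - 1) * gen a e m))" (is "?l = ?r")
proof -
  interpret F: ring "free_alg N" by (rule free_alg_ring)
  let ?\<theta> = "\<lambda>f. Y_image (y_class N f)"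
  note hom = y_class_hom[of N]
  have mult: "f * g \<in> carrier (free_alg N)" if "f \<in> carrier (free_alg N)" "g \<in> carrier (free_alg N)" for f g
    using F.m_closed[OF that] by simp
  have y: "y_class N f \<in> carrier (Y N)" if "f \<in> carrier (free_alg N)" for f
    by (rule ring_hom_closed[OF hom that])
  have \<theta>_sum: "?\<theta> (\<Sum>a\<in>A. g a) = (\<Sum>a\<in>A. ?\<theta> (g a)) \<and> (\<Sum>a\<in>A. g a) \<in> carrier (free_alg N)"
    if "finite A" "\<And>a. a \<in> A \<Longrightarrow> g a \<in> carrier (free_alg N)" for A :: "nat set" and g
  proof
    have eq: "(\<Sum>a\<in>A. g a) = finsum (free_alg N) g A"
      using free_finsum[of A g N] that by simp
    show "(\<Sum>a\<in>A. g a) \<in> carrier (free_alg N)"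
      unfolding eq by (rule F.finsum_closed) (use that(2) in blast)
    show "?\<theta> (\<Sum>a\<in>A. g a) = (\<Sum>a\<in>A. ?\<theta> (g a))"
    proof -
      have "y_class N (finsum (free_alg N) g A) = finsum (Y N) (\<lambda>a. y_class N (g a)) A"
        by (rule ring_hom_finsum[OF free_alg_ring ring_Y hom that])
      then show ?thesis
        unfolding eq by (simp only: Y_image_finsum[OF that(1) y[OF that(2)]])
    qed
  qed
  have \<theta>_term: "?\<theta> (fscal q * (ftau i j (- r) * ftau k l (- r'))) = scalar q * (gen i j r * gen k l r')"
    if "i \<in> {1..N}" "j \<in> {1..N}" "k \<in> {1..N}" "l \<in> {1..N}" for q i j k l r r'
  proof -
    have t: "ftau i j (- r) \<in> carrier (free_alg N)" "ftau k l (- r') \<in> carrier (free_alg N)"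
      using that by (simp_all only: ftau_closed)
    have "y_class N (fscal q * (ftau i j (- r) * ftau k l (- r'))) =
        yscal N q \<otimes>\<^bsub>Y N\<^esub> (tau N i j (- r) \<otimes>\<^bsub>Y N\<^esub> tau N k l (- r'))"
      using ring_hom_mult[OF hom fscal_closed mult[OF t]] ring_hom_mult[OF hom t]
      unfolding free_alg_simps yscal_class tau_class by simp
    then show ?thesis
      using that ring.ring_simprules(5)[OF ring_Y tau_closed[OF that(1,2)] tau_closed[OF that(3,4)]]
      by (simp add: Y_image_scalar Y_image_mult tau_closed gen_def)
  qed
  have expand: "?\<theta> (\<Sum>s\<in>{0, 1}. \<Sum>e\<in>{1..N}. \<Sum>f\<in>{1..N}.
        fscal (C s e f) * (ftau (i e f) (j e f) (- R s) * ftau (k e f) (l e f) (- R' s))) =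
      (\<Sum>s\<in>{0, 1}. \<Sum>e\<in>{1..N}. \<Sum>f\<in>{1..N}. scalar (C s e f) * (gen (i e f) (j e f) (R s) * gen (k e f) (l e f) (R' s)))"
    if ijkl: "\<And>e f. e \<in> {1..N} \<Longrightarrow> f \<in> {1..N} \<Longrightarrow>
      i e f \<in> {1..N} \<and> j e f \<in> {1..N} \<and> k e f \<in> {1..N} \<and> l e f \<in> {1..N}"
    for C :: "nat \<Rightarrow> nat \<Rightarrow> nat \<Rightarrow> complex fps" and i j k l :: "nat \<Rightarrow> nat \<Rightarrow> nat" and R R' :: "nat \<Rightarrow> int"
  proof -
    let ?g = "\<lambda>s e f. fscal (C s e f) * (ftau (i e f) (j e f) (- R s) * ftau (k e f) (l e f) (- R' s))"
    have g: "?g s e f \<in> carrier (free_alg N)" if "e \<in> {1..N}" "f \<in> {1..N}" for s e f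
      using ijkl[OF that] by (intro mult fscal_closed ftau_closed) simp_all
    have 1: "?\<theta> (\<Sum>f\<in>{1..N}. ?g s e f) = (\<Sum>f\<in>{1..N}. ?\<theta> (?g s e f)) \<and>
        (\<Sum>f\<in>{1..N}. ?g s e f) \<in> carrier (free_alg N)" if "e \<in> {1..N}" for s e
      by (rule \<theta>_sum) (simp_all only: g that finite_atLeastAtMost)
    have 2: "?\<theta> (\<Sum>e\<in>{1..N}. \<Sum>f\<in>{1..N}. ?g s e f) = (\<Sum>e\<in>{1..N}. ?\<theta> (\<Sum>f\<in>{1..N}. ?g s e f)) \<and>
        (\<Sum>e\<in>{1..N}. \<Sum>f\<in>{1..N}. ?g s e f) \<in> carrier (free_alg N)" for s
      by (rule \<theta>_sum) (simp_all only: 1 finite_atLeastAtMost)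
    have 3: "?\<theta> (\<Sum>s\<in>{0, 1}. \<Sum>e\<in>{1..N}. \<Sum>f\<in>{1..N}. ?g s e f) =
        (\<Sum>s\<in>{0, 1}. ?\<theta> (\<Sum>e\<in>{1..N}. \<Sum>f\<in>{1..N}. ?g s e f))"
      by (rule conjunct1[OF \<theta>_sum]) (simp_all only: 2 finite.intros)
    show ?thesis
      unfolding 3 conjunct1[OF 2]
    proof (rule sum.cong[OF refl], rule sum.cong[OF refl])
      fix s e assume e: "e \<in> {1..N}"
      show "?\<theta> (\<Sum>f\<in>{1..N}. ?g s e f) =
          (\<Sum>f\<in>{1..N}. scalar (C s e f) * (gen (i e f) (j e f) (R s) * gen (k e f) (l e f) (R' s)))"
        unfolding conjunct1[OF 1[OF e]]
        by (rule sum.cong[OF refl], rule \<theta>_term) (use ijkl[OF e] in blast)+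
    qed
  qed
  let ?I = "pair_word a b" and ?J = "pair_word c d"
  have w: "?I \<in> multi N 2" "?J \<in> multi N 2"
    using assms by (simp_all add: pair_word_multi)
  have "y_class N (rtt_lhs N m (n - 1) ?I ?J) = y_class N (rtt_rhs N m (n - 1) ?I ?J)"
    unfolding y_class_def
    using F.quotient_eq_iff_same_a_r_cos[OF rtt_ideal rtt_expand(3,4)[OF assms]] rtt_relation_mem[OF w] by blast
  then have "?\<theta> (rtt_lhs N m (n - 1) ?I ?J) = ?\<theta> (rtt_rhs N m (n - 1) ?I ?J)"
    by (rule arg_cong)
  moreover have "?\<theta> (rtt_lhs N m (n - 1) ?I ?J) = (\<Sum>s\<in>{0, 1}. \<Sum>e\<in>{1..N}. \<Sum>f\<in>{1..N}.
      scalar (coeff (Rhat N a e b f) s) * (gen e c (m - int s) * gen f d (n - 1 + int s)))"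
    unfolding rtt_expand(1)[OF assms] using assms by (intro expand) simp
  moreover have "\<dots> = scalar (fps_exp (-1/2)) * ?l"
  proof -
    have "(\<Sum>s\<in>{0, 1}. \<Sum>e\<in>{1..N}. \<Sum>f\<in>{1..N}.
      scalar (coeff (Rhat N a e b f) s) * (gen e c (m - int s) * gen f d (n - 1 + int s))) =
      (\<Sum>e\<in>{1..N}. \<Sum>f\<in>{1..N}. scalar (coeff (Rhat N a e b f) 0) * (gen e c m * gen f d (n - 1))
        + scalar (coeff (Rhat N a e b f) 1) * (gen e c (m - 1) * gen f d n))"
      by (simp add: sum.distrib)
    also have "\<dots> = scalar (fps_exp (-1/2)) * ?l"
      unfolding sum_distrib_left
    proof (rule sum.cong[OF refl], rule sum.cong[OF refl])
      fix e f assume "e \<in> {1..N}" "f \<in> {1..N}"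
      from Rhat_coeffs[OF assms(1,2) this]
      show "scalar (coeff (Rhat N a e b f) 0) * (gen e c m * gen f d (n - 1))
          + scalar (coeff (Rhat N a e b f) 1) * (gen e c (m - 1) * gen f d n) =
        scalar (fps_exp (-1/2)) * (scalar (r_hi a b e f) * (gen e c (m - 1) * gen f d n)
          + scalar (r_lo a b e f) * (gen e c m * gen f d (n - 1)))"
        by (simp only: algebra_product.s_mult distrib_left mult.assoc add.commute)
    qed
    finally show ?thesis .
  qed
  moreover have "?\<theta> (rtt_rhs N m (n - 1) ?I ?J) = (\<Sum>s\<in>{0, 1}. \<Sum>e\<in>{1..N}. \<Sum>f\<in>{1..N}.
      scalar (coeff (Rhat N e c f d) s) * (gen b f (n - 1 + int s) * gen a e (m - int s)))"
    unfolding rtt_expand(2)[OF assms] fscal_central[symmetric] using assms by (intro expand) simp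
  moreover have "\<dots> = scalar (fps_exp (-1/2)) * ?r"
  proof -
    have "(\<Sum>s\<in>{0, 1}. \<Sum>e\<in>{1..N}. \<Sum>f\<in>{1..N}.
      scalar (coeff (Rhat N e c f d) s) * (gen b f (n - 1 + int s) * gen a e (m - int s))) =
      (\<Sum>e\<in>{1..N}. \<Sum>f\<in>{1..N}. scalar (coeff (Rhat N e c f d) 0) * (gen b f (n - 1) * gen a e m)
        + scalar (coeff (Rhat N e c f d) 1) * (gen b f n * gen a e (m - 1)))"
      by (simp add: sum.distrib)
    also have "\<dots> = scalar (fps_exp (-1/2)) * ?r"
      unfolding sum_distrib_left
    proof (rule sum.cong[OF refl], rule sum.cong[OF refl])
      fix e f assume "e \<in> {1..N}" "f \<in> {1..N}"
      from Rhat_coeffs[OF this assms(3,4)]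
      show "scalar (coeff (Rhat N e c f d) 0) * (gen b f (n - 1) * gen a e m)
          + scalar (coeff (Rhat N e c f d) 1) * (gen b f n * gen a e (m - 1)) =
        scalar (fps_exp (-1/2)) * (scalar (r_hi e f c d) * (gen b f n * gen a e (m - 1))
          + scalar (r_lo e f c d) * (gen b f (n - 1) * gen a e m))"
        by (simp only: algebra_product.s_mult distrib_left mult.assoc add.commute)
    qed
    finally show ?thesis .
  qed
  ultimately have "scalar (fps_exp (1/2)) * (scalar (fps_exp (-1/2)) * ?l) =
      scalar (fps_exp (1/2)) * (scalar (fps_exp (-1/2)) * ?r)"
    by (simp only:)
  then show ?thesis
    by (simp only: mult.assoc[symmetric] algebra_product.s_mult[symmetric] fps_exp_half
        algebra_product.s_one mult_1_left)
qed

sublocale cur: rtt_currents scalar N "int p" gen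
  by unfold_locales (simp_all only: gen_bounded gen_rtt)

text \<open>The image of 1 is not 1, but it acts as 1 on images.\<close>

lemma gen_unit: "gen i j r * Y_image \<one>\<^bsub>Y N\<^esub> = gen i j r"
proof (cases "i \<in> {1..N} \<and> j \<in> {1..N}")
  case True
  then have "tau N i j (- r) \<in> carrier (Y N)" by (simp only: tau_closed)
  then show ?thesis
    using Y_image_mult[of "tau N i j (- r)" "\<one>\<^bsub>Y N\<^esub>"] True ring_Y[of N]
    by (simp add: gen_def monoid.r_one[OF ring.is_monoid] monoid.one_closed[OF ring.is_monoid])
qed (auto simp: gen_def)

lemma T_coeff_image:
  assumes I: "I \<in> multi N N" and J: "J \<in> multi N N" and k: "k \<in> {1..N}"
  shows "T_coeff N k r I J \<in> carrier (Y N)"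
    and "Y_image (T_coeff N k r I J) = (if \<forall>a\<in>{1..N} - {k}. I a = J a
      then scalar (fps_exp (- of_int ((int k - 1) * r))) * gen (I k) (J k) r else 0)"
proof -
  interpret YN: ring "Y N" by (rule ring_Y)
  let ?X = "at_factor (Y N) N k (\<lambda>i j. tau N i j (- r)) I J"
  have range: "I k \<in> {1..N}" "J k \<in> {1..N}"
    using multi_range[OF I k] multi_range[OF J k] .
  have X: "?X \<in> carrier (Y N)"
    unfolding at_factor_def using tau_closed[OF range] by simp
  then show "T_coeff N k r I J \<in> carrier (Y N)"
    unfolding T_coeff_def by (intro YN.m_closed yscal_closed)
  have "Y_image ?X = (if \<forall>a\<in>{1..N} - {k}. I a = J a then gen (I k) (J k) r else 0)"
    unfolding at_factor_def gen_def if_P[OF conjI[OF range]] by (simp only: if_distrib[of Y_image] Y_image_zero)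
  then have "Y_image (T_coeff N k r I J) = scalar (fps_exp (- of_int ((int k - 1) * r))) *
      (if \<forall>a\<in>{1..N} - {k}. I a = J a then gen (I k) (J k) r else 0)"
    unfolding T_coeff_def Y_image_scalar[OF X] by (rule arg_cong)
  then show "Y_image (T_coeff N k r I J) = (if \<forall>a\<in>{1..N} - {k}. I a = J a
      then scalar (fps_exp (- of_int ((int k - 1) * r))) * gen (I k) (J k) r else 0)"
    by (simp only: if_distrib[of "\<lambda>x. scalar (fps_exp (- of_int ((int k - 1) * r))) * x"] mult_zero_right)
qed

definition factor :: "(nat \<Rightarrow> int) \<Rightarrow> (nat \<Rightarrow> nat) \<Rightarrow> (nat \<Rightarrow> nat) \<Rightarrow> nat \<Rightarrow> free set set algebra_product" where
  "factor r I J k = scalar (fps_exp (- of_int ((int k - 1) * r k))) * gen (I k) (J k) (r k)"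

lemma coeff_word_prod_list: "cur.coeff_word m I J r = prod_list (map (factor r I J) [1..<m + 1])"
  by (induction m) (simp_all add: factor_def)

text \<open>The partial products \<open>T\<^sub>m \<dots> T\<^sub>N\<close> from which the product in \<^const>\<open>T_word\<close> is built, starting from the right.\<close>

definition word_suffix :: "(nat \<Rightarrow> int) \<Rightarrow> nat \<Rightarrow> free set tmat" where
  "word_suffix r m = foldr (\<lambda>k M. tmul (Y N) N N (T_coeff N k (r k)) M) [m..<N + 1] (tone (Y N))"

text \<open>The factor \<open>T\<^sub>m\<close> only changes the \<open>m\<close>-th letter. Hence the rows and columns of \<open>T\<^sub>m \<dots> T\<^sub>N\<close> agree in the
letters before \<open>m\<close>, and in the matrix product with the next factor a single word contributes.\<close>

lemma word_suffix_image:
  assumes "1 \<le> m" "m \<le> N + 1" and I: "I \<in> multi N N" and J: "J \<in> multi N N"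
  shows "word_suffix r m I J \<in> carrier (Y N) \<and> Y_image (word_suffix r m I J) =
    (if \<forall>a\<in>{1..<m}. I a = J a then prod_list (map (factor r I J) [m..<N + 1]) * Y_image \<one>\<^bsub>Y N\<^esub> else 0)"
  using assms(2,1) I
proof (induction m arbitrary: I rule: inc_induct)
  interpret YN: ring "Y N" by (rule ring_Y)
  case base
  have eq: "(\<forall>a\<in>{1..<N + 1}. I a = J a) \<longleftrightarrow> I = J"
  proof
    assume "\<forall>a\<in>{1..<N + 1}. I a = J a"
    then show "I = J"
      using base.prems(2) J unfolding multi_def by (intro PiE_ext[of I "{1..N}" _ J]) simp_all
  qed simp
  show ?case
    unfolding eq by (simp add: word_suffix_def tone_def Y_image_zero)
next
  interpret YN: ring "Y N" by (rule ring_Y)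
  case (step m)
  have m: "m \<in> {1..N}" using step.hyps step.prems by simp
  have upt: "[m..<N + 1] = m # [Suc m..<N + 1]"
    using step.hyps by (intro upt_conv_Cons) simp
  have W: "word_suffix r m = tmul (Y N) N N (T_coeff N m (r m)) (word_suffix r (Suc m))"
    by (simp only: word_suffix_def upt foldr.simps comp_apply)
  have IH: "word_suffix r (Suc m) K J \<in> carrier (Y N)" "Y_image (word_suffix r (Suc m) K J) =
      (if \<forall>a\<in>{1..<Suc m}. K a = J a then prod_list (map (factor r K J) [Suc m..<N + 1]) * Y_image \<one>\<^bsub>Y N\<^esub> else 0)"
    if "K \<in> multi N N" for K
    using step.IH[of K] that by simp_all
  have T: "T_coeff N m (r m) I K \<in> carrier (Y N)" if "K \<in> multi N N" for K
    using T_coeff_image(1)[OF step.prems(2) that m] .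
  have closed: "T_coeff N m (r m) I K \<otimes>\<^bsub>Y N\<^esub> word_suffix r (Suc m) K J \<in> carrier (Y N)" if "K \<in> multi N N" for K
    using T[OF that] IH(1)[OF that] by (rule YN.m_closed)
  let ?K = "I(m := J m)"
  have K: "?K \<in> multi N N"
    using step.prems(2) multi_range[OF J m] m by (auto simp: multi_def PiE_iff extensional_def)
  let ?cond = "\<forall>a\<in>{1..<m}. I a = J a"
  have support: "(\<forall>a\<in>{1..N} - {m}. I a = L a) \<and> (\<forall>a\<in>{1..<Suc m}. L a = J a) \<longleftrightarrow> L = ?K \<and> ?cond"
    if L: "L \<in> multi N N" for L
  proof
    assume eq: "(\<forall>a\<in>{1..N} - {m}. I a = L a) \<and> (\<forall>a\<in>{1..<Suc m}. L a = J a)"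
    have "L a = ?K a" if "a \<in> {1..N}" for a
      using eq that m by (cases "a = m") auto
    then have "L = ?K"
      using L K unfolding multi_def by (intro PiE_ext) auto
    moreover have ?cond
    proof
      fix a assume a: "a \<in> {1..<m}"
      then have "I a = L a" "L a = J a" using eq m by auto
      then show "I a = J a" by simp
    qed
    ultimately show "L = ?K \<and> ?cond" ..
  qed auto
  have "Y_image (word_suffix r m I J) = (\<Sum>L\<in>multi N N. Y_image (T_coeff N m (r m) I L) * Y_image (word_suffix r (Suc m) L J))"
    unfolding W tmul_def
    by (subst Y_image_finsum) (simp_all add: closed Y_image_mult T IH(1))
  also have "\<dots> = (\<Sum>L\<in>multi N N. if L = ?K then (if ?cond
      then factor r I J m * (prod_list (map (factor r I J) [Suc m..<N + 1]) * Y_image \<one>\<^bsub>Y N\<^esub>) else 0) else 0)"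
  proof (rule sum.cong[OF refl])
    fix L assume L: "L \<in> multi N N"
    show "Y_image (T_coeff N m (r m) I L) * Y_image (word_suffix r (Suc m) L J) = (if L = ?K then (if ?cond
      then factor r I J m * (prod_list (map (factor r I J) [Suc m..<N + 1]) * Y_image \<one>\<^bsub>Y N\<^esub>) else 0) else 0)"
    proof (cases "L = ?K \<and> ?cond")
      case True
      have tail: "map (factor r L J) [Suc m..<N + 1] = map (factor r I J) [Suc m..<N + 1]"
        using True by (auto simp: factor_def)
      have both: "\<forall>a\<in>{1..N} - {m}. I a = L a" "\<forall>a\<in>{1..<Suc m}. L a = J a"
        using support[OF L] True by blast+
      have "L m = J m" using True by simp
      then show ?thesis
        unfolding T_coeff_image(2)[OF step.prems(2) L m] IH(2)[OF L] if_P[OF both(1)] if_P[OF both(2)] tail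
        using True by (simp add: factor_def)
    next
      case False
      then have "\<not> (\<forall>a\<in>{1..N} - {m}. I a = L a) \<or> \<not> (\<forall>a\<in>{1..<Suc m}. L a = J a)"
        using support[OF L] by blast
      then have "Y_image (T_coeff N m (r m) I L) * Y_image (word_suffix r (Suc m) L J) = 0"
        unfolding T_coeff_image(2)[OF step.prems(2) L m] IH(2)[OF L]
        by (elim disjE) (simp_all only: if_False mult_zero_left mult_zero_right)
      then show ?thesis using False by auto
    qed
  qed
  also have "\<dots> = (if ?cond then factor r I J m * (prod_list (map (factor r I J) [Suc m..<N + 1]) * Y_image \<one>\<^bsub>Y N\<^esub>) else 0)"
    using K by simp
  finally have "Y_image (word_suffix r m I J) =
      (if ?cond then prod_list (map (factor r I J) [m..<N + 1]) * Y_image \<one>\<^bsub>Y N\<^esub> else 0)"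
    by (simp only: upt list.map prod_list.Cons mult.assoc)
  moreover have "word_suffix r m I J \<in> carrier (Y N)"
    unfolding W tmul_def by (rule YN.finsum_closed) (use closed in blast)
  ultimately show ?case by blast
qed

lemma coeff_word_unit: "m \<ge> 1 \<Longrightarrow> cur.coeff_word m I J r * Y_image \<one>\<^bsub>Y N\<^esub> = cur.coeff_word m I J r"
  by (cases m) (simp_all add: mult.assoc gen_unit)

lemma T_word_image:
  assumes "N \<ge> 1" and I: "I \<in> multi N N" and J: "J \<in> multi N N"
  shows "T_word N r I J \<in> carrier (Y N)" and "Y_image (T_word N r I J) = cur.coeff_word N I J r"
proof -
  have "Y_image (T_word N r I J) = prod_list (map (factor r I J) [1..<N + 1]) * Y_image \<one>\<^bsub>Y N\<^esub>"
    "T_word N r I J \<in> carrier (Y N)"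
    using word_suffix_image[OF le_refl _ I J, of r] unfolding T_word_def word_suffix_def by auto
  moreover have "cur.coeff_word N I J r * Y_image \<one>\<^bsub>Y N\<^esub> = cur.coeff_word N I J r"
    by (rule coeff_word_unit[OF assms(1)])
  ultimately show "T_word N r I J \<in> carrier (Y N)" "Y_image (T_word N r I J) = cur.coeff_word N I J r"
    unfolding coeff_word_prod_list by simp_all
qed

end

section \<open>The completion\<close>

text \<open>The transition map sends the class of \<open>y\<close> modulo \<open>I\<^sub>p\<^sub>+\<^sub>1\<close> to its class modulo \<open>I\<^sub>p\<close>, because \<open>I\<^sub>p\<^sub>+\<^sub>1 \<subseteq> I\<^sub>p\<close>.\<close>

lemma to_compl_transition:
  assumes y: "y \<in> carrier (Y N)"
  shows "I_ideal N p <+>\<^bsub>Y N\<^esub> to_compl N y (Suc p) = to_compl N y p"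
proof -
  interpret YN: ring "Y N" by (rule ring_Y)
  interpret I: ideal "I_ideal N p" "Y N" by (rule I_ideal)
  interpret I': ideal "I_ideal N (Suc p)" "Y N" by (rule I_ideal)
  show ?thesis
  proof
    show "I_ideal N p <+>\<^bsub>Y N\<^esub> to_compl N y (Suc p) \<subseteq> to_compl N y p"
    proof
      fix x assume "x \<in> I_ideal N p <+>\<^bsub>Y N\<^esub> to_compl N y (Suc p)"
      then obtain a b where ab: "a \<in> I_ideal N p" "b \<in> I_ideal N (Suc p)"
        and x: "x = a \<oplus>\<^bsub>Y N\<^esub> (b \<oplus>\<^bsub>Y N\<^esub> y)"
        unfolding to_compl_def set_add_def' a_r_coset_def' by blast
      have "x = (a \<oplus>\<^bsub>Y N\<^esub> b) \<oplus>\<^bsub>Y N\<^esub> y"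
        unfolding x using I.Icarr[OF ab(1)] I'.Icarr[OF ab(2)] y by (rule YN.a_assoc[symmetric])
      moreover have "a \<oplus>\<^bsub>Y N\<^esub> b \<in> I_ideal N p"
        using ab I_ideal_antimono by (intro I.a_closed) auto
      ultimately show "x \<in> to_compl N y p"
        unfolding to_compl_def a_r_coset_def' by blast
    qed
    show "to_compl N y p \<subseteq> I_ideal N p <+>\<^bsub>Y N\<^esub> to_compl N y (Suc p)"
    proof
      fix x assume "x \<in> to_compl N y p"
      then obtain a where a: "a \<in> I_ideal N p" and x: "x = a \<oplus>\<^bsub>Y N\<^esub> y"
        unfolding to_compl_def a_r_coset_def' by blast
      have "x = a \<oplus>\<^bsub>Y N\<^esub> (\<zero>\<^bsub>Y N\<^esub> \<oplus>\<^bsub>Y N\<^esub> y)"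
        unfolding x using y by simp
      moreover have "\<zero>\<^bsub>Y N\<^esub> \<in> I_ideal N (Suc p)"
        by (rule additive_subgroup.zero_closed[OF I'.additive_subgroup_axioms])
      ultimately show "x \<in> I_ideal N p <+>\<^bsub>Y N\<^esub> to_compl N y (Suc p)"
        using a unfolding to_compl_def set_add_def' a_r_coset_def' by blast
    qed
  qed
qed

lemma Ycompl_carrier_iff:
  "f \<in> carrier (Ycompl N) \<longleftrightarrow> (\<forall>p. f p \<in> carrier (level N p)) \<and>
    (\<forall>p. I_ideal N p <+>\<^bsub>Y N\<^esub> f (Suc p) = f p)"
  by (simp add: Ycompl_def inverse_limit_def)

lemma Ycompl_simps:
  "f \<otimes>\<^bsub>Ycompl N\<^esub> g = (\<lambda>p. f p \<otimes>\<^bsub>level N p\<^esub> g p)"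
  "f \<oplus>\<^bsub>Ycompl N\<^esub> g = (\<lambda>p. f p \<oplus>\<^bsub>level N p\<^esub> g p)"
  "\<zero>\<^bsub>Ycompl N\<^esub> = (\<lambda>p. \<zero>\<^bsub>level N p\<^esub>)"
  by (simp_all add: Ycompl_def inverse_limit_def)

text \<open>A coherent family lifts to \<open>Y\<close> at each level separately; an operation inherited from \<open>Y\<close> therefore preserves coherence.\<close>

lemma Ycompl_closed_op:
  assumes f: "f \<in> carrier (Ycompl N)" and g: "g \<in> carrier (Ycompl N)"
    and op: "\<And>x y. x \<in> carrier (Y N) \<Longrightarrow> y \<in> carrier (Y N) \<Longrightarrow> op x y \<in> carrier (Y N)"
    and hom: "\<And>x y p. x \<in> carrier (Y N) \<Longrightarrow> y \<in> carrier (Y N) \<Longrightarrow>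
      to_compl N (op x y) p = op' p (to_compl N x p) (to_compl N y p)"
  shows "(\<lambda>p. op' p (f p) (g p)) \<in> carrier (Ycompl N)"
  unfolding Ycompl_carrier_iff
proof (intro conjI allI)
  fix p
  have "\<exists>x\<in>carrier (Y N). f q = to_compl N x q" "\<exists>x\<in>carrier (Y N). g q = to_compl N x q" for q
    using f g to_compl_surj unfolding Ycompl_carrier_iff by blast+
  then obtain x y x' y' where xy: "x \<in> carrier (Y N)" "y \<in> carrier (Y N)"
      "f p = to_compl N x p" "g p = to_compl N y p"
    and xy': "x' \<in> carrier (Y N)" "y' \<in> carrier (Y N)"
      "f (Suc p) = to_compl N x' (Suc p)" "g (Suc p) = to_compl N y' (Suc p)"
    by metis
  show "op' p (f p) (g p) \<in> carrier (level N p)"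
    unfolding xy hom[OF xy(1,2), symmetric] by (rule ring_hom_closed[OF to_compl_hom op[OF xy(1,2)]])
  have "f p = to_compl N x' p" "g p = to_compl N y' p"
    using f g to_compl_transition[OF xy'(1), of p] to_compl_transition[OF xy'(2), of p] xy'(3,4)
    unfolding Ycompl_carrier_iff by metis+
  then show "I_ideal N p <+>\<^bsub>Y N\<^esub> op' (Suc p) (f (Suc p)) (g (Suc p)) = op' p (f p) (g p)"
    unfolding xy'(3,4) by (simp only: hom[OF xy'(1,2), symmetric] to_compl_transition[OF op[OF xy'(1,2)]])
qed

lemma Ycompl_add_closed:
  "f \<in> carrier (Ycompl N) \<Longrightarrow> g \<in> carrier (Ycompl N) \<Longrightarrow> f \<oplus>\<^bsub>Ycompl N\<^esub> g \<in> carrier (Ycompl N)"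
  unfolding Ycompl_simps
  by (rule Ycompl_closed_op[where op = "add (Y N)"])
    (simp_all add: ring.ring_simprules(1)[OF ring_Y] ring_hom_add[OF to_compl_hom])

lemma Ycompl_mult_closed:
  "f \<in> carrier (Ycompl N) \<Longrightarrow> g \<in> carrier (Ycompl N) \<Longrightarrow> f \<otimes>\<^bsub>Ycompl N\<^esub> g \<in> carrier (Ycompl N)"
  unfolding Ycompl_simps
  by (rule Ycompl_closed_op[where op = "monoid.mult (Y N)"])
    (simp_all add: ring.ring_simprules(5)[OF ring_Y] ring_hom_mult[OF to_compl_hom])

lemma to_compl_Ycompl: "y \<in> carrier (Y N) \<Longrightarrow> to_compl N y \<in> carrier (Ycompl N)"
  unfolding Ycompl_carrier_iff using to_compl_transition ring_hom_closed[OF to_compl_hom] by blast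

lemma abelian_monoid_Ycompl: "abelian_monoid (Ycompl N)"
proof (rule abelian_monoidI)
  show "\<zero>\<^bsub>Ycompl N\<^esub> \<in> carrier (Ycompl N)"
  proof -
    have "to_compl N \<zero>\<^bsub>Y N\<^esub> = \<zero>\<^bsub>Ycompl N\<^esub>"
      unfolding Ycompl_simps by (rule ext) (rule ring_hom_zero[OF to_compl_hom ring_Y ring_level])
    then show ?thesis
      using to_compl_Ycompl[OF ring.ring_simprules(2)[OF ring_Y]] by metis
  qed
next
  fix f g h assume "f \<in> carrier (Ycompl N)" "g \<in> carrier (Ycompl N)" "h \<in> carrier (Ycompl N)"
  then have c: "f p \<in> carrier (level N p)" "g p \<in> carrier (level N p)" "h p \<in> carrier (level N p)" for p
    unfolding Ycompl_carrier_iff by blast+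
  show "f \<oplus>\<^bsub>Ycompl N\<^esub> g \<oplus>\<^bsub>Ycompl N\<^esub> h = f \<oplus>\<^bsub>Ycompl N\<^esub> (g \<oplus>\<^bsub>Ycompl N\<^esub> h)"
    unfolding Ycompl_simps by (rule ext) (rule ring.ring_simprules(7)[OF ring_level c])
next
  fix f assume "f \<in> carrier (Ycompl N)"
  then have c: "f p \<in> carrier (level N p)" for p
    unfolding Ycompl_carrier_iff by blast
  show "\<zero>\<^bsub>Ycompl N\<^esub> \<oplus>\<^bsub>Ycompl N\<^esub> f = f"
    unfolding Ycompl_simps by (rule ext) (rule ring.ring_simprules(8)[OF ring_level c])
next
  fix f g assume "f \<in> carrier (Ycompl N)" "g \<in> carrier (Ycompl N)"
  then have c: "f p \<in> carrier (level N p)" "g p \<in> carrier (level N p)" for p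
    unfolding Ycompl_carrier_iff by blast+
  show "f \<oplus>\<^bsub>Ycompl N\<^esub> g = g \<oplus>\<^bsub>Ycompl N\<^esub> f"
    unfolding Ycompl_simps by (rule ext) (rule ring.ring_simprules(10)[OF ring_level c])
qed (rule Ycompl_add_closed)

lemma Ycompl_finsum:
  assumes "finite A" "\<And>a. a \<in> A \<Longrightarrow> f a \<in> carrier (Ycompl N)"
  shows "finsum (Ycompl N) f A \<in> carrier (Ycompl N)"
    and "finsum (Ycompl N) f A p = finsum (level N p) (\<lambda>a. f a p) A"
proof -
  interpret abelian_monoid "Ycompl N" by (rule abelian_monoid_Ycompl)
  interpret level: ring "level N p" by (rule ring_level)
  show "finsum (Ycompl N) f A \<in> carrier (Ycompl N)"
    using assms(2) by (intro finsum_closed) auto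
  show "finsum (Ycompl N) f A p = finsum (level N p) (\<lambda>a. f a p) A"
    using assms
  proof (induction A)
    case empty
    then show ?case by (simp only: finsum_empty level.finsum_empty Ycompl_simps)
  next
    case (insert a A)
    have "finsum (Ycompl N) f (insert a A) = f a \<oplus>\<^bsub>Ycompl N\<^esub> finsum (Ycompl N) f A"
      using insert by (intro finsum_insert) auto
    moreover have "f b p \<in> carrier (level N p)" if "b \<in> insert a A" for b
      using insert.prems[OF that] unfolding Ycompl_carrier_iff by blast
    then have "finsum (level N p) (\<lambda>a. f a p) (insert a A) =
        f a p \<oplus>\<^bsub>level N p\<^esub> finsum (level N p) (\<lambda>a. f a p) A"
      using insert.hyps by (intro level.finsum_insert) auto
    ultimately show ?case
      using insert by (simp only: Ycompl_simps insertI2)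
  qed
qed

text \<open>At a fixed level the infinite sum may be computed over any finite set that contains all terms which are nonzero there.\<close>

lemma compl_sum_eq:
  assumes f: "\<And>a. a \<in> A \<Longrightarrow> f a \<in> carrier (Y N)" and B: "finite B" "B \<subseteq> A"
    and zero: "\<And>a. a \<in> A - B \<Longrightarrow> to_compl N (f a) p = \<zero>\<^bsub>level N p\<^esub>"
  shows "compl_sum N f A p = to_compl N (finsum (Y N) f B) p"
proof -
  interpret level: ring "level N p" by (rule ring_level)
  let ?S = "{a \<in> A. to_compl N (f a) p \<noteq> \<zero>\<^bsub>level N p\<^esub>}"
  have S: "?S \<subseteq> B" using zero by blast
  have "compl_sum N f A p = finsum (level N p) (\<lambda>a. to_compl N (f a) p) ?S"
    by (simp only: compl_sum_def)
  also have "\<dots> = finsum (level N p) (\<lambda>a. to_compl N (f a) p) B"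
    by (rule level.add.finprod_mono_neutral_cong_left[OF B(1) S])
      (use B f ring_hom_closed[OF to_compl_hom] in auto)
  also have "\<dots> = to_compl N (finsum (Y N) f B) p"
    using B f by (intro ring_hom_finsum[OF ring_Y ring_level to_compl_hom, symmetric]) auto
  finally show ?thesis .
qed

section \<open>The series in the completion\<close>

context at_level
begin

lemma coeff_word_vanishes: "k \<in> {1..m} \<Longrightarrow> r k > int p \<Longrightarrow> cur.coeff_word m I J r = 0"
proof (induction m)
  case (Suc m)
  then show ?case by (cases "k = Suc m") (auto simp: gen_bounded)
qed simp

lemma exponents_subset:
  "cur.exponents N n \<subseteq> {r \<in> {1..N} \<rightarrow>\<^sub>E UNIV. (\<Sum>k\<in>{1..N}. r k) = n}"
  by (auto simp: cur.exponents_def PiE_iff)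

text \<open>A word with an exponent larger than \<open>p\<close> contains a generator of \<open>I\<^sub>p\<close>.\<close>

lemma T_word_negligible:
  assumes "N \<ge> 1" "I \<in> multi N N" "J \<in> multi N N"
    and r: "r \<in> {r \<in> {1..N} \<rightarrow>\<^sub>E UNIV. (\<Sum>k\<in>{1..N}. r k) = n} - cur.exponents N n"
  shows "to_compl N (T_word N r I J) p = \<zero>\<^bsub>level N p\<^esub>"
proof -
  have "\<not> (\<forall>k\<in>{1..N}. r k \<le> int p)"
    using r unfolding cur.exponents_def PiE_iff by blast
  then have "\<exists>k\<in>{1..N}. r k > int p"
    unfolding linorder_not_le[symmetric] by blast
  then have "Y_image (T_word N r I J) = 0"
    unfolding T_word_image(2)[OF assms(1-3)] using coeff_word_vanishes by blast
  then have "\<iota> (to_compl N (T_word N r I J) p) = \<iota> \<zero>\<^bsub>level N p\<^esub>"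
    by (simp only: Y_image_def embed_zero)
  then show ?thesis
    by (rule embed_inject[rotated 2]) (simp_all only: to_compl_closed T_word_image(1)[OF assms(1-3)] zero_closed)
qed

lemma T_prod_eq:
  assumes "N \<ge> 1" "I \<in> multi N N" "J \<in> multi N N"
    and B: "finite B" "cur.exponents N n \<subseteq> B" "B \<subseteq> {r \<in> {1..N} \<rightarrow>\<^sub>E UNIV. (\<Sum>k\<in>{1..N}. r k) = n}"
  shows "T_prod N n I J p = to_compl N (finsum (Y N) (\<lambda>r. T_word N r I J) B) p"
  unfolding T_prod_def
proof (rule compl_sum_eq[OF _ B(1) B(3)])
  show "T_word N r I J \<in> carrier (Y N)" for r
    by (rule T_word_image(1)[OF assms(1-3)])
  show "to_compl N (T_word N r I J) p = \<zero>\<^bsub>level N p\<^esub>"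
    if "r \<in> {r \<in> {1..N} \<rightarrow>\<^sub>E UNIV. (\<Sum>k\<in>{1..N}. r k) = n} - B" for r
    using that B(2) by (intro T_word_negligible[OF assms(1-3)]) blast
qed

lemma T_prod_image:
  assumes "N \<ge> 1" "I \<in> multi N N" "J \<in> multi N N"
  shows "\<iota> (T_prod N n I J p) = cur.current_word N I J $$ (- n)"
proof -
  have "\<iota> (T_prod N n I J p) = Y_image (finsum (Y N) (\<lambda>r. T_word N r I J) (cur.exponents N n))"
    unfolding T_prod_eq[OF assms cur.finite_exponents subset_refl exponents_subset] Y_image_def ..
  also have "\<dots> = (\<Sum>r\<in>cur.exponents N n. cur.coeff_word N I J r)"
    by (simp only: Y_image_finsum[OF cur.finite_exponents T_word_image(1)[OF assms]] T_word_image(2)[OF assms])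
  also have "\<dots> = cur.current_word N I J $$ (- n)"
    by (rule cur.current_word_coeff[symmetric])
  finally show ?thesis .
qed

end

text \<open>Modulo both \<open>I\<^sub>p\<close> and \<open>I\<^sub>p\<^sub>+\<^sub>1\<close>, the sum is the class of one and the same finite sum, over exponents at most \<open>p + 1\<close>.\<close>

lemma T_prod_closed:
  assumes "N \<ge> 1" "I \<in> multi N N" "J \<in> multi N N"
  shows "T_prod N n I J \<in> carrier (Ycompl N)"
  unfolding Ycompl_carrier_iff
proof (intro conjI allI)
  fix p
  interpret L: at_level N p .
  interpret L': at_level N "Suc p" .
  interpret YN: ring "Y N" by (rule ring_Y)
  let ?y = "finsum (Y N) (\<lambda>r. T_word N r I J) (L'.cur.exponents N n)"
  have y: "?y \<in> carrier (Y N)"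
    using L.T_word_image(1)[OF assms] by (intro YN.finsum_closed) blast
  have "L.cur.exponents N n \<subseteq> L'.cur.exponents N n"
    unfolding L.cur.exponents_def L'.cur.exponents_def using PiE_mono[of "{1..N}" "\<lambda>_. {..int p}" "\<lambda>_. {..int (Suc p)}"]
    by auto
  then have "T_prod N n I J p = to_compl N ?y p"
    by (rule L.T_prod_eq[OF assms L'.cur.finite_exponents _ L'.exponents_subset])
  moreover have "T_prod N n I J (Suc p) = to_compl N ?y (Suc p)"
    by (rule L'.T_prod_eq[OF assms L'.cur.finite_exponents subset_refl L'.exponents_subset])
  ultimately show "T_prod N n I J p \<in> carrier (level N p)"
    "I_ideal N p <+>\<^bsub>Y N\<^esub> T_prod N n I J (Suc p) = T_prod N n I J p"
    using to_compl_transition[OF y] L.to_compl_closed[OF y] by simp_all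
qed

lemma TT_summand_closed:
  assumes "N \<ge> 1" "I \<in> multi N N" "K \<in> multi N N"
  shows "to_compl N (yscal N c) \<otimes>\<^bsub>Ycompl N\<^esub> T_prod N n K I \<in> carrier (Ycompl N)"
  by (rule Ycompl_mult_closed[OF to_compl_Ycompl[OF yscal_closed] T_prod_closed[OF assms(1,3,2)]])

lemma TT_entry_closed:
  assumes "N \<ge> 1" "I \<in> multi N N"
  shows "tmul (Ycompl N) N N (\<lambda>I J. to_compl N (yscal N (antisymmetrizer N I J))) (T_prod N n) I I
    \<in> carrier (Ycompl N)"
  unfolding tmul_def by (rule Ycompl_finsum(1)[OF finite_multi TT_summand_closed[OF assms]])

lemma TT_closed: "N \<ge> 1 \<Longrightarrow> TT N n \<in> carrier (Ycompl N)"
  unfolding TT_def ttrace_def by (rule Ycompl_finsum(1)[OF finite_multi TT_entry_closed])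

context at_level
begin

text \<open>Since the rows of the antisymmetrizer are multiples of \<open>\<epsilon>\<close> and \<open>\<epsilon> T\<^sub>1 \<dots> T\<^sub>N = D \<epsilon>\<close>, the diagonal entries of
\<open>A T\<^sub>1 \<dots> T\<^sub>N\<close> are those of \<open>A\<close> times \<open>D\<close>. The coefficient of \<open>z\<^sup>n\<close> has degree \<open>-n\<close> in \<open>1/z\<close>.\<close>

lemma TT_image:
  assumes N: "N \<ge> 1"
  shows "\<iota> (TT N n p) = scalar (\<Sum>I\<in>multi N N. antisymmetrizer N I I) * cur.current_qdet $$ (- n)"
proof -
  let ?A = "antisymmetrizer N" and ?M = "multi N N"
  have closed: "f p \<in> carrier (level N p)" if "f \<in> carrier (Ycompl N)" for f
    using that unfolding Ycompl_carrier_iff by blast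
  have summand: "\<iota> ((to_compl N (yscal N (?A I K)) \<otimes>\<^bsub>Ycompl N\<^esub> T_prod N n K I) p) =
      scalar (?A I K) * cur.current_word N K I $$ (- n)" if "I \<in> ?M" "K \<in> ?M" for I K
  proof -
    have "(to_compl N (yscal N (?A I K)) \<otimes>\<^bsub>Ycompl N\<^esub> T_prod N n K I) p =
        level_class N p (fscal (?A I K)) \<otimes>\<^bsub>level N p\<^esub> T_prod N n K I p"
      by (simp only: Ycompl_simps level_class_def yscal_class)
    then show ?thesis
      by (simp only: embed_scalar[OF closed[OF T_prod_closed[OF N that(2,1)]]] T_prod_image[OF N that(2,1)])
  qed
  have entry: "\<iota> (tmul (Ycompl N) N N (\<lambda>I J. to_compl N (yscal N (?A I J))) (T_prod N n) I I p) =
      scalar (?A I I) * cur.current_qdet $$ (- n)" if I: "I \<in> ?M" for I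
  proof -
    have "\<iota> (tmul (Ycompl N) N N (\<lambda>I J. to_compl N (yscal N (?A I J))) (T_prod N n) I I p)
      = (\<Sum>K\<in>?M. scalar (?A I K) * cur.current_word N K I $$ (- n))"
    proof -
      let ?f = "\<lambda>K. to_compl N (yscal N (?A I K)) \<otimes>\<^bsub>Ycompl N\<^esub> T_prod N n K I"
      have f: "?f K \<in> carrier (Ycompl N)" if "K \<in> ?M" for K
        by (rule TT_summand_closed[OF N I that])
      have eq: "finsum (Ycompl N) ?f ?M p = finsum (level N p) (\<lambda>K. ?f K p) ?M"
        by (rule Ycompl_finsum(2)[OF finite_multi f])
      have "\<iota> (finsum (Ycompl N) ?f ?M p) = (\<Sum>K\<in>?M. \<iota> (?f K p))"
        unfolding eq by (rule embed_finsum[OF finite_multi closed[OF f]])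
      also have "\<dots> = (\<Sum>K\<in>?M. scalar (?A I K) * cur.current_word N K I $$ (- n))"
        by (rule sum.cong[OF refl summand[OF I]])
      finally show ?thesis unfolding tmul_def .
    qed
    also have "\<dots> = scalar (?A I (id_word N)) *
        (\<Sum>K\<in>?M. scalar (q_sign N K) * cur.current_word N K I $$ (- n))"
      unfolding sum_distrib_left
      by (rule sum.cong[OF refl])
        (simp only: antisymmetrizer_row[OF I] algebra_product.s_mult mult.assoc)
    also have "\<dots> = scalar (?A I (id_word N)) * (scalar (q_sign N I) * cur.current_qdet $$ (- n))"
      by (simp only: cur.current_word_skew[OF I])
    also have "\<dots> = scalar (?A I I) * cur.current_qdet $$ (- n)"
      by (simp only: antisymmetrizer_row[OF I I] algebra_product.s_mult mult.assoc)
    finally show ?thesis .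
  qed
  let ?f = "\<lambda>I. tmul (Ycompl N) N N (\<lambda>I J. to_compl N (yscal N (?A I J))) (T_prod N n) I I"
  have f: "?f I \<in> carrier (Ycompl N)" if "I \<in> ?M" for I
    by (rule TT_entry_closed[OF N that])
  have eq: "finsum (Ycompl N) ?f ?M p = finsum (level N p) (\<lambda>I. ?f I p) ?M"
    by (rule Ycompl_finsum(2)[OF finite_multi f])
  have "\<iota> (finsum (Ycompl N) ?f ?M p) = (\<Sum>I\<in>?M. \<iota> (?f I p))"
    unfolding eq by (rule embed_finsum[OF finite_multi closed[OF f]])
  also have "\<dots> = (\<Sum>I\<in>?M. scalar (?A I I) * cur.current_qdet $$ (- n))"
    by (rule sum.cong[OF refl entry])
  finally show ?thesis
    unfolding TT_def ttrace_def algebra_product.s_sum sum_distrib_right .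
qed

text \<open>The elements that commute with a given one form a subalgebra, and the generators are among them.\<close>

lemma TT_commutes:
  assumes N: "N \<ge> 1" and f: "f \<in> carrier (free_alg N)"
  shows "TT N n p \<otimes>\<^bsub>level N p\<^esub> level_class N p f = level_class N p f \<otimes>\<^bsub>level N p\<^esub> TT N n p"
proof -
  have T: "TT N n p \<in> carrier (level N p)"
    using TT_closed[OF N, of n] unfolding Ycompl_carrier_iff by blast
  have c: "level_class N p g \<in> carrier (level N p)" if "g \<in> carrier (free_alg N)" for g
    by (rule ring_hom_closed[OF level_class_hom that])
  show ?thesis
  proof (rule free_alg_induct[OF f])
    fix f g assume f: "f \<in> carrier (free_alg N)" and g: "g \<in> carrier (free_alg N)"
      and comm: "TT N n p \<otimes>\<^bsub>level N p\<^esub> level_class N p f = level_class N p f \<otimes>\<^bsub>level N p\<^esub> TT N n p"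
        "TT N n p \<otimes>\<^bsub>level N p\<^esub> level_class N p g = level_class N p g \<otimes>\<^bsub>level N p\<^esub> TT N n p"
    have "level_class N p (f + g) = level_class N p f \<oplus>\<^bsub>level N p\<^esub> level_class N p g"
      using ring_hom_add[OF level_class_hom f g] by simp
    then show "TT N n p \<otimes>\<^bsub>level N p\<^esub> level_class N p (f + g) = level_class N p (f + g) \<otimes>\<^bsub>level N p\<^esub> TT N n p"
      by (simp only: r_distr[OF c[OF f] c[OF g] T] l_distr[OF c[OF f] c[OF g] T] comm)
    have fg: "level_class N p (f * g) = level_class N p f \<otimes>\<^bsub>level N p\<^esub> level_class N p g"
      using ring_hom_mult[OF level_class_hom f g] by simp
    have "TT N n p \<otimes>\<^bsub>level N p\<^esub> (level_class N p f \<otimes>\<^bsub>level N p\<^esub> level_class N p g)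
      = level_class N p f \<otimes>\<^bsub>level N p\<^esub> (TT N n p \<otimes>\<^bsub>level N p\<^esub> level_class N p g)"
      using m_assoc[OF T c[OF f] c[OF g]] m_assoc[OF c[OF f] T c[OF g]] comm(1) by simp
    also have "\<dots> = (level_class N p f \<otimes>\<^bsub>level N p\<^esub> level_class N p g) \<otimes>\<^bsub>level N p\<^esub> TT N n p"
      using m_assoc[OF c[OF f] c[OF g] T] comm(2) by simp
    finally show "TT N n p \<otimes>\<^bsub>level N p\<^esub> level_class N p (f * g) = level_class N p (f * g) \<otimes>\<^bsub>level N p\<^esub> TT N n p"
      unfolding fg .
  next
    fix q
    show "TT N n p \<otimes>\<^bsub>level N p\<^esub> level_class N p (fscal q) = level_class N p (fscal q) \<otimes>\<^bsub>level N p\<^esub> TT N n p"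
      by (rule fps_algebra_scalar(5)[OF level_algebra T, symmetric])
  next
    fix i j r assume ij: "i \<in> {1..N}" "j \<in> {1..N}"
    have t: "level_class N p (ftau i j r) \<in> carrier (level N p)"
      by (rule c[OF ftau_closed[OF ij]])
    have gen: "\<iota> (level_class N p (ftau i j r)) = gen i j (- r)"
      unfolding gen_def if_P[OF conjI[OF ij]] unfolding group_add_class.minus_minus by (simp only: Y_image_def level_class_def tau_class)
    have "gen i j (- r) * (scalar c * cur.current_qdet $$ (- n)) = scalar c * cur.current_qdet $$ (- n) * gen i j (- r)" for c
      unfolding algebra_product.s_left_commute[of "gen i j (- r)"] cur.current_qdet_central[OF ij]
      by (rule mult.assoc[symmetric])
    then have "\<iota> (TT N n p \<otimes>\<^bsub>level N p\<^esub> level_class N p (ftau i j r)) =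
        \<iota> (level_class N p (ftau i j r) \<otimes>\<^bsub>level N p\<^esub> TT N n p)"
      unfolding embed_mult[OF T t] embed_mult[OF t T] gen TT_image[OF N] by (rule sym)
    then show "TT N n p \<otimes>\<^bsub>level N p\<^esub> level_class N p (ftau i j r) = level_class N p (ftau i j r) \<otimes>\<^bsub>level N p\<^esub> TT N n p"
      by (rule embed_inject[OF m_closed[OF T t] m_closed[OF t T]])
  qed
qed

end

theorem theorem8p3:
  fixes N :: nat and n :: int
  assumes "N \<ge> 2"
  shows "TT N n \<in> ring_center (Ycompl N)"
  unfolding ring_center_def
proof (intro CollectI conjI ballI)
  have N: "N \<ge> 1" using assms by simp
  show "TT N n \<in> carrier (Ycompl N)"
    by (rule TT_closed[OF N])
  fix x assume x: "x \<in> carrier (Ycompl N)"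
  show "TT N n \<otimes>\<^bsub>Ycompl N\<^esub> x = x \<otimes>\<^bsub>Ycompl N\<^esub> TT N n"
    unfolding Ycompl_simps
  proof
    fix p
    interpret at_level N p .
    obtain f where "f \<in> carrier (free_alg N)" "x p = level_class N p f"
      using x level_class_surj unfolding Ycompl_carrier_iff by blast
    then show "TT N n p \<otimes>\<^bsub>level N p\<^esub> x p = x p \<otimes>\<^bsub>level N p\<^esub> TT N n p"
      using TT_commutes[OF N] by simp
  qed
qed

end
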